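(* Let $\phi\in\Phi^2\setminus\{0\}$, written as $\phi=\operatorname{per}_B+\alpha\operatorname{vol}$ with $B\in\mathcal{S}^2$ and $\alpha\ge0$, and let $K$ be a planar convex body. Then the following assertions hold: (I) Almost everywhere on $\mathbb{R}^2$, in the sense of Lebesgue measure, $$g_{K,\phi}=\mathbf{1}_K*\delta^B_{-\operatorname{bd}K}+\delta^B_{\operatorname{bd}K}*\mathbf{1}_{-K}+\alpha\,\mathbf{1}_K*\mathbf{1}_{-K}=\Bigl(\delta^B_{-\operatorname{bd}K}+\tfrac{\alpha}{2}\mathbf{1}_{-K}\Bigr)*\mathbf{1}_K+\Bigl(\delta^B_{\operatorname{bd}K}+\tfrac{\alpha}{2}\mathbf{1}_K\Bigr)*\mathbf{1}_{-K}.$$ (II) $\int_{\mathbb{R}^2}g_{K,\phi}(x)\,dx=\operatorname{vol}(K)\bigl(2\operatorname{per}_B(K)+\alpha\operatorname{vol}(K)\bigr)$. (III) $\operatorname{supp}g_{K,\phi}=DK$. (IV) $g_{K,\operatorname{per}_B}$ and $\sqrt{g_K}$ are concave on $DK$.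
   Context: $\mathcal{K}^2$ is the set of all compact convex subsets of $\mathbb{R}^2$ (including $\emptyset$); a planar convex body is an element of $\mathcal{K}^2$ with nonempty interior. $\Phi^2$ is the set of all functionals $\phi:\mathcal{K}^2\to\mathbb{R}$ that are valuations ($\phi(\emptyset)=0$ and $\phi(K\cup H)=\phi(K)+\phi(H)-\phi(K\cap H)$ whenever $K,H,K\cup H\in\mathcal{K}^2$), translation invariant, monotone with respect to inclusion, even ($\phi(-K)=\phi(K)$), and satisfy $\phi(\{o\})=0$. $\mathcal{S}^2$ is the set of closed convex $B\subset\mathbb{R}^2$ with $B=-B$ and nonempty interior. For $B\in\mathcal{S}^2$, $\|x\|_B=\inf\{\alpha>0:x\in\alpha B\}$ and $\operatorname{len}_B(\gamma)=\int_\gamma\|dx\|_B$ is the length of a rectifiable curve in this seminorm, $\operatorname{len}_B(\emptyset)=0$; $\operatorname{per}_B(K)=\operatorname{len}_B(\operatorname{bd}K)$ if $\operatorname{int}K\neq\emptyset$, and $\operatorname{per}_B(K)=2\operatorname{len}_B(K)$ otherwise. Every $\phi\in\Phi^2$ has a unique representation $\phi=\operatorname{per}_B+\alpha\operatorname{vol}$ with $B\in\mathcal{S}^2$, $\alpha\ge0$, where $\operatorname{vol}$ is area. For a valuation $\phi$, $g_{K,\phi}(x)=\phi(K\cap(K+x))$ for $x\in\mathbb{R}^2$; $g_{K,\operatorname{per}_B}$ is the case $\phi=\operatorname{per}_B$ and $g_K$ the case $\phi=\operatorname{vol}$. $\mathbf{1}_A$ is the characteristic function of $A$. For a rectifiable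 curve $\gamma$, $\delta^B_\gamma$ is the Borel measure (distribution) given by $(\delta^B_\gamma,\tau)=\int_\gamma\tau(x)\,\|dx\|_B$ for $\tau\in C^\infty(\mathbb{R}^2)$; $*$ is convolution (of distributions). $DK=\{x-y:x,y\in K\}$. *)

theory Defs
  imports "HOL-Probability.Probability"
begin

section \<open>Valuations on planar convex sets\<close>

definition convex_compacts :: "(real^2) set set" where
  "convex_compacts = {K. compact K \<and> convex K}"

definition planar_convex_body :: "(real^2) set \<Rightarrow> bool" where
  "planar_convex_body K \<longleftrightarrow> K \<in> convex_compacts \<and> interior K \<noteq> {}"

definition valuation :: "((real^2) set \<Rightarrow> real) \<Rightarrow> bool" where
  "valuation \<phi> \<longleftrightarrow> \<phi> {} = 0 \<and>
    (\<forall>K\<in>convex_compacts. \<forall>H\<in>convex_compacts. K \<union> H \<in> convex_compacts \<longrightarrow>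
       \<phi> (K \<union> H) = \<phi> K + \<phi> H - \<phi> (K \<inter> H))"

text \<open>Functionals are total on sets of points; only their values on \<^const>\<open>convex_compacts\<close>
  carry meaning.\<close>

definition Phi2 :: "((real^2) set \<Rightarrow> real) set" where
  "Phi2 = {\<phi>. valuation \<phi>
    \<and> (\<forall>K\<in>convex_compacts. \<forall>x. \<phi> ((\<lambda>y. y + x) ` K) = \<phi> K)
    \<and> (\<forall>K\<in>convex_compacts. \<forall>H\<in>convex_compacts. K \<subseteq> H \<longrightarrow> \<phi> K \<le> \<phi> H)
    \<and> (\<forall>K\<in>convex_compacts. \<phi> (uminus ` K) = \<phi> K)
    \<and> \<phi> {0} = 0}"

definition vol :: "(real^2) set \<Rightarrow> real" where
  "vol K = measure lebesgue K"

definition covariogram :: "((real^2) set \<Rightarrow> real) \<Rightarrow> (real^2) set \<Rightarrow> real^2 \<Rightarrow> real" where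
  "covariogram \<phi> K x = \<phi> (K \<inter> (\<lambda>y. y + x) ` K)"

definition difference_body :: "(real^2) set \<Rightarrow> (real^2) set" where
  "difference_body K = {x - y |x y. x \<in> K \<and> y \<in> K}"

section \<open>Length with respect to a seminorm\<close>

text \<open>The sets below may be unbounded, so their gauge is in general only a seminorm.\<close>

definition S2 :: "(real^2) set set" where
  "S2 = {B. closed B \<and> convex B \<and> uminus ` B = B \<and> interior B \<noteq> {}}"

definition gauge_norm :: "(real^2) set \<Rightarrow> real^2 \<Rightarrow> real" where
  "gauge_norm B x = Inf {a. a > 0 \<and> x \<in> (\<lambda>y. a *\<^sub>R y) ` B}"

definition inscribed_lengths ::
    "(real^2 \<Rightarrow> real) \<Rightarrow> (real \<Rightarrow> real^2) \<Rightarrow> real \<Rightarrow> real \<Rightarrow> real set" where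
  "inscribed_lengths N \<gamma> a b =
    {\<Sum>i<length ts - 1. N (\<gamma> (ts ! Suc i) - \<gamma> (ts ! i)) |ts. sorted ts \<and> set ts \<subseteq> {a..b}}"

definition rectifiable :: "(real \<Rightarrow> real^2) \<Rightarrow> bool" where
  "rectifiable \<gamma> \<longleftrightarrow> bdd_above (inscribed_lengths norm \<gamma> 0 1)"

text \<open>The integral of \<open>\<parallel>dx\<parallel>\<^sub>B\<close> along the part of \<open>\<gamma>\<close> with parameters in \<open>{a..b}\<close>.\<close>

definition path_len :: "(real^2) set \<Rightarrow> (real \<Rightarrow> real^2) \<Rightarrow> real \<Rightarrow> real \<Rightarrow> real" where
  "path_len B \<gamma> a b = Sup (inscribed_lengths (gauge_norm B) \<gamma> a b)"

text \<open>The measure \<open>\<tau> \<mapsto> \<integral>\<^sub>\<gamma> \<tau>(x) \<parallel>dx\<parallel>\<^sub>B\<close>: the image under \<open>\<gamma>\<close> of the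
  Lebesgue-Stieltjes measure of the arc-length function of \<open>\<gamma>\<close>, the latter being extended to the
  real line by constants.\<close>

definition path_measure :: "(real^2) set \<Rightarrow> (real \<Rightarrow> real^2) \<Rightarrow> (real^2) measure" where
  "path_measure B \<gamma> =
    distr (restrict_space (interval_measure (\<lambda>t. path_len B \<gamma> 0 (max 0 (min 1 t)))) {0..1})
      borel \<gamma>"

text \<open>Curves occur as point sets: boundaries of convex bodies, segments, and single points. Such a
  set is traversed once by a simple (open or closed) path, or by a constant path if it is a point.
  Length and length measure do not depend on the simple parametrization that is chosen.\<close>

definition parametrizes :: "(real \<Rightarrow> real^2) \<Rightarrow> (real^2) set \<Rightarrow> bool" where
  "parametrizes \<gamma> C \<longleftrightarrow> path \<gamma> \<and> path_image \<gamma> = C \<and> rectifiable \<gamma> \<and>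
    (simple_path \<gamma> \<or> (\<exists>p. C = {p}))"

definition param_of :: "(real^2) set \<Rightarrow> real \<Rightarrow> real^2" where
  "param_of C = (SOME \<gamma>. parametrizes \<gamma> C)"

definition len :: "(real^2) set \<Rightarrow> (real^2) set \<Rightarrow> real" where
  "len B C = (if C = {} then 0 else path_len B (param_of C) 0 1)"

definition curve_measure :: "(real^2) set \<Rightarrow> (real^2) set \<Rightarrow> (real^2) measure" where
  "curve_measure B C = path_measure B (param_of C)"

definition per :: "(real^2) set \<Rightarrow> (real^2) set \<Rightarrow> real" where
  "per B K = (if interior K \<noteq> {} then len B (frontier K) else 2 * len B K)"

section \<open>Convolution\<close>

text \<open>All distributions involved are finite Borel measures of compact support, and their
  convolution is that of measures, \<^const>\<open>convolution\<close>. A function is regarded as a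
  distribution through its density with respect to Lebesgue measure.\<close>

definition char_measure :: "(real^2) set \<Rightarrow> (real^2) measure" where
  "char_measure A = density lborel (indicator A)"

definition measure_add :: "'a measure \<Rightarrow> 'a measure \<Rightarrow> 'a measure" where
  "measure_add M N = measure_of (space M) (sets M) (\<lambda>A. emeasure M A + emeasure N A)"

lemma space_measure_add [simp]: "space (measure_add M N) = space M"
  by (simp add: measure_add_def)

lemma sets_measure_add [simp]: "sets (measure_add M N) = sets M"
  by (simp add: measure_add_def)

lemma emeasure_measure_add:
  assumes [simp]: "sets N = sets M" and A: "A \<in> sets M"
  shows "emeasure (measure_add M N) A = emeasure M A + emeasure N A"
proof -
  have "countably_additive (sets M) (\<lambda>A. emeasure M A + emeasure N A)"
  proof (rule countably_additiveI)
    fix F :: "nat \<Rightarrow> 'a set"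
    assume F: "range F \<subseteq> sets M" and d: "disjoint_family F" "\<Union> (range F) \<in> sets M"
    have "(\<Sum>i. emeasure M (F i) + emeasure N (F i))
        = (\<Sum>i. emeasure M (F i)) + (\<Sum>i. emeasure N (F i))"
      by (intro suminf_add [symmetric]) auto
    then show "(\<Sum>i. emeasure M (F i) + emeasure N (F i))
        = emeasure M (\<Union> (range F)) + emeasure N (\<Union> (range F))"
      using F d by (simp add: suminf_emeasure)
  qed
  then show ?thesis
    unfolding measure_add_def using A
    by (intro emeasure_measure_of_sigma) (auto simp: sets.sigma_algebra_axioms positive_def)
qed

text \<open>The measure \<open>\<mu>\<close>, seen as a distribution, is a nonnegative function that equals \<open>g\<close> almost
  everywhere.\<close>

definition ae_equals_measure :: "(real^2 \<Rightarrow> real) \<Rightarrow> (real^2) measure \<Rightarrow> bool" where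
  "ae_equals_measure g \<mu> \<longleftrightarrow>
    (\<exists>h. h \<in> borel_measurable borel \<and> (\<forall>x. 0 \<le> h x) \<and>
         \<mu> = density lborel (\<lambda>x. ennreal (h x)) \<and>
         (AE x in lebesgue. g x = h x))"

end

theory Submission
  imports Defs
begin

text \<open>Write \<open>N\<close> for the gauge seminorm of \<open>B\<close>. For \<open>N = \<bar>u \<bullet> _\<bar>\<close> everything reduces to counting points
  on lines orthogonal to \<open>u\<close>: almost every such line that meets a convex body meets its boundary in
  exactly two points. So the length measure of the boundary is the image of Lebesgue measure on the
  projection under the two endpoint maps, and the perimeter is twice the width in direction \<open>u\<close>.
  For a generic line the endpoints of its segment in \<open>K\<close> that lie in \<open>K + x\<close> and those of its
  segment in \<open>K + x\<close> that lie in \<open>K\<close> number two or zero, according to whether the line meets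
  \<open>K \<inter> (K + x)\<close>; integrating over all lines gives
  \<open>per(K \<inter> (K + x)) = \<delta>(K + x) + \<delta>(K - x)\<close> for the length measure \<open>\<delta>\<close> of the boundary of \<open>K\<close>,
  for almost all \<open>x\<close>. Lengths are additive and monotone in the seminorm, and every planar seminorm
  is a uniform limit of finite sums \<open>\<Sum>u. \<bar>u \<bullet> _\<bar>\<close>, so the identity, and likewise the
  superadditivity of the perimeter under Minkowski combinations, passes to \<open>N\<close>. This gives (I) and
  the first half of (IV); the second half is the Brunn-Minkowski inequality, proved by Bonnesen's
  comparison of the level sets of chord lengths.\<close>

section \<open>Variation of a curve with respect to a seminorm\<close>

text \<open>Three obstacles shape the argument. The set \<open>B\<close> may be unbounded, so its
  gauge can vanish off the origin, and nothing may rely on definiteness. The path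
  \<open>param_of (frontier K)\<close> is an arbitrary choice, so lengths must be found for every
  simple path onto the boundary; its rectifiability and the right continuity behind
  \<open>interval_measure\<close> have to be proved, and both come from the same count of crossings.
  Finally, limits of measures are avoided: the error of a zonal approximation is bounded by
  \<open>e * (\<bar>x$1\<bar> + \<bar>x$2\<bar>)\<close>, which is itself zonal, so by monotonicity
  in the seminorm the error in any mass is at most \<open>e\<close> times a sum of widths, uniformly
  in the Borel set. The approximation is special to the plane: on directions, the triangle
  inequality says that second differences relative to sinusoids are nonnegative, and these give the
  coefficients of the sum. Since the exceptional translations depend on \<open>u\<close>, a fixed
  sequence of approximations is used, which involves only countably many directions.\<close>

definition is_seminorm :: "(real^2 \<Rightarrow> real) \<Rightarrow> bool" where
  "is_seminorm N \<longleftrightarrow> (\<forall>x y. N (x + y) \<le> N x + N y) \<and> (\<forall>c x. N (c *\<^sub>R x) = \<bar>c\<bar> * N x)"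

lemma seminorm_triangle: "is_seminorm N \<Longrightarrow> N (x + y) \<le> N x + N y"
  and seminorm_scale: "is_seminorm N \<Longrightarrow> N (c *\<^sub>R x) = \<bar>c\<bar> * N x"
  by (auto simp: is_seminorm_def)

lemma seminorm_minus: "is_seminorm N \<Longrightarrow> N (- x) = N x"
  using seminorm_scale[of N "-1" x] by simp

lemma seminorm_zero: "is_seminorm N \<Longrightarrow> N 0 = 0"
  using seminorm_scale[of N 0 0] by simp

lemma seminorm_nonneg: "is_seminorm N \<Longrightarrow> 0 \<le> N x"
  using seminorm_triangle[of N x "- x"] by (simp add: seminorm_minus seminorm_zero)

lemma seminorm_diff_swap: "is_seminorm N \<Longrightarrow> N (x - y) = N (y - x)"
  using seminorm_minus[of N "y - x"] by simp

lemma seminorm_triangle3: "is_seminorm N \<Longrightarrow> N (x - z) \<le> N (x - y) + N (y - z)"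
  using seminorm_triangle[of N "x - y" "y - z"] by simp

lemma seminorm_abs_diff: "is_seminorm N \<Longrightarrow> \<bar>N x - N y\<bar> \<le> N (x - y)"
  using seminorm_triangle[of N "x - y" y] seminorm_triangle[of N "y - x" x]
  by (auto simp: seminorm_diff_swap)

lemma seminorm_add: "is_seminorm N \<Longrightarrow> is_seminorm M \<Longrightarrow> is_seminorm (\<lambda>x. N x + M x)"
  by (auto simp: is_seminorm_def algebra_simps) (smt (verit))

lemma seminorm_inner: "is_seminorm (\<lambda>x. \<bar>u \<bullet> x\<bar>)"
  by (auto simp: is_seminorm_def inner_add_right abs_mult intro: abs_triangle_ineq)

definition zonal :: "(real^2) list \<Rightarrow> real^2 \<Rightarrow> real" where
  "zonal us x = (\<Sum>u\<leftarrow>us. \<bar>u \<bullet> x\<bar>)"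

lemma zonal_Nil: "zonal [] = (\<lambda>x. 0)"
  and zonal_Cons: "zonal (u # us) = (\<lambda>x. \<bar>u \<bullet> x\<bar> + zonal us x)"
  by (auto simp: zonal_def)

lemma seminorm_zonal: "is_seminorm (zonal us)"
proof (induction us)
  case Nil
  then show ?case by (simp add: zonal_Nil is_seminorm_def)
next
  case (Cons u us)
  then show ?case unfolding zonal_Cons by (intro seminorm_add seminorm_inner)
qed

text \<open>The \<open>l1\<close> norm serves as majorant because it is zonal, so that its lengths
  can be expressed by widths.\<close>

lemma seminorm_le_l1:
  assumes N: "is_seminorm N"
  shows "N x \<le> max (N (axis 1 1)) (N (axis 2 1)) * (\<bar>x$1\<bar> + \<bar>x$2\<bar>)"
proof -
  have "x = x$1 *\<^sub>R axis 1 1 + x$2 *\<^sub>R axis 2 1"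
    by (simp add: vec_eq_iff forall_2 axis_def)
  then have "N x \<le> N (x$1 *\<^sub>R axis 1 1) + N (x$2 *\<^sub>R axis 2 1)"
    using seminorm_triangle[OF N] by metis
  also have "\<dots> = \<bar>x$1\<bar> * N (axis 1 1) + \<bar>x$2\<bar> * N (axis 2 1)"
    by (simp add: seminorm_scale[OF N])
  also have "\<dots> \<le> \<bar>x$1\<bar> * max (N (axis 1 1)) (N (axis 2 1)) + \<bar>x$2\<bar> * max (N (axis 1 1)) (N (axis 2 1))"
    by (intro add_mono mult_left_mono) auto
  finally show ?thesis by (simp add: algebra_simps)
qed

lemma zonal_axes: "0 \<le> c \<Longrightarrow> zonal [c *\<^sub>R axis 1 1, c *\<^sub>R axis 2 1] x = c * (\<bar>x$1\<bar> + \<bar>x$2\<bar>)"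
  by (simp add: zonal_def inner_axis' abs_mult algebra_simps)

lemma seminorm_le_zonal:
  assumes "is_seminorm N"
  obtains us where "\<And>x. N x \<le> zonal us x"
proof -
  let ?c = "max (N (axis 1 1)) (N (axis 2 1))"
  have "0 \<le> ?c" using seminorm_nonneg[OF assms] by (simp add: le_max_iff_disj)
  from zonal_axes[OF this] seminorm_le_l1[OF assms] show ?thesis
    by (intro that[of "[?c *\<^sub>R axis 1 1, ?c *\<^sub>R axis 2 1]"]) metis
qed

lemma zonal_le_norm: obtains C where "0 \<le> C" "\<And>x. zonal us x \<le> C * norm x"
proof -
  have "zonal us x \<le> (\<Sum>u\<leftarrow>us. norm u) * norm x" for x
    unfolding zonal_def
    by (induction us) (auto simp: algebra_simps intro: add_mono Cauchy_Schwarz_ineq2)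
  then show ?thesis by (intro that[of "\<Sum>u\<leftarrow>us. norm u"]) (auto intro!: sum_list_nonneg)
qed

section \<open>Polygon sums and their behaviour under refinement\<close>

fun psum :: "(real^2 \<Rightarrow> real) \<Rightarrow> (real \<Rightarrow> real^2) \<Rightarrow> real list \<Rightarrow> real" where
  "psum N \<gamma> (s # t # ts) = N (\<gamma> t - \<gamma> s) + psum N \<gamma> (t # ts)"
| "psum N \<gamma> _ = 0"

text \<open>Truncated subtraction leaves the indexed sum empty for lists of length at most one, in
  agreement with the default clause of \<open>psum\<close>.\<close>

lemma psum_conv_sum:
  "(\<Sum>i<length ts - 1. N (\<gamma> (ts ! Suc i) - \<gamma> (ts ! i))) = psum N \<gamma> ts"
  by (induction N \<gamma> ts rule: psum.induct) (simp_all add: sum.lessThan_Suc_shift del: sum.lessThan_Suc)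

lemma inscribed_lengths_psum:
  "inscribed_lengths N \<gamma> a b = {psum N \<gamma> ts |ts. sorted ts \<and> set ts \<subseteq> {a..b}}"
  unfolding inscribed_lengths_def psum_conv_sum ..

lemma psum_nonneg: "is_seminorm N \<Longrightarrow> 0 \<le> psum N \<gamma> ts"
  by (induction N \<gamma> ts rule: psum.induct) (auto intro: seminorm_nonneg add_nonneg_nonneg)

lemma psum_mono: "(\<And>x. N x \<le> M x) \<Longrightarrow> psum N \<gamma> ts \<le> psum M \<gamma> ts"
  by (induction N \<gamma> ts rule: psum.induct) (auto intro: add_mono)

lemma psum_add: "psum (\<lambda>x. N x + M x) \<gamma> ts = psum N \<gamma> ts + psum M \<gamma> ts"
  by (induction N \<gamma> ts rule: psum.induct) auto

lemma psum_cmult: "psum (\<lambda>x. c * N x) \<gamma> ts = c * psum N \<gamma> ts"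
  by (induction N \<gamma> ts rule: psum.induct) (auto simp: algebra_simps)

lemma psum_split: "psum N \<gamma> (xs @ t # ys) = psum N \<gamma> (xs @ [t]) + psum N \<gamma> (t # ys)"
  by (induction N \<gamma> xs rule: psum.induct) auto

lemma psum_le_Cons: "is_seminorm N \<Longrightarrow> psum N \<gamma> ts \<le> psum N \<gamma> (t # ts)"
  by (cases ts) (auto simp: seminorm_nonneg)

text \<open>The triangle inequality at the inserted point; at either end of the list a nonnegative
  term is added.\<close>

lemma psum_insort: "is_seminorm N \<Longrightarrow> psum N \<gamma> ts \<le> psum N \<gamma> (insort t ts)"
proof (induction N \<gamma> ts rule: psum.induct)
  case (1 N \<gamma> x y ts)
  then show ?case
    using seminorm_triangle3[of N "\<gamma> y" "\<gamma> x" "\<gamma> t"]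
    by (auto simp: seminorm_nonneg split: if_splits)
qed (auto simp: seminorm_nonneg)

text \<open>Common refinement of two subdivisions, used to compare a sum of two suprema with one
  supremum.\<close>

definition merge_sorted :: "real list \<Rightarrow> real list \<Rightarrow> real list" where
  "merge_sorted xs ys = foldr insort xs ys"

lemma merge_sorted:
  assumes "sorted ys"
  shows "sorted (merge_sorted xs ys)" "set (merge_sorted xs ys) = set xs \<union> set ys"
  unfolding merge_sorted_def using assms
  by (induction xs) (auto simp: sorted_insort set_insort_key)

lemma psum_merge_sorted: "is_seminorm N \<Longrightarrow> psum N \<gamma> ys \<le> psum N \<gamma> (merge_sorted xs ys)"
  unfolding merge_sorted_def by (induction xs) (auto intro: order_trans[OF _ psum_insort])

lemma merge_sorted_commute:
  assumes "sorted xs" "sorted ys"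
  shows "merge_sorted xs ys = merge_sorted ys xs"
proof -
  have "mset (merge_sorted us vs) = mset us + mset vs" for us vs
    unfolding merge_sorted_def by (induction us) auto
  then have "sort (xs @ ys) = merge_sorted xs ys" "sort (xs @ ys) = merge_sorted ys xs"
    using assms by (auto intro!: properties_for_sort merge_sorted(1))
  then show ?thesis by simp
qed

text \<open>The quantity of \<open>path_len\<close> for an arbitrary \<open>N\<close>: zonal
  functions are not presented as gauges of sets.\<close>

definition var :: "(real^2 \<Rightarrow> real) \<Rightarrow> (real \<Rightarrow> real^2) \<Rightarrow> real \<Rightarrow> real \<Rightarrow> real" where
  "var N \<gamma> a b = Sup (inscribed_lengths N \<gamma> a b)"

lemma path_len_var: "path_len B \<gamma> = var (gauge_norm B) \<gamma>"
  by (simp add: path_len_def var_def fun_eq_iff)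

lemma inscribed_lengths_nonempty: "inscribed_lengths N \<gamma> a b \<noteq> {}"
  by (auto simp: inscribed_lengths_psum intro: exI[of _ "[]"])

lemma inscribed_lengths_bdd:
  assumes "rectifiable \<gamma>" "is_seminorm N" "0 \<le> a" "b \<le> 1"
  shows "bdd_above (inscribed_lengths N \<gamma> a b)"
proof -
  obtain us where us: "\<And>x. N x \<le> zonal us x" using seminorm_le_zonal assms by metis
  obtain C where C: "0 \<le> C" "\<And>x. zonal us x \<le> C * norm x" using zonal_le_norm by metis
  obtain M where M: "\<And>x. x \<in> inscribed_lengths norm \<gamma> 0 1 \<Longrightarrow> x \<le> M"
    using assms by (auto simp: rectifiable_def bdd_above_def)
  have "psum N \<gamma> ts \<le> C * M" if "sorted ts" "set ts \<subseteq> {a..b}" for ts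
  proof -
    have "psum N \<gamma> ts \<le> C * psum norm \<gamma> ts"
      using us C psum_mono[of N "\<lambda>x. C * norm x" \<gamma> ts] by (auto simp: psum_cmult intro: order_trans)
    moreover have "psum norm \<gamma> ts \<le> M"
      using that assms by (intro M) (fastforce simp: inscribed_lengths_psum)
    ultimately show ?thesis using C by (meson mult_left_mono order_trans)
  qed
  then show ?thesis by (auto simp: bdd_above_def inscribed_lengths_psum)
qed

lemma psum_le_var:
  assumes "rectifiable \<gamma>" "is_seminorm N" "0 \<le> a" "b \<le> 1" "sorted ts" "set ts \<subseteq> {a..b}"
  shows "psum N \<gamma> ts \<le> var N \<gamma> a b"
  unfolding var_def using inscribed_lengths_bdd[OF assms(1-4)] assms(5,6)
  by (intro cSup_upper) (auto simp: inscribed_lengths_psum)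

lemma var_least:
  assumes "\<And>ts. sorted ts \<Longrightarrow> set ts \<subseteq> {a..b} \<Longrightarrow> psum N \<gamma> ts \<le> c"
  shows "var N \<gamma> a b \<le> c"
  unfolding var_def using inscribed_lengths_nonempty assms
  by (intro cSup_least) (auto simp: inscribed_lengths_psum)

lemma var_nonneg:
  assumes "rectifiable \<gamma>" "is_seminorm N" "0 \<le> a" "b \<le> 1"
  shows "0 \<le> var N \<gamma> a b"
  using psum_le_var[OF assms, of "[]"] by simp

lemma var_mono:
  assumes "rectifiable \<gamma>" "is_seminorm M" "0 \<le> a" "b \<le> 1" "\<And>x. N x \<le> M x"
  shows "var N \<gamma> a b \<le> var M \<gamma> a b"
  using assms by (intro var_least) (meson order_trans psum_le_var psum_mono)

text \<open>The two suprema are bounded one after the other, so no single polygon has to be nearly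
  optimal for both.\<close>

lemma var_add_le:
  assumes "\<And>ts us. sorted ts \<Longrightarrow> set ts \<subseteq> {a..b} \<Longrightarrow> sorted us \<Longrightarrow> set us \<subseteq> {c..d} \<Longrightarrow>
    psum N \<gamma> ts + psum M \<gamma> us \<le> e"
  shows "var N \<gamma> a b + var M \<gamma> c d \<le> e"
proof -
  have "var N \<gamma> a b \<le> e - psum M \<gamma> us" if "sorted us" "set us \<subseteq> {c..d}" for us
    using assms that by (intro var_least) (simp add: algebra_simps)
  then have "psum M \<gamma> us \<le> e - var N \<gamma> a b" if "sorted us" "set us \<subseteq> {c..d}" for us
    using that by (simp add: algebra_simps)
  then have "var M \<gamma> c d \<le> e - var N \<gamma> a b"
    by (intro var_least)
  then show ?thesis by simp
qed

text \<open>For the lower bound, two polygons are replaced by a common refinement, which increases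
  both sums.\<close>

lemma var_add_seminorm:
  assumes "rectifiable \<gamma>" "is_seminorm N" "is_seminorm M" "0 \<le> a" "b \<le> 1"
  shows "var (\<lambda>x. N x + M x) \<gamma> a b = var N \<gamma> a b + var M \<gamma> a b"
proof (rule antisym)
  show "var (\<lambda>x. N x + M x) \<gamma> a b \<le> var N \<gamma> a b + var M \<gamma> a b"
    using assms by (intro var_least) (auto simp: psum_add intro!: add_mono psum_le_var)
  show "var N \<gamma> a b + var M \<gamma> a b \<le> var (\<lambda>x. N x + M x) \<gamma> a b"
  proof (rule var_add_le)
    fix ts us :: "real list"
    assume *: "sorted ts" "set ts \<subseteq> {a..b}" "sorted us" "set us \<subseteq> {a..b}"
    let ?m = "merge_sorted ts us"
    have "psum N \<gamma> ts + psum M \<gamma> us \<le> psum N \<gamma> ?m + psum M \<gamma> ?m"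
      using * assms psum_merge_sorted[of N \<gamma> ts us] psum_merge_sorted[of M \<gamma> us ts]
        merge_sorted_commute[of ts us] by (intro add_mono) auto
    also have "\<dots> \<le> var (\<lambda>x. N x + M x) \<gamma> a b"
      unfolding psum_add[symmetric] using * assms merge_sorted[of us ts]
      by (intro psum_le_var seminorm_add) auto
    finally show "psum N \<gamma> ts + psum M \<gamma> us \<le> var (\<lambda>x. N x + M x) \<gamma> a b" .
  qed
qed

text \<open>Inserting \<open>b\<close> into a polygon splits it into polygons on both sides;
  conversely, polygons on both sides are joined through \<open>b\<close>.\<close>

lemma var_add_interval:
  assumes "rectifiable \<gamma>" "is_seminorm N" "0 \<le> a" "a \<le> b" "b \<le> c" "c \<le> 1"
  shows "var N \<gamma> a c = var N \<gamma> a b + var N \<gamma> b c"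
proof (rule antisym)
  show "var N \<gamma> a c \<le> var N \<gamma> a b + var N \<gamma> b c"
  proof (rule var_least)
    fix ts :: "real list" assume ts: "sorted ts" "set ts \<subseteq> {a..c}"
    have "b \<in> set (insort b ts)" by (simp add: set_insort_key)
    then obtain xs ys where xy: "insort b ts = xs @ b # ys" using split_list by metis
    have s: "sorted (xs @ b # ys)" using ts xy by (metis sorted_insort)
    have "set (xs @ b # ys) \<subseteq> {a..c}"
      unfolding xy[symmetric] using ts assms by (auto simp: set_insort_key)
    with s have "psum N \<gamma> (xs @ [b]) \<le> var N \<gamma> a b" "psum N \<gamma> (b # ys) \<le> var N \<gamma> b c"
      using assms by (auto intro!: psum_le_var simp: sorted_append subset_iff)
    with psum_insort[OF assms(2), of \<gamma> ts b] show "psum N \<gamma> ts \<le> var N \<gamma> a b + var N \<gamma> b c"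
      unfolding xy psum_split[of N \<gamma> xs b ys] by simp
  qed
  show "var N \<gamma> a b + var N \<gamma> b c \<le> var N \<gamma> a c"
  proof (rule var_add_le)
    fix ts us :: "real list"
    assume *: "sorted ts" "set ts \<subseteq> {a..b}" "sorted us" "set us \<subseteq> {b..c}"
    have "psum N \<gamma> ts \<le> psum N \<gamma> (ts @ [b])"
      using assms(2) by (induction N \<gamma> ts rule: psum.induct) (auto simp: seminorm_nonneg)
    moreover have "psum N \<gamma> us \<le> psum N \<gamma> (b # us)"
      by (rule psum_le_Cons[OF assms(2)])
    moreover have "psum N \<gamma> (ts @ b # us) \<le> var N \<gamma> a c"
      using assms * by (intro psum_le_var) (fastforce simp: sorted_append)+
    ultimately show "psum N \<gamma> ts + psum N \<gamma> us \<le> var N \<gamma> a c"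
      unfolding psum_split[of N \<gamma> ts b us] by simp
  qed
qed

section \<open>Zonal approximation of planar seminorms\<close>

definition dir :: "real \<Rightarrow> real^2" where
  "dir t = vector [cos t, sin t]"

lemma dir_nth [simp]: "dir t $ 1 = cos t" "dir t $ 2 = sin t"
  by (auto simp: dir_def)

lemma inner_vec2: "(x::real^2) \<bullet> y = x$1 * y$1 + x$2 * y$2"
  by (simp add: inner_vec_def sum_2)

lemma dir_plus_pi: "dir (t + pi) = - dir t" "dir (t - pi) = - dir t"
  by (simp_all add: vec_eq_iff forall_2)

lemma dir_add_dir: "dir (t + d) + dir (t - d) = (2 * cos d) *\<^sub>R dir t"
  by (simp add: vec_eq_iff forall_2 cos_add cos_diff sin_add sin_diff)

text \<open>Rotation of a sum over the grid \<open>j * d\<close>; the period is \<open>pi\<close>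
  because seminorms do not distinguish opposite directions.\<close>

lemma sum_periodic_shift:
  fixes G :: "real \<Rightarrow> real"
  assumes "\<And>x. G (x + pi) = G x" "real n * d = pi"
  shows "(\<Sum>j<n. G (real j * d + d)) = (\<Sum>j<n. G (real j * d))"
proof -
  have "(\<Sum>j<n. G (real (Suc j) * d)) + G 0 = (\<Sum>j<Suc n. G (real j * d))"
    unfolding sum.lessThan_Suc_shift by simp
  also have "\<dots> = (\<Sum>j<n. G (real j * d)) + G 0"
    using assms(1)[of 0] assms(2) by simp
  finally show ?thesis by (simp add: algebra_simps)
qed

text \<open>\<open>sin\<close> solves the recurrence
  \<open>f (x + d) + f (x - d) = 2 * cos d * f x\<close>, and so does \<open>\<bar>sin\<bar>\<close>
  as long as the arguments do not lie on both sides of a zero. On the grid the only contribution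
  therefore comes from the kink at \<open>0\<close>: \<open>\<bar>sin\<bar>\<close> acts as a
  discrete Green function.\<close>

lemma abs_sin_second_difference:
  assumes d: "real n * d = pi" "2 \<le> n" and i: "\<bar>i\<bar> < int n"
  shows "\<bar>sin (of_int i * d + d)\<bar> + \<bar>sin (of_int i * d - d)\<bar> - 2 * cos d * \<bar>sin (of_int i * d)\<bar>
    = (if i = 0 then 2 * sin d else 0)"
proof -
  have "d = pi / real n" using d by (simp add: field_simps)
  moreover have "pi / real n < pi / 1" using d(2) by (intro divide_strict_left_mono) auto
  ultimately have d0: "0 < d" "d < pi" using d(2) by auto
  have pos: "\<bar>sin (of_int i * d + d)\<bar> + \<bar>sin (of_int i * d - d)\<bar> - 2 * cos d * \<bar>sin (of_int i * d)\<bar> = 0"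
    if "0 < i" "i < int n" for i :: int
  proof -
    have "1 \<le> real_of_int i" "real_of_int i + 1 \<le> real n" using that by linarith+
    then have b: "d \<le> of_int i * d" "of_int i * d + d \<le> pi"
      using d0 d(1) mult_right_mono[of 1 "real_of_int i" d] mult_right_mono[of "real_of_int i + 1" "real n" d]
      by (auto simp: algebra_simps)
    then have "0 \<le> sin (of_int i * d + d)" "0 \<le> sin (of_int i * d - d)" "0 \<le> sin (of_int i * d)"
      using d0 by (auto intro!: sin_ge_zero)
    then show ?thesis by (simp add: sin_add sin_diff)
  qed
  consider "i = 0" | "0 < i" | "0 < - i" by linarith
  then show ?thesis
  proof cases
    case 1
    have "0 < sin d" using d0 sin_gt_zero by blast
    with 1 show ?thesis by simp
  next
    case 2
    with pos[of i] i show ?thesis by simp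
  next
    case 3
    have "sin (of_int (-i) * d + d) = - sin (of_int i * d - d)"
      "sin (of_int (-i) * d - d) = - sin (of_int i * d + d)"
      by (simp_all add: sin_add sin_diff)
    with pos[of "- i"] 3 i show ?thesis by simp
  qed
qed

text \<open>The coefficient at the \<open>j\<close>-th direction is the jump of the slope there of the function that
  interpolates \<open>N\<close> linearly on the sectors between consecutive multiples of \<open>\<pi> / n\<close>.\<close>

lemma zonal_interpolation:
  assumes N: "is_seminorm N" and n: "2 \<le> n"
  obtains us where "\<And>k. k < n \<Longrightarrow> zonal us (dir (real k * (pi / real n))) = N (dir (real k * (pi / real n)))"
proof -
  define d where "d = pi / real n"
  have d: "real n * d = pi" using n by (simp add: d_def)
  have sd: "0 < sin d"
    using n by (intro sin_gt_zero) (auto simp: d_def field_simps)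
  define H where "H t = N (dir t)" for t
  have Hper: "H (t + pi) = H t" "H (t - pi) = H t" for t
    by (simp_all add: H_def dir_plus_pi seminorm_minus[OF N])
  define c where "c t = H (t + d) + H (t - d) - 2 * cos d * H t" for t
  \<comment> \<open>The two neighbours of a direction add up to a multiple of it, so the triangle
    inequality makes the second difference nonnegative.\<close>
  have c0: "0 \<le> c t" for t
  proof -
    have "2 * cos d * H t \<le> \<bar>2 * cos d\<bar> * H t"
      using seminorm_nonneg[OF N] by (intro mult_right_mono) (auto simp: H_def)
    also have "\<dots> = N (dir (t + d) + dir (t - d))"
      by (simp add: dir_add_dir seminorm_scale[OF N] H_def)
    also have "\<dots> \<le> H (t + d) + H (t - d)"
      unfolding H_def by (rule seminorm_triangle[OF N])
    finally show ?thesis by (simp add: c_def)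
  qed
  \<comment> \<open>The turn by \<open>pi / 2\<close> places the zero of the \<open>j\<close>-th
    summand at the direction \<open>j * d\<close>; the divisor \<open>2 * sin d\<close> is the size
    of the kink found in \<open>abs_sin_second_difference\<close>.\<close>
  define us where
    "us = map (\<lambda>j. (c (real j * d) / (2 * sin d)) *\<^sub>R dir (real j * d + pi / 2)) [0..<n]"
  have zon: "zonal us (dir t) = (\<Sum>j<n. c (real j * d) / (2 * sin d) * \<bar>sin (t - real j * d)\<bar>)" for t
  proof -
    have "dir (s + pi / 2) \<bullet> dir t = sin (t - s)" for s
      by (simp add: inner_vec2 cos_add sin_add sin_diff)
    then show ?thesis
      unfolding zonal_def us_def using c0 sd
      by (simp add: o_def abs_mult interv_sum_list_conv_sum_set_nat atLeast0LessThan)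
  qed
  have "zonal us (dir (real k * d)) = N (dir (real k * d))" if k: "k < n" for k
  proof -
    define t where "t = real k * d"
    let ?S = "\<lambda>x. \<bar>sin (t - x)\<bar>"
    have S: "\<bar>sin (x + pi)\<bar> = \<bar>sin x\<bar>" "\<bar>sin (x - pi)\<bar> = \<bar>sin x\<bar>" for x by auto
    have "?S (x + pi) = ?S x" for x using S(2)[of "t - x"] by (simp add: algebra_simps)
    note Sper = this
    have "(\<Sum>j<n. H (real j * d + d) * ?S (real j * d + d - d)) = (\<Sum>j<n. H (real j * d) * ?S (real j * d - d))"
      by (rule sum_periodic_shift[OF _ d, of "\<lambda>x. H x * ?S (x - d)"])
        (use Sper[of "_ - d"] Hper in \<open>simp add: diff_add_eq del: sin_periodic_pi\<close>)
    then have e1: "(\<Sum>j<n. H (real j * d + d) * ?S (real j * d)) = (\<Sum>j<n. H (real j * d) * ?S (real j * d - d))"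
      by simp
    have "(\<Sum>j<n. H (real j * d + d - d) * ?S (real j * d + d)) = (\<Sum>j<n. H (real j * d - d) * ?S (real j * d))"
      by (rule sum_periodic_shift[OF _ d, of "\<lambda>x. H (x - d) * ?S x"])
        (use Sper Hper(1)[of "_ - d"] in \<open>simp add: diff_add_eq del: sin_periodic_pi\<close>)
    then have e2: "(\<Sum>j<n. H (real j * d - d) * ?S (real j * d)) = (\<Sum>j<n. H (real j * d) * ?S (real j * d + d))"
      by simp
    \<comment> \<open>Summation by parts over a period moves the second difference from
      \<open>H\<close> to \<open>\<bar>sin\<bar>\<close>, where it is concentrated at
      \<open>j = k\<close>.\<close>
    have "(\<Sum>j<n. c (real j * d) * ?S (real j * d))
      = (\<Sum>j<n. H (real j * d) * (?S (real j * d - d) + ?S (real j * d + d) - 2 * cos d * ?S (real j * d)))"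
      using e1 e2 by (simp add: c_def algebra_simps sum.distrib sum_subtractf)
    also have "\<dots> = (\<Sum>j<n. if j = k then H (real j * d) * (2 * sin d) else 0)"
    proof (rule sum.cong)
      fix j assume "j \<in> {..<n}"
      then have "\<bar>int k - int j\<bar> < int n" using k by auto
      from abs_sin_second_difference[OF d n this]
      have "?S (real j * d - d) + ?S (real j * d + d) - 2 * cos d * ?S (real j * d)
        = (if int k - int j = 0 then 2 * sin d else 0)"
        by (simp add: t_def algebra_simps)
      then show "H (real j * d) * (?S (real j * d - d) + ?S (real j * d + d) - 2 * cos d * ?S (real j * d))
        = (if j = k then H (real j * d) * (2 * sin d) else 0)" by auto
    qed simp
    also have "\<dots> = H t * (2 * sin d)" using k by (simp add: t_def)
    finally have "(\<Sum>j<n. c (real j * d) * ?S (real j * d)) / (2 * sin d) = H t"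
      using sd by simp
    then show ?thesis
      unfolding t_def[symmetric] zon by (simp add: sum_divide_distrib H_def)
  qed
  then show ?thesis using that[of us] by (simp add: d_def)
qed

lemma real_nearest_multiple:
  fixes x d :: real
  assumes "0 \<le> x" "0 < d" "x < real n * d"
  obtains k where "k < n" "\<bar>x - real k * d\<bar> \<le> d"
proof -
  have "\<exists>k<n. \<bar>x - real k * d\<bar> \<le> d"
    using assms(3)
  proof (induction n)
    case (Suc n)
    show ?case
    proof (cases "x < real n * d")
      case True
      then show ?thesis using Suc.IH less_Suc_eq by blast
    next
      case False
      with Suc.prems show ?thesis by (intro exI[of _ n]) (auto simp: algebra_simps)
    qed
  qed (use assms in simp)
  then show ?thesis using that by blast
qed

text \<open>The sign \<open>s\<close> reduces every direction to a half turn, which is all that the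
  interpolation nodes \<open>k * (pi / n)\<close> with \<open>k < n\<close> cover.\<close>

lemma polar_half:
  fixes x :: "real^2"
  obtains r t s where "0 \<le> r" "0 \<le> t" "t < pi" "\<bar>s\<bar> = 1" "x = (s * r) *\<^sub>R dir t"
    "r \<le> \<bar>x$1\<bar> + \<bar>x$2\<bar>"
proof -
  let ?z = "Complex (x$1) (x$2)"
  define r where "r = cmod ?z"
  define t where "t = Arg2pi ?z"
  have t: "0 \<le> t" "t < 2 * pi" using Arg2pi[of ?z] by (auto simp: t_def)
  have xt: "x$1 = r * cos t" "x$2 = r * sin t"
    using cos_Arg2pi[of ?z] sin_Arg2pi[of ?z] by (simp_all add: r_def t_def)
  have r: "0 \<le> r" "r \<le> \<bar>x$1\<bar> + \<bar>x$2\<bar>"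
    using cmod_le[of ?z] by (auto simp: r_def)
  show ?thesis
  proof (cases "t < pi")
    case True
    show ?thesis
      by (rule that[of r t 1]) (use r t xt True in \<open>auto simp: vec_eq_iff forall_2\<close>)
  next
    case False
    show ?thesis
      by (rule that[of r "t - pi" "-1"]) (use r t xt False in \<open>auto simp: vec_eq_iff forall_2\<close>)
  qed
qed

lemma seminorm_dir_diff:
  assumes N: "is_seminorm N" and C: "\<And>x. N x \<le> C * (\<bar>x$1\<bar> + \<bar>x$2\<bar>)" "0 \<le> C"
  shows "\<bar>N (dir s) - N (dir t)\<bar> \<le> C * (2 * \<bar>s - t\<bar>)"
proof -
  have "\<bar>N (dir s) - N (dir t)\<bar> \<le> N (dir s - dir t)" by (rule seminorm_abs_diff[OF N])
  also have "\<dots> \<le> C * (\<bar>cos s - cos t\<bar> + \<bar>sin s - sin t\<bar>)" using C(1)[of "dir s - dir t"] by simp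
  also have "\<dots> \<le> C * (2 * \<bar>s - t\<bar>)"
  proof (intro mult_left_mono C)
    have "\<bar>cos s - cos t\<bar> = 2 * (\<bar>sin ((s + t) / 2)\<bar> * \<bar>sin ((t - s) / 2)\<bar>)"
      by (simp add: cos_diff_cos abs_mult)
    also have "\<dots> \<le> 2 * (1 * \<bar>(t - s) / 2\<bar>)"
      by (intro mult_left_mono mult_mono abs_sin_x_le_abs_x) auto
    moreover have "\<bar>sin s - sin t\<bar> = 2 * (\<bar>sin ((s - t) / 2)\<bar> * \<bar>cos ((s + t) / 2)\<bar>)"
      by (simp add: sin_diff_sin abs_mult)
    moreover have "\<dots> \<le> 2 * (\<bar>(s - t) / 2\<bar> * 1)"
      by (intro mult_left_mono mult_mono abs_sin_x_le_abs_x) auto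
    moreover have "\<bar>t - s\<bar> = \<bar>s - t\<bar>" by (rule abs_minus_commute)
    ultimately show "\<bar>cos s - cos t\<bar> + \<bar>sin s - sin t\<bar> \<le> 2 * \<bar>s - t\<bar>" by simp
  qed
  finally show ?thesis .
qed

text \<open>Both seminorms agree at the nodes and have Lipschitz constant \<open>2 * C\<close> in
  the angle; homogeneity carries the estimate from directions to all vectors.\<close>

lemma zonal_approximation:
  assumes N: "is_seminorm N" and e: "0 < e"
  obtains us where "\<And>x. \<bar>N x - zonal us x\<bar> \<le> e * (\<bar>x$1\<bar> + \<bar>x$2\<bar>)"
proof -
  define C where "C = max (N (axis 1 1)) (N (axis 2 1))"
  have C0: "0 \<le> C" using seminorm_nonneg[OF N] by (simp add: C_def le_max_iff_disj)
  have CN: "N x \<le> C * (\<bar>x$1\<bar> + \<bar>x$2\<bar>)" for x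
    using seminorm_le_l1[OF N] by (simp add: C_def)
  obtain m :: nat where m: "4 * C * pi / e < real m" using reals_Archimedean2 by blast
  \<comment> \<open>An even \<open>n\<close> makes both coordinate axes nodes (\<open>k = 0\<close>
    and \<open>k = Suc m\<close>), so \<open>zonal us\<close> agrees with \<open>N\<close> there and
    inherits the same bound \<open>C\<close>.\<close>
  define n where "n = 2 * Suc m"
  have n2: "2 \<le> n" by (simp add: n_def)
  define d where "d = pi / real n"
  have d: "0 < d" "real n * d = pi" using n2 by (auto simp: d_def)
  have "4 * C * pi < e * real n"
  proof -
    have "4 * C * pi < e * real m" using m e by (simp add: field_simps)
    also have "\<dots> \<le> e * real n" using e by (intro mult_left_mono) (auto simp: n_def)
    finally show ?thesis .
  qed
  then have Cd: "4 * C * d \<le> e" using n2 by (simp add: d_def field_simps)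
  obtain us where us: "\<And>k. k < n \<Longrightarrow> zonal us (dir (real k * d)) = N (dir (real k * d))"
    using zonal_interpolation[OF N n2] unfolding d_def by metis
  have "dir 0 = axis 1 1" "dir (real (Suc m) * d) = axis 2 1"
  proof -
    have "real (Suc m) * d = pi / 2" using d(2) by (simp add: n_def algebra_simps)
    from this show "dir (real (Suc m) * d) = axis 2 1"
      unfolding \<open>real (Suc m) * d = pi / 2\<close> by (simp add: vec_eq_iff forall_2 axis_def)
  qed (simp add: vec_eq_iff forall_2 axis_def)
  then have "max (zonal us (axis 1 1)) (zonal us (axis 2 1)) = C"
    using us[of 0] us[of "Suc m"] by (simp add: n_def C_def)
  then have CZ: "zonal us x \<le> C * (\<bar>x$1\<bar> + \<bar>x$2\<bar>)" for x
    using seminorm_le_l1[OF seminorm_zonal, of us x] by simp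
  have "\<bar>N x - zonal us x\<bar> \<le> e * (\<bar>x$1\<bar> + \<bar>x$2\<bar>)" for x
  proof -
    obtain r t s where x: "0 \<le> r" "0 \<le> t" "t < pi" "\<bar>s\<bar> = 1" "x = (s * r) *\<^sub>R dir t"
      "r \<le> \<bar>x$1\<bar> + \<bar>x$2\<bar>" using polar_half by metis
    obtain k where k: "k < n" "\<bar>t - real k * d\<bar> \<le> d"
      using real_nearest_multiple[of t d n] x d by auto
    have bound: "C * (2 * \<bar>t - real k * d\<bar>) \<le> C * (2 * d)"
      using k C0 by (intro mult_left_mono) auto
    \<comment> \<open>\<open>t\<close> is within \<open>d\<close> of a node, and each of the two
      seminorms changes by at most \<open>2 * C * d\<close> on the way.\<close>
    have "\<bar>N (dir t) - zonal us (dir t)\<bar> \<le> 4 * C * d"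
      using seminorm_dir_diff[OF N CN C0, of t "real k * d"]
        seminorm_dir_diff[OF seminorm_zonal CZ C0, of t "real k * d"] us[OF k(1)] bound by linarith
    then have "\<bar>N (dir t) - zonal us (dir t)\<bar> \<le> e" using Cd by linarith
    then have "r * \<bar>N (dir t) - zonal us (dir t)\<bar> \<le> r * e"
      using x by (intro mult_left_mono) auto
    also have "\<dots> \<le> e * (\<bar>x$1\<bar> + \<bar>x$2\<bar>)" using x(6) e by (simp add: mult.commute)
    finally have "\<bar>r * N (dir t) - r * zonal us (dir t)\<bar> \<le> e * (\<bar>x$1\<bar> + \<bar>x$2\<bar>)"
      unfolding right_diff_distrib[symmetric] abs_mult using x(1) by simp
    moreover have "N x = r * N (dir t)" "zonal us x = r * zonal us (dir t)"
      using x by (simp_all add: seminorm_scale[OF N] seminorm_scale[OF seminorm_zonal] abs_mult)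
    ultimately show ?thesis by simp
  qed
  then show ?thesis by (rule that)
qed

section \<open>Crossings of parallel lines\<close>

text \<open>Open segments ignore crossings at vertices, which affects finitely many levels only, and
  they make a segment on which \<open>f\<close> has equal end values contribute nothing.\<close>

fun crossings :: "(real \<Rightarrow> real) \<Rightarrow> real list \<Rightarrow> real \<Rightarrow> nat" where
  "crossings f (x # y # ts) s = of_bool (s \<in> open_segment (f x) (f y)) + crossings f (y # ts) s"
| "crossings f _ s = 0"

lemma open_segment_real_measure:
  fixes a b :: real
  shows "open_segment a b \<in> sets borel" "emeasure lborel (open_segment a b) = ennreal \<bar>b - a\<bar>"
  by (auto simp: open_segment_eq_real_ivl abs_if)


text \<open>Each segment of the polygon is crossed by a set of levels of length
  \<open>\<bar>f y - f x\<bar>\<close>: the one-dimensional form of the Cauchy-Crofton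
  formula.\<close>

lemma nn_integral_crossings:
  "(\<lambda>s. of_nat (crossings f ts s) :: ennreal) \<in> borel_measurable borel \<and>
    (\<integral>\<^sup>+s. of_nat (crossings f ts s) \<partial>lborel) = ennreal (psum (\<lambda>x. \<bar>u \<bullet> x\<bar>) \<gamma> ts)"
  if "\<And>t. f t = u \<bullet> \<gamma> t"
proof (induction ts rule: induct_list012)
  case (3 x y ts)
  let ?S = "open_segment (f x) (f y)"
  have e: "of_nat (crossings f (x # y # ts) s) = (indicator ?S s + of_nat (crossings f (y # ts) s) :: ennreal)" for s
    by (simp add: indicator_def)
  have [measurable]: "?S \<in> sets borel" by (rule open_segment_real_measure)
  have [measurable]: "(\<lambda>s. of_nat (crossings f (y # ts) s) :: ennreal) \<in> borel_measurable borel"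
    using 3 by blast
  have "(\<lambda>s. of_nat (crossings f (x # y # ts) s) :: ennreal) \<in> borel_measurable borel"
    unfolding e by measurable
  moreover have "(\<integral>\<^sup>+s. of_nat (crossings f (x # y # ts) s) \<partial>lborel)
     = ennreal \<bar>f y - f x\<bar> + ennreal (psum (\<lambda>x. \<bar>u \<bullet> x\<bar>) \<gamma> (y # ts))"
    unfolding e using 3 by (subst nn_integral_add) (auto simp: open_segment_real_measure)
  moreover have "\<bar>f y - f x\<bar> = \<bar>u \<bullet> (\<gamma> y - \<gamma> x)\<bar>" using that by (simp add: inner_diff_right)
  ultimately show ?case
    by (simp add: psum_nonneg[OF seminorm_inner])
qed auto

lemma crossings_outside:
  assumes "\<And>t. t \<in> set ts \<Longrightarrow> m \<le> f t \<and> f t \<le> M" "s \<notin> {m<..<M}"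
  shows "crossings f ts s = 0"
  using assms
proof (induction f ts s rule: crossings.induct)
  case (1 f x y ts s)
  have "m \<le> f x \<and> f x \<le> M" "m \<le> f y \<and> f y \<le> M" using 1(2) by auto
  then have "s \<notin> open_segment (f x) (f y)"
    using 1(3) by (auto simp: open_segment_eq_real_ivl split: if_splits)
  with 1 show ?case by simp
qed auto

text \<open>By the intermediate value theorem every crossed segment has a parameter with value
  \<open>s\<close> strictly between its two ends. The left end \<open>hd ts\<close> is left out so
  that the parameters of successive segments are counted disjointly.\<close>

lemma crossings_le_card:
  fixes f :: "real \<Rightarrow> real"
  assumes f: "continuous_on {a..b} f"
  shows "sorted ts \<Longrightarrow> set ts \<subseteq> {a..b} \<Longrightarrow> finite {t\<in>{a<..<b}. f t = s} \<Longrightarrow> ts \<noteq> [] \<Longrightarrow>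
    crossings f ts s \<le> card {t\<in>{hd ts<..<b}. f t = s}"
proof (induction ts rule: induct_list012)
  case (3 x y ts)
  have xy: "a \<le> x" "x \<le> y" "y \<le> b" using 3 by auto
  let ?A = "{t\<in>{x<..<y}. f t = s}" and ?B = "{t\<in>{y<..<b}. f t = s}" and ?C = "{t\<in>{x<..<b}. f t = s}"
  have fin: "finite ?C" by (rule finite_subset[OF _ 3(5)]) (use xy in auto)
  have "of_bool (s \<in> open_segment (f x) (f y)) \<le> card ?A"
  proof (cases "s \<in> open_segment (f x) (f y)")
    case True
    have c: "continuous_on {x..y} f" by (rule continuous_on_subset[OF f]) (use xy in auto)
    have "\<exists>t\<in>{x..y}. f t = s"
      using True xy IVT'[of f x s y] IVT2'[of f y s x] c
      by (fastforce simp: open_segment_eq_real_ivl split: if_splits)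
    then obtain t where t: "t \<in> {x..y}" "f t = s" by blast
    then have "t \<noteq> x" "t \<noteq> y" using True by (auto simp: open_segment_eq_real_ivl split: if_splits)
    with t have "t \<in> ?A" by auto
    then have "?A \<noteq> {}" by blast
    moreover have "finite ?A" by (rule finite_subset[OF _ fin]) (use xy in auto)
    ultimately show ?thesis using True by (simp add: card_gt_0_iff Suc_le_eq)
  qed simp
  moreover have "crossings f (y # ts) s \<le> card ?B" using 3(2)[OF _ _ 3(5)] 3(3,4) by simp
  moreover have "card ?A + card ?B = card (?A \<union> ?B)"
  proof (rule card_Un_disjoint[symmetric])
    show "finite ?A" "finite ?B" by (rule finite_subset[OF _ fin], use xy in force)+
  qed auto
  moreover have "card (?A \<union> ?B) \<le> card ?C" by (rule card_mono[OF fin]) (use xy in auto)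
  ultimately show ?case by simp
qed auto

text \<open>Finite fibres are required only on the open interval \<open>{m<..<M}\<close>: an extreme
  level may be attained on a whole arc, but it is never crossed.\<close>

lemma psum_inner_le_crossings:
  assumes "\<And>t. f t = u \<bullet> \<gamma> t" "continuous_on {a..b} f" "sorted ts" "set ts \<subseteq> {a..b}"
    and "\<And>t. t \<in> {a..b} \<Longrightarrow> m \<le> f t \<and> f t \<le> M"
    and g: "\<And>s. s \<in> {m<..<M} \<Longrightarrow> finite {t\<in>{a<..<b}. f t = s} \<and> of_nat (card {t\<in>{a<..<b}. f t = s}) \<le> (g s :: ennreal)"
  shows "ennreal (psum (\<lambda>x. \<bar>u \<bullet> x\<bar>) \<gamma> ts) \<le> (\<integral>\<^sup>+s. g s * indicator {m<..<M} s \<partial>lborel)"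
proof -
  have "of_nat (crossings f ts s) \<le> g s * indicator {m<..<M} s" for s
  proof (cases "s \<in> {m<..<M} \<and> ts \<noteq> []")
    case True
    then have "crossings f ts s \<le> card {t\<in>{hd ts<..<b}. f t = s}"
      using assms g by (intro crossings_le_card[OF assms(2)]) auto
    also have "\<dots> \<le> card {t\<in>{a<..<b}. f t = s}"
      using g[of s] True assms(4) hd_in_set[of ts] by (intro card_mono) fastforce+
    finally have "(of_nat (crossings f ts s) :: ennreal) \<le> of_nat (card {t\<in>{a<..<b}. f t = s})"
      by (rule of_nat_mono)
    also have "\<dots> \<le> g s" using g[of s] True by blast
    finally show ?thesis using True by simp
  next
    case False
    moreover have "m \<le> f t \<and> f t \<le> M" if "t \<in> set ts" for t using assms(4,5) that by blast
    ultimately have "crossings f ts s = 0"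
      using crossings_outside[of ts m f M s] by (cases "ts = []") auto
    then show ?thesis by simp
  qed
  note le = this
  have "ennreal (psum (\<lambda>x. \<bar>u \<bullet> x\<bar>) \<gamma> ts) = (\<integral>\<^sup>+s. of_nat (crossings f ts s) \<partial>lborel)"
    using nn_integral_crossings[of f u \<gamma>, OF assms(1)] by simp
  also have "\<dots> \<le> (\<integral>\<^sup>+s. g s * indicator {m<..<M} s \<partial>lborel)"
    by (intro nn_integral_mono le)
  finally show ?thesis .
qed

section \<open>Chords of a planar convex body\<close>

definition perp :: "real^2 \<Rightarrow> real^2" where
  "perp u = vector [- u$2, u$1]"

definition hi :: "(real^2) set \<Rightarrow> real^2 \<Rightarrow> real \<Rightarrow> real" where
  "hi K u s = Sup {perp u \<bullet> y |y. y \<in> K \<and> u \<bullet> y = s}"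

text \<open>The vector \<open>u\<close> is not normalized, since the coefficients of a zonal sum are
  absorbed in its directions; hence the factor \<open>1 / (u \<bullet> u)\<close>. The opposite end
  of the chord is \<open>top_pt K (- u) (- s)\<close>, because
  \<open>perp (- u) = - perp u\<close>.\<close>

definition top_pt :: "(real^2) set \<Rightarrow> real^2 \<Rightarrow> real \<Rightarrow> real^2" where
  "top_pt K u s = (1 / (u \<bullet> u)) *\<^sub>R (s *\<^sub>R u + hi K u s *\<^sub>R perp u)"

definition lo :: "(real^2) set \<Rightarrow> real^2 \<Rightarrow> real" where
  "lo K u = Inf ((\<bullet>) u ` K)"

definition up :: "(real^2) set \<Rightarrow> real^2 \<Rightarrow> real" where
  "up K u = Sup ((\<bullet>) u ` K)"

lemma perp_uminus [simp]: "perp (- u) = - perp u"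
  by (simp add: perp_def vec_eq_iff forall_2)

lemma perp_nth [simp]: "perp u $ 1 = - u$2" "perp u $ 2 = u$1"
  by (simp_all add: perp_def)

lemma perp_inner [simp]: "u \<bullet> perp u = 0" "perp u \<bullet> u = 0" "perp u \<bullet> perp u = u \<bullet> u"
  by (simp_all add: inner_vec2)

lemma perp_eq_zero [simp]: "perp u = 0 \<longleftrightarrow> u = 0"
  by (auto simp: vec_eq_iff forall_2)

lemma perp_decomposition:
  assumes "u \<noteq> 0"
  shows "y = (1 / (u \<bullet> u)) *\<^sub>R ((u \<bullet> y) *\<^sub>R u + (perp u \<bullet> y) *\<^sub>R perp u)"
proof -
  have "u \<bullet> u \<noteq> 0" using assms by simp
  then have "u$1 * u$1 + u$2 * u$2 \<noteq> 0" by (simp add: inner_vec2)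
  then show ?thesis
    by (simp add: vec_eq_iff forall_2 inner_vec2 divide_simps) (auto simp: algebra_simps)
qed

lemma eq_if_coords_eq:
  assumes "u \<noteq> 0" "u \<bullet> x = u \<bullet> y" "perp u \<bullet> x = perp u \<bullet> y"
  shows "x = y"
  using perp_decomposition[OF assms(1), of x] perp_decomposition[OF assms(1), of y] assms by simp

lemma lo_uminus: "lo K (- u) = - up K u" and up_uminus: "up K (- u) = - lo K u"
  unfolding lo_def up_def by (simp_all add: Inf_real_def image_image)

lemma inner_top_pt: "u \<noteq> 0 \<Longrightarrow> u \<bullet> top_pt K u s = s"
  and perp_inner_top_pt: "u \<noteq> 0 \<Longrightarrow> perp u \<bullet> top_pt K u s = hi K u s"
  by (simp_all add: top_pt_def inner_add_right)

locale planar_body =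
  fixes K :: "(real^2) set"
  assumes body: "planar_convex_body K"
begin

lemma compact: "compact K" and convex: "convex K" and interior: "interior K \<noteq> {}"
  using body by (auto simp: planar_convex_body_def convex_compacts_def)

lemma closed: "closed K" and bounded: "bounded K"
  using compact compact_imp_closed compact_imp_bounded by auto

lemma nonempty: "K \<noteq> {}"
  using interior interior_subset by auto

lemma closure_interior: "closure (interior K) = K"
  using convex_closure_interior[OF convex interior] closed by simp

lemma compact_proj: "compact ((\<bullet>) u ` K)"
  by (intro compact_continuous_image compact continuous_intros)

lemma lo_le: "y \<in> K \<Longrightarrow> lo K u \<le> u \<bullet> y" and le_up: "y \<in> K \<Longrightarrow> u \<bullet> y \<le> up K u"
  unfolding lo_def up_def
  using compact_proj[THEN compact_imp_bounded]
  by (auto intro!: cInf_lower cSup_upper bounded_imp_bdd_below bounded_imp_bdd_above)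

lemma lo_attained: obtains y where "y \<in> K" "u \<bullet> y = lo K u"
  using closed_contains_Inf[of "(\<bullet>) u ` K"] compact_proj[of u] nonempty
  by (force simp: lo_def compact_eq_bounded_closed dest: bounded_imp_bdd_below)

lemma up_attained: obtains y where "y \<in> K" "u \<bullet> y = up K u"
  using closed_contains_Sup[of "(\<bullet>) u ` K"] compact_proj[of u] nonempty
  by (force simp: up_def compact_eq_bounded_closed dest: bounded_imp_bdd_above)

lemma lo_le_up: "lo K u \<le> up K u"
  using nonempty lo_le le_up by (meson equals0I order_trans)

lemma proj_eq: "(\<bullet>) u ` K = {lo K u..up K u}"
proof -
  have "is_interval ((\<bullet>) u ` K)"
    by (simp add: is_interval_convex_1 convex_linear_image convex linear_iff inner_add_right)
  moreover have "lo K u \<in> (\<bullet>) u ` K" "up K u \<in> (\<bullet>) u ` K"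
    using lo_attained up_attained by (metis imageI)+
  ultimately have "{lo K u..up K u} \<subseteq> (\<bullet>) u ` K"
    unfolding is_interval_1 by (meson atLeastAtMost_iff subsetI)
  moreover have "(\<bullet>) u ` K \<subseteq> {lo K u..up K u}"
    using lo_le le_up by auto
  ultimately show ?thesis by blast
qed

text \<open>Interior points come arbitrarily close to points of \<open>K\<close> on the two extreme
  levels, and the projection of the convex interior is an interval.\<close>

lemma interior_chord:
  assumes s: "lo K u < s" "s < up K u"
  obtains y where "y \<in> interior K" "u \<bullet> y = s"
proof -
  have aux: "\<exists>p\<in>interior K. p \<in> U" if "open U" "y \<in> K" "y \<in> U" for U y
    using open_Int_closure_eq_empty[OF that(1), of "interior K"] that closure_interior by auto
  obtain p where p: "p \<in> interior K" "u \<bullet> p < s"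
  proof -
    obtain y where "y \<in> K" "u \<bullet> y = lo K u" using lo_attained .
    then show ?thesis using aux[OF open_halfspace_lt[of u s], of y] s that by auto
  qed
  obtain q where q: "q \<in> interior K" "u \<bullet> q > s"
  proof -
    obtain y where "y \<in> K" "u \<bullet> y = up K u" using up_attained .
    then show ?thesis using aux[OF open_halfspace_gt[of s u], of y] s that by auto
  qed
  have "is_interval ((\<bullet>) u ` interior K)"
    by (simp add: is_interval_convex_1 convex_linear_image convex_interior convex linear_iff inner_add_right)
  then have "s \<in> (\<bullet>) u ` interior K"
    using mem_is_interval_1_I[of _ "u \<bullet> p" "u \<bullet> q" s] p q by simp
  then show ?thesis using that by auto
qed

lemma chord_compact: "compact {perp u \<bullet> y |y. y \<in> K \<and> u \<bullet> y = s}"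
proof -
  have "{perp u \<bullet> y |y. y \<in> K \<and> u \<bullet> y = s} = (\<bullet>) (perp u) ` (K \<inter> {y. u \<bullet> y = s})" by auto
  then show ?thesis
    by (auto intro!: compact_continuous_image compact_Int_closed compact closed_hyperplane continuous_intros)
qed

lemma le_hi:
  assumes "y \<in> K"
  shows "perp u \<bullet> y \<le> hi K u (u \<bullet> y)"
  unfolding hi_def using assms
  by (intro cSup_upper bounded_imp_bdd_above compact_imp_bounded chord_compact) auto

lemma top_pt_in:
  assumes "u \<noteq> 0" "lo K u \<le> s" "s \<le> up K u"
  shows "top_pt K u s \<in> K"
proof -
  have "s \<in> (\<bullet>) u ` K" using assms by (simp add: proj_eq)
  then have "{perp u \<bullet> y |y. y \<in> K \<and> u \<bullet> y = s} \<noteq> {}" by auto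
  then have "hi K u s \<in> {perp u \<bullet> y |y. y \<in> K \<and> u \<bullet> y = s}"
    unfolding hi_def using chord_compact[of u s]
    by (intro closed_contains_Sup) (auto simp: compact_eq_bounded_closed intro: bounded_imp_bdd_above)
  then obtain y where y: "y \<in> K" "u \<bullet> y = s" "perp u \<bullet> y = hi K u s" by auto
  then have "y = top_pt K u s"
    by (intro eq_if_coords_eq[OF assms(1)]) (auto simp: inner_top_pt perp_inner_top_pt assms)
  with y show ?thesis by simp
qed

lemma hi_gt:
  assumes "u \<noteq> 0" "y \<in> interior K"
  shows "perp u \<bullet> y < hi K u (u \<bullet> y)"
proof -
  obtain e where e: "e > 0" "cball y e \<subseteq> K"
    using assms(2) by (auto simp: mem_interior_cball)
  define z where "z = y + (e / norm (perp u)) *\<^sub>R perp u"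
  have "z \<in> K" using e assms by (auto simp: z_def dist_norm intro!: subsetD[OF e(2)])
  from le_hi[OF this, of u] show ?thesis
    using e assms by (simp add: z_def inner_add_right) (smt (verit) divide_pos_pos inner_gt_zero_iff mult_pos_pos norm_eq_zero perp_eq_zero zero_less_norm_iff)
qed

text \<open>Separation gives the inequality on the interior only; it extends to \<open>K\<close>
  because the interior is dense in \<open>K\<close>.\<close>

lemma supporting_line:
  assumes "y \<notin> interior K"
  obtains a where "a \<noteq> 0" "\<And>z. z \<in> K \<Longrightarrow> a \<bullet> y \<le> a \<bullet> z"
proof -
  obtain a b where a: "a \<noteq> 0" "\<forall>z\<in>{y}. a \<bullet> z \<le> b" "\<forall>z\<in>interior K. b \<le> a \<bullet> z"
    using separating_hyperplane_sets[of "{y}" "interior K"] convex_interior[OF convex] interior assms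
    by auto
  then have "interior K \<subseteq> {z. b \<le> a \<bullet> z}" by auto
  then have "closure (interior K) \<subseteq> {z. b \<le> a \<bullet> z}"
    by (rule closure_minimal) (simp add: closed_halfspace_ge)
  then show ?thesis using a that[of a] by (force simp: closure_interior)
qed

lemma frontier_eq: "frontier K = K - interior K"
  using closed by (simp add: frontier_def)

lemma hi_uminus_less:
  assumes "u \<noteq> 0" "lo K u < s" "s < up K u"
  shows "- hi K (- u) (- s) < hi K u s"
proof -
  obtain y where "y \<in> interior K" "u \<bullet> y = s" using interior_chord assms by blast
  with hi_gt[of u y] hi_gt[of "- u" y] assms show ?thesis by simp
qed

text \<open>A boundary point strictly between the two ends of its chord would have a supporting line
  that contains the chord. That line would be the level \<open>s\<close> of \<open>u\<close>, which
  cannot support \<open>K\<close>, since \<open>s\<close> lies strictly between the extreme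
  levels.\<close>

lemma frontier_chord:
  assumes u: "u \<noteq> 0" and s: "lo K u < s" "s < up K u"
  shows "y \<in> frontier K \<and> u \<bullet> y = s \<longleftrightarrow> y = top_pt K u s \<or> y = top_pt K (- u) (- s)"
proof
  have mu: "- u \<noteq> 0" "lo K (- u) < - s" "- s < up K (- u)"
    using u s by (auto simp: lo_uminus up_uminus)
  have top: "top_pt K v r \<in> frontier K" "v \<bullet> top_pt K v r = r"
    if "v \<noteq> 0" "lo K v < r" "r < up K v" for v r
    using that hi_gt[of v "top_pt K v r"]
    by (auto simp: frontier_eq inner_top_pt perp_inner_top_pt intro: top_pt_in)
  show "y \<in> frontier K \<and> u \<bullet> y = s" if "y = top_pt K u s \<or> y = top_pt K (- u) (- s)"
    using that top[OF u s] top[OF mu] by auto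
  assume y: "y \<in> frontier K \<and> u \<bullet> y = s"
  show "y = top_pt K u s \<or> y = top_pt K (- u) (- s)"
  proof (rule ccontr)
    assume neq: "\<not> ?thesis"
    let ?t = "top_pt K u s" and ?b = "top_pt K (- u) (- s)"
    have yK: "y \<in> K" "y \<notin> interior K" using y by (auto simp: frontier_eq)
    have tK: "?t \<in> K" "?b \<in> K" using top[OF u s] top[OF mu] by (auto simp: frontier_eq)
    have ht: "u \<bullet> ?t = s" "u \<bullet> ?b = s" using top[OF u s] top[OF mu] by auto
    have pt: "perp u \<bullet> ?t = hi K u s" "perp u \<bullet> ?b = - hi K (- u) (- s)"
      using perp_inner_top_pt[OF u] perp_inner_top_pt[OF mu(1)] by (auto simp: minus_equation_iff)
    have "perp u \<bullet> y \<le> perp u \<bullet> ?t" "perp u \<bullet> ?b \<le> perp u \<bullet> y"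
      using le_hi[OF yK(1), of u] le_hi[OF yK(1), of "- u"] y pt by auto
    moreover have "perp u \<bullet> y \<noteq> perp u \<bullet> ?t" "perp u \<bullet> ?b \<noteq> perp u \<bullet> y"
      using neq eq_if_coords_eq[OF u] y ht by metis+
    ultimately have between: "perp u \<bullet> y < perp u \<bullet> ?t" "perp u \<bullet> ?b < perp u \<bullet> y" by auto
    obtain a where a: "a \<noteq> 0" "\<And>z. z \<in> K \<Longrightarrow> a \<bullet> y \<le> a \<bullet> z"
      using supporting_line[OF yK(2)] by blast
    have dec: "a \<bullet> z = ((u \<bullet> a) * (u \<bullet> z) + (perp u \<bullet> a) * (perp u \<bullet> z)) / (u \<bullet> u)" for z
      by (subst perp_decomposition[OF u, of z]) (simp add: inner_add_right inner_commute add_divide_distrib algebra_simps)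
    have uu: "0 < u \<bullet> u" using u by simp
    have "perp u \<bullet> a = 0"
    proof (rule ccontr)
      assume "perp u \<bullet> a \<noteq> 0"
      have "(perp u \<bullet> a) * (perp u \<bullet> y) \<le> (perp u \<bullet> a) * (perp u \<bullet> ?t)"
        "(perp u \<bullet> a) * (perp u \<bullet> y) \<le> (perp u \<bullet> a) * (perp u \<bullet> ?b)"
        using a(2)[OF tK(1)] a(2)[OF tK(2)] uu y ht unfolding dec by (simp_all add: divide_simps)
      with between \<open>perp u \<bullet> a \<noteq> 0\<close> show False
        by (smt (verit) mult_less_cancel_left)
    qed
    then have le: "(u \<bullet> a) * s \<le> (u \<bullet> a) * (u \<bullet> z)" if "z \<in> K" for z
      using a(2)[OF that] uu y unfolding dec by (simp add: divide_simps)
    have "u \<bullet> a \<noteq> 0" using \<open>perp u \<bullet> a = 0\<close> a(1) eq_if_coords_eq[OF u, of a 0] by auto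
    moreover obtain p q where "p \<in> K" "u \<bullet> p = lo K u" "q \<in> K" "u \<bullet> q = up K u"
      using lo_attained up_attained by metis
    ultimately show False
      using le[of p] le[of q] s by (smt (verit) mult_less_cancel_left)
  qed
qed

lemma top_pt_neq:
  assumes "u \<noteq> 0" "lo K u < s" "s < up K u"
  shows "top_pt K u s \<noteq> top_pt K (- u) (- s)"
proof -
  have "perp u \<bullet> top_pt K (- u) (- s) = - hi K (- u) (- s)"
    using perp_inner_top_pt[of "- u" K "- s"] assms by (simp add: minus_equation_iff)
  then show ?thesis using hi_uminus_less[OF assms] perp_inner_top_pt[OF assms(1), of K s] by force
qed

text \<open>\<open>hi\<close> is concave by convexity of \<open>K\<close>, and a concave function is
  continuous on an open interval. This is the source of measurability of the endpoint maps.\<close>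

lemma continuous_on_hi:
  assumes u: "u \<noteq> 0"
  shows "continuous_on {lo K u<..<up K u} (hi K u)"
proof -
  have "concave_on {lo K u<..<up K u} (hi K u)"
    unfolding concave_on_iff
  proof (intro conjI ballI allI impI convex_real_interval)
    fix s t a b assume *: "s \<in> {lo K u<..<up K u}" "t \<in> {lo K u<..<up K u}" "0 \<le> a" "0 \<le> b" "a + b = (1::real)"
    let ?z = "a *\<^sub>R top_pt K u s + b *\<^sub>R top_pt K u t"
    have "?z \<in> K" using * u by (intro convexD[OF convex] top_pt_in) auto
    moreover have "u \<bullet> ?z = a * s + b * t" "perp u \<bullet> ?z = a * hi K u s + b * hi K u t"
      using u by (simp_all add: inner_add_right inner_top_pt perp_inner_top_pt)
    ultimately show "hi K u (a *\<^sub>R s + b *\<^sub>R t) \<ge> a * hi K u s + b * hi K u t"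
      using le_hi[of ?z u] by simp
  qed
  then have "continuous_on {lo K u<..<up K u} (\<lambda>s. - hi K u s)"
    unfolding concave_on_def by (intro convex_on_continuous) auto
  from continuous_on_minus[OF this] show ?thesis by simp
qed

lemma continuous_on_top_pt:
  "u \<noteq> 0 \<Longrightarrow> continuous_on {lo K u<..<up K u} (top_pt K u)"
  unfolding top_pt_def by (intro continuous_intros continuous_on_hi)

lemma lo_less_up:
  assumes "u \<noteq> 0"
  shows "lo K u < up K u"
proof -
  obtain y where "y \<in> interior K" using interior by auto
  then obtain e where e: "e > 0" "cball y e \<subseteq> K" by (auto simp: mem_interior_cball)
  define z where "z = y + (e / norm u) *\<^sub>R u"
  have "z \<in> K" "y \<in> K" using e assms by (auto simp: z_def dist_norm intro!: subsetD[OF e(2)])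
  moreover have "u \<bullet> y < u \<bullet> z" using e assms by (simp add: z_def inner_add_right)
  ultimately show ?thesis using lo_le le_up by (meson le_less_trans less_le_trans)
qed

end

section \<open>Parametrizations of the boundary\<close>

lemma simple_path_dir: "simple_path (\<lambda>t. dir (2 * pi * t))"
proof -
  have "path (\<lambda>t. dir (2 * pi * t))"
  proof -
    have d: "dir = (\<lambda>t. cos t *\<^sub>R axis 1 1 + sin t *\<^sub>R axis 2 1)"
      by (simp add: fun_eq_iff vec_eq_iff forall_2 axis_def)
    show ?thesis unfolding path_def d by (intro continuous_intros)
  qed
  moreover have "loop_free (\<lambda>t. dir (2 * pi * t))"
    unfolding loop_free_def
  proof (intro ballI impI)
    fix x y :: real assume xy: "x \<in> {0..1}" "y \<in> {0..1}" "dir (2 * pi * x) = dir (2 * pi * y)"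
    then have "sin (2 * pi * x) = sin (2 * pi * y) \<and> cos (2 * pi * x) = cos (2 * pi * y)"
      by (metis dir_nth)
    then obtain n :: int where "2 * pi * x = 2 * pi * y + 2 * pi * of_int n"
      using sin_cos_eq_iff by metis
    then have "2 * pi * (x - y - of_int n) = 0" by (simp add: algebra_simps)
    then have x: "x = y + of_int n" by simp
    then have "- 1 \<le> n" "n \<le> 1" using xy by auto
    then have "n = - 1 \<or> n = 0 \<or> n = 1" by auto
    then show "x = y \<or> x = 0 \<and> y = 1 \<or> x = 1 \<and> y = 0"
      using x xy by auto
  qed
  ultimately show ?thesis by (simp add: simple_path_def)
qed

lemma path_image_dir: "path_image (\<lambda>t. dir (2 * pi * t)) = sphere 0 1"
proof
  show "path_image (\<lambda>t. dir (2 * pi * t)) \<subseteq> sphere 0 1"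
    by (auto simp: path_image_def norm_eq_sqrt_inner inner_vec2 power2_eq_square[symmetric])
  show "sphere 0 1 \<subseteq> path_image (\<lambda>t. dir (2 * pi * t))"
  proof
    fix x :: "real^2" assume "x \<in> sphere 0 1"
    then have "(x$1)\<^sup>2 + (x$2)\<^sup>2 = 1"
      by (simp add: norm_eq_sqrt_inner inner_vec2 power2_eq_square)
    then obtain t where t: "0 \<le> t" "t < 2 * pi" "x$1 = cos t" "x$2 = sin t"
      using sincos_total_2pi by metis
    then have "x = dir (2 * pi * (t / (2 * pi)))" by (simp add: vec_eq_iff forall_2)
    moreover have "t / (2 * pi) \<in> {0..1}" using t by (simp add: field_simps)
    ultimately show "x \<in> path_image (\<lambda>t. dir (2 * pi * t))"
      unfolding path_image_def by blast
  qed
qed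

context planar_body
begin

text \<open>The boundary is homeomorphic to the unit circle. The existence of such a path makes the
  choice in \<open>param_of\<close> meaningful.\<close>

lemma frontier_simple_path: obtains \<gamma> where "simple_path \<gamma>" "path_image \<gamma> = frontier K"
proof -
  have "rel_frontier (cball (0::real^2) 1) homeomorphic rel_frontier K"
    using interior
    by (intro homeomorphic_rel_frontiers_convex_bounded_sets convex bounded bounded_cball convex_cball)
       (simp add: aff_dim_nonempty_interior)
  then have "sphere (0::real^2) 1 homeomorphic frontier K"
    using interior by (simp add: rel_frontier_nonempty_interior)
  then obtain h k where "homeomorphism (sphere (0::real^2) 1) (frontier K) h k"
    by (auto simp: homeomorphic_def)
  then have h: "continuous_on (sphere 0 1) h" "inj_on h (sphere 0 1)" "h ` sphere 0 1 = frontier K"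
    by (auto simp: homeomorphism_def intro: inj_on_inverseI)
  show ?thesis
  proof
    show "simple_path (h \<circ> (\<lambda>t. dir (2 * pi * t)))"
      using h by (intro simple_path_continuous_image simple_path_dir) (auto simp: path_image_dir)
    show "path_image (h \<circ> (\<lambda>t. dir (2 * pi * t))) = frontier K"
      unfolding path_image_compose path_image_dir by (rule h)
  qed
qed

text \<open>Excludes the clause of \<open>parametrizes\<close> for constant paths, so that the path
  chosen for a boundary is simple.\<close>

lemma frontier_not_singleton: "frontier K \<noteq> {p}"
proof
  assume p: "frontier K = {p}"
  define u :: "real^2" where "u = axis 1 1"
  have u: "u \<noteq> 0" by (simp add: u_def axis_eq_0_iff)
  obtain s where s: "lo K u < s" "s < up K u" using dense lo_less_up[OF u] by blast
  have "top_pt K u s \<in> {p}" "top_pt K (- u) (- s) \<in> {p}"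
    unfolding p[symmetric] using frontier_chord[OF u s] by auto
  then show False using top_pt_neq[OF u s] by simp
qed

text \<open>An arc does not separate the plane, whereas the boundary of a convex body does.\<close>

lemma frontier_path_closed:
  assumes "simple_path \<gamma>" "path_image \<gamma> = frontier K"
  shows "\<gamma> 0 = \<gamma> 1"
proof (rule ccontr)
  assume "\<gamma> 0 \<noteq> \<gamma> 1"
  then have "arc \<gamma>" using assms by (simp add: arc_simple_path pathstart_def pathfinish_def)
  then have "connected (- frontier K)" using connected_arc_complement[of \<gamma>] assms by simp
  moreover have "- frontier K \<inter> interior K \<noteq> {}" using interior by (auto simp: frontier_eq)
  moreover have "- K \<noteq> {}" using bounded not_bounded_UNIV by (metis Compl_empty_eq double_compl)
  then have "- frontier K - interior K \<noteq> {}" using interior_subset by (auto simp: frontier_eq)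
  ultimately have "- frontier K \<inter> frontier (interior K) \<noteq> {}"
    by (intro connected_Int_frontier) auto
  moreover have "frontier (interior K) \<subseteq> frontier K"
    by (simp add: frontier_def closure_interior closed)
  ultimately show False by auto
qed

end

lemma emeasure_distr_restrict_lborel:
  assumes "f \<in> borel_measurable (restrict_space lborel I)" "I \<in> sets borel" "A \<in> sets borel"
  shows "emeasure (distr (restrict_space lborel I) borel f) A = emeasure lborel {s\<in>I. f s \<in> A}"
    and "{s\<in>I. f s \<in> A} \<in> sets borel"
proof -
  have eq: "f -` A \<inter> space (restrict_space lborel I) = {s\<in>I. f s \<in> A}"
    by (auto simp: space_restrict_space)
  have "f -` A \<inter> space (restrict_space lborel I) \<in> sets (restrict_space lborel I)"
    using assms by (intro measurable_sets)
  then show "{s\<in>I. f s \<in> A} \<in> sets borel"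
    unfolding eq using assms by (auto simp: sets_restrict_space_iff)
  show "emeasure (distr (restrict_space lborel I) borel f) A = emeasure lborel {s\<in>I. f s \<in> A}"
    using assms by (subst emeasure_distr) (simp_all only: eq, auto simp: emeasure_restrict_space)
qed

lemma emeasure_lborel_reflect:
  assumes "S \<in> sets (borel :: real measure)"
  shows "emeasure lborel {s. - s \<in> S} = emeasure lborel S"
proof -
  have "emeasure lborel S = (\<integral>\<^sup>+s. indicator S s \<partial>lborel)" using assms by simp
  also have "\<dots> = (\<integral>\<^sup>+s. indicator S (0 + (-1) * s) \<partial>lborel)"
    using assms by (subst nn_integral_real_affine[where c="-1" and t=0]) auto
  also have "\<dots> = (\<integral>\<^sup>+s. indicator {s. - s \<in> S} s \<partial>lborel)"
    by (intro nn_integral_cong) (auto simp: indicator_def)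
  also have "\<dots> = emeasure lborel {s. - s \<in> S}"
    using assms by (intro nn_integral_indicator) simp
  finally show ?thesis by simp
qed

text \<open>The open interval leaves out the extreme levels, whose lines may meet the boundary in a
  segment; they form a null set. For \<open>u = 0\<close> and nonempty \<open>K\<close> it is empty,
  which disposes of the degenerate direction.\<close>

definition width_int :: "(real^2) set \<Rightarrow> real^2 \<Rightarrow> real set" where
  "width_int K u = {lo K u<..<up K u}"

lemma width_int_uminus: "s \<in> width_int K (- u) \<longleftrightarrow> - s \<in> width_int K u"
  by (auto simp: width_int_def lo_uminus up_uminus)

lemma width_int_borel [measurable]: "width_int K u \<in> sets borel"
  by (simp add: width_int_def)

lemma emeasure_distr_width_int_uminus:
  assumes "f \<in> borel_measurable (restrict_space lborel (width_int K (- u)))" "A \<in> sets borel"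
  shows "emeasure (distr (restrict_space lborel (width_int K (- u))) borel f) A
      = emeasure lborel {s\<in>width_int K u. f (- s) \<in> A}"
    "{s\<in>width_int K u. f (- s) \<in> A} \<in> sets borel"
proof -
  let ?S = "{s\<in>width_int K (- u). f s \<in> A}"
  have eq: "{s\<in>width_int K u. f (- s) \<in> A} = {s. - s \<in> ?S}"
    by (simp add: width_int_uminus)
  note * = emeasure_distr_restrict_lborel[OF assms(1) width_int_borel assms(2)]
  show "emeasure (distr (restrict_space lborel (width_int K (- u))) borel f) A
      = emeasure lborel {s\<in>width_int K u. f (- s) \<in> A}"
    unfolding eq emeasure_lborel_reflect[OF *(2)] by (rule *(1))
  have "uminus -` ?S \<inter> space borel \<in> sets borel" by (rule measurable_sets[OF _ *(2)]) simp
  then show "{s\<in>width_int K u. f (- s) \<in> A} \<in> sets borel"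
    unfolding eq by (simp add: vimage_def)
qed

context planar_body
begin

lemma width_int_zero: "width_int K 0 = {}"
  using nonempty by (simp add: width_int_def lo_def up_def image_constant_conv)

lemma top_pt_measurable: "top_pt K u \<in> borel_measurable (restrict_space lborel (width_int K u))"
proof (cases "u = 0")
  case True
  then show ?thesis by (simp add: width_int_zero measurable_def space_restrict_space)
next
  case False
  then have "top_pt K u \<in> borel_measurable (restrict_space borel (width_int K u))"
    unfolding width_int_def by (intro borel_measurable_continuous_on_restrict continuous_on_top_pt)
  moreover have "sets (restrict_space lborel (width_int K u)) = sets (restrict_space borel (width_int K u))"
    by (rule sets_restrict_space_cong) simp
  ultimately show ?thesis
    using measurable_cong_sets by blast
qed

lemma emeasure_width_int_finite: "emeasure lborel {s\<in>width_int K u. P s} < \<infinity>"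
proof -
  have "emeasure lborel {s\<in>width_int K u. P s} \<le> emeasure lborel {lo K u..up K u}"
    by (intro emeasure_mono) (auto simp: width_int_def)
  then show ?thesis using lo_le_up[of u] by (simp add: le_less_trans)
qed

end

section \<open>Simple paths onto the boundary and their variation in one direction\<close>

locale boundary_path = planar_body +
  fixes \<gamma> :: "real \<Rightarrow> real^2"
  assumes simple: "simple_path \<gamma>" and image: "path_image \<gamma> = frontier K"
begin

lemma start_end: "\<gamma> 0 = \<gamma> 1"
  by (rule frontier_path_closed[OF simple image])

lemma continuous: "continuous_on {0..1} \<gamma>"
  using simple by (simp add: simple_path_def path_def)

lemma inj: "x \<in> {0..<1} \<Longrightarrow> y \<in> {0..<1} \<Longrightarrow> \<gamma> x = \<gamma> y \<Longrightarrow> x = y"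
  using simple by (fastforce simp: simple_path_def loop_free_def)

lemma on_frontier: "t \<in> {0..1} \<Longrightarrow> \<gamma> t \<in> frontier K"
  using image by (auto simp: path_image_def)

lemma in_body: "t \<in> {0..1} \<Longrightarrow> \<gamma> t \<in> K"
  using on_frontier by (auto simp: frontier_eq)

lemma on_frontier_obtain:
  assumes "p \<in> frontier K" obtains t where "t \<in> {0..<1}" "\<gamma> t = p"
proof -
  have "p \<in> \<gamma> ` {0..1}" using assms image by (simp add: path_image_def)
  then obtain t where t: "t \<in> {0..1}" "\<gamma> t = p" by auto
  show ?thesis
  proof (cases "t = 1")
    case True
    with t start_end show ?thesis by (intro that[of 0]) auto
  next
    case False
    with t show ?thesis by (intro that[of t]) auto
  qed
qed

text \<open>The half-open range \<open>{0..<1}\<close> removes the double point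
  \<open>\<gamma> 0 = \<gamma> 1\<close> of the closed path, which makes the parameter
  unique.\<close>

definition tau :: "real^2 \<Rightarrow> real \<Rightarrow> real" where
  "tau u s = (THE t. t \<in> {0..<1} \<and> \<gamma> t = top_pt K u s)"

lemma tau:
  assumes "s \<in> width_int K u"
  shows "tau u s \<in> {0..<1}" "\<gamma> (tau u s) = top_pt K u s"
    "t \<in> {0..<1} \<Longrightarrow> \<gamma> t = top_pt K u s \<Longrightarrow> t = tau u s"
proof -
  have u: "u \<noteq> 0" using assms width_int_zero by auto
  have "top_pt K u s \<in> frontier K"
    using assms frontier_chord[OF u] by (auto simp: width_int_def)
  then have "\<exists>!t. t \<in> {0..<1} \<and> \<gamma> t = top_pt K u s"
    using on_frontier_obtain inj by metis
  from theI'[OF this] show *: "tau u s \<in> {0..<1}" "\<gamma> (tau u s) = top_pt K u s"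
    unfolding tau_def by auto
  show "t \<in> {0..<1} \<Longrightarrow> \<gamma> t = top_pt K u s \<Longrightarrow> t = tau u s"
    using * inj by metis
qed

text \<open>Turns sublevel sets of \<open>tau\<close> into preimages of compact arcs under the
  measurable map \<open>top_pt\<close>. The cut \<open>min b 1\<close> keeps the arc inside the
  parameter domain.\<close>

lemma tau_le_iff:
  assumes "s \<in> width_int K u"
  shows "tau u s \<le> b \<longleftrightarrow> top_pt K u s \<in> \<gamma> ` {0..min b 1}"
proof
  assume "tau u s \<le> b"
  then show "top_pt K u s \<in> \<gamma> ` {0..min b 1}"
    using tau(1,2)[OF assms] by (intro image_eqI[of _ _ "tau u s"]) auto
next
  assume "top_pt K u s \<in> \<gamma> ` {0..min b 1}"
  then obtain t where t: "top_pt K u s = \<gamma> t" "0 \<le> t" "t \<le> b" "t \<le> 1" by auto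
  show "tau u s \<le> b"
  proof (cases "t = 1")
    case True
    with t tau(1)[OF assms] show ?thesis by auto
  next
    case False
    with t tau(3)[OF assms, of t] show ?thesis by auto
  qed
qed

lemma tau_measurable: "tau u \<in> borel_measurable (restrict_space lborel (width_int K u))"
proof (rule borel_measurableI_le)
  fix b
  have "{s \<in> space (restrict_space lborel (width_int K u)). tau u s \<le> b}
    = {s \<in> space (restrict_space lborel (width_int K u)). top_pt K u s \<in> \<gamma> ` {0..min b 1}}"
    using tau_le_iff by (auto simp: space_restrict_space)
  moreover have "compact (\<gamma> ` {0..min b 1})"
    by (intro compact_continuous_image continuous_on_subset[OF continuous]) auto
  then have [measurable]: "\<gamma> ` {0..min b 1} \<in> sets borel" by (intro borel_closed compact_imp_closed)
  note [measurable] = top_pt_measurable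
  have "{s \<in> space (restrict_space lborel (width_int K u)). top_pt K u s \<in> \<gamma> ` {0..min b 1}}
    \<in> sets (restrict_space lborel (width_int K u))" by measurable
  ultimately show "{s \<in> space (restrict_space lborel (width_int K u)). tau u s \<le> b}
    \<in> sets (restrict_space lborel (width_int K u))" by simp
qed

definition nu_half :: "real^2 \<Rightarrow> real measure" where
  "nu_half u = distr (restrict_space lborel (width_int K u)) borel (tau u)"

text \<open>Carries Lebesgue measure on the levels to the parameters of both ends of the chords. It
  turns out to be the measure whose distribution function is the variation of
  \<open>\<gamma>\<close> in direction \<open>u\<close>.\<close>

definition nu :: "real^2 \<Rightarrow> real measure" where
  "nu u = measure_add (nu_half u) (nu_half (- u))"

lemma emeasure_nu_half:
  "A \<in> sets borel \<Longrightarrow> emeasure (nu_half u) A = emeasure lborel {s\<in>width_int K u. tau u s \<in> A}"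
  "A \<in> sets borel \<Longrightarrow> {s\<in>width_int K u. tau u s \<in> A} \<in> sets borel"
  unfolding nu_half_def by (auto intro!: emeasure_distr_restrict_lborel tau_measurable)

lemma emeasure_nu_half_uminus:
  "A \<in> sets borel \<Longrightarrow> emeasure (nu_half (- u)) A = emeasure lborel {s\<in>width_int K u. tau (- u) (- s) \<in> A}"
  "A \<in> sets borel \<Longrightarrow> {s\<in>width_int K u. tau (- u) (- s) \<in> A} \<in> sets borel"
  unfolding nu_half_def by (auto intro!: emeasure_distr_width_int_uminus tau_measurable)

lemma sets_nu [simp]: "sets (nu u) = sets borel" and space_nu [simp]: "space (nu u) = UNIV"
  by (simp_all add: nu_def nu_half_def)

lemma emeasure_nu:
  assumes "A \<in> sets borel"
  shows "emeasure (nu u) A = emeasure lborel {s\<in>width_int K u. tau u s \<in> A}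
    + emeasure lborel {s\<in>width_int K u. tau (- u) (- s) \<in> A}"
  unfolding nu_def using assms emeasure_nu_half_uminus[OF assms] emeasure_nu_half[OF assms]
  by (subst emeasure_measure_add) (auto simp: nu_half_def)

lemma emeasure_nu_UNIV:
  "emeasure (nu u) UNIV = ennreal (2 * (up K u - lo K u))"
proof -
  have e: "{s\<in>width_int K u. f s \<in> UNIV} = {lo K u<..<up K u}" for f :: "real \<Rightarrow> real"
    by (auto simp: width_int_def)
  have "emeasure (nu u) UNIV = emeasure lborel {s\<in>width_int K u. tau u s \<in> UNIV}
    + emeasure lborel {s\<in>width_int K u. tau (- u) (- s) \<in> UNIV}"
    by (rule emeasure_nu) simp
  also have "\<dots> = emeasure lborel {lo K u<..<up K u} + emeasure lborel {lo K u<..<up K u}"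
    by (simp only: e)
  also have "\<dots> = ennreal (2 * (up K u - lo K u))"
    using lo_le_up[of u] by (simp add: ennreal_plus[symmetric] del: ennreal_plus)
  finally show ?thesis .
qed

sublocale nu: finite_borel_measure "nu u" for u
  by (intro finite_borel_measure.intro finite_measureI finite_borel_measure_axioms.intro)
     (simp_all add: emeasure_nu_UNIV)

lemma measure_nu_UNIV: "measure (nu u) UNIV = 2 * (up K u - lo K u)"
  using lo_le_up[of u] by (simp add: measure_def emeasure_nu_UNIV)

text \<open>On each level inside the width, at most the two parameters of the chord ends lie between
  \<open>a\<close> and \<open>b\<close>, and \<open>nu u\<close> counts those in
  \<open>A\<close>.\<close>

lemma psum_le_nu:
  assumes ts: "sorted ts" "set ts \<subseteq> {a..b}" and ab: "0 \<le> a" "b \<le> 1"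
    and A: "A \<in> sets borel" "{a<..<b} \<subseteq> A"
  shows "psum (\<lambda>x. \<bar>u \<bullet> x\<bar>) \<gamma> ts \<le> measure (nu u) A"
proof -
  define g :: "real \<Rightarrow> ennreal" where
    "g s = indicator {s\<in>width_int K u. tau u s \<in> A} s + indicator {s\<in>width_int K u. tau (- u) (- s) \<in> A} s" for s
  have "ennreal (psum (\<lambda>x. \<bar>u \<bullet> x\<bar>) \<gamma> ts) \<le> (\<integral>\<^sup>+s. g s * indicator {lo K u<..<up K u} s \<partial>lborel)"
  proof (rule psum_inner_le_crossings[where f="\<lambda>t. u \<bullet> \<gamma> t", OF refl _ ts])
    show "continuous_on {a..b} (\<lambda>t. u \<bullet> \<gamma> t)"
      using ab by (intro continuous_intros continuous_on_subset[OF continuous]) auto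
    show "lo K u \<le> u \<bullet> \<gamma> t \<and> u \<bullet> \<gamma> t \<le> up K u" if "t \<in> {a..b}" for t
      using in_body[of t] lo_le le_up that ab by auto
    fix s assume s: "s \<in> {lo K u<..<up K u}"
    then have s': "s \<in> width_int K u" "- s \<in> width_int K (- u)"
      unfolding width_int_uminus by (simp_all add: width_int_def)
    then have u: "u \<noteq> 0" using width_int_zero by auto
    let ?T = "{t\<in>{a<..<b}. u \<bullet> \<gamma> t = s}"
    have sub: "?T \<subseteq> {tau u s, tau (- u) (- s)} \<inter> A"
    proof
      fix t assume t: "t \<in> ?T"
      then have t': "t \<in> {0..<1}" "t \<in> A" using ab A by auto
      then have "\<gamma> t \<in> frontier K \<and> u \<bullet> \<gamma> t = s" using t on_frontier by auto
      then have "\<gamma> t = top_pt K u s \<or> \<gamma> t = top_pt K (- u) (- s)"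
        using frontier_chord[OF u] s by simp
      then show "t \<in> {tau u s, tau (- u) (- s)} \<inter> A"
        using tau(3)[OF s'(1) t'(1)] tau(3)[OF s'(2) t'(1)] t' by blast
    qed
    then have "card ?T \<le> card ({tau u s, tau (- u) (- s)} \<inter> A)"
      by (intro card_mono) auto
    also have "\<dots> \<le> of_bool (tau u s \<in> A) + of_bool (tau (- u) (- s) \<in> A)"
      by (auto simp: card_insert_if)
    finally have "(of_nat (card ?T) :: ennreal) \<le> of_nat (of_bool (tau u s \<in> A) + of_bool (tau (- u) (- s) \<in> A))"
      by (rule of_nat_mono)
    also have "\<dots> = g s" using s' by (auto simp: g_def)
    finally show "finite ?T \<and> of_nat (card ?T) \<le> g s"
      using finite_subset[OF sub] by simp
  qed
  also have "\<dots> = (\<integral>\<^sup>+s. g s \<partial>lborel)"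
    by (intro nn_integral_cong) (auto simp: g_def width_int_def indicator_def)
  also have "\<dots> = emeasure (nu u) A"
    unfolding g_def using A emeasure_nu_half(2) emeasure_nu_half_uminus(2)
    by (subst nn_integral_add) (auto simp: emeasure_nu)
  also have "\<dots> = ennreal (measure (nu u) A)" by (rule nu.emeasure_eq_measure)
  finally show ?thesis by simp
qed

text \<open>Two coordinate directions bound the norm, and in each of them the crossing count bounds
  all polygon sums by twice the width.\<close>

lemma rectifiable: "rectifiable \<gamma>"
  unfolding rectifiable_def bdd_above_def
proof (intro exI ballI)
  fix x assume "x \<in> inscribed_lengths norm \<gamma> 0 1"
  then obtain ts where ts: "x = psum norm \<gamma> ts" "sorted ts" "set ts \<subseteq> {0..1}"
    by (auto simp: inscribed_lengths_psum)
  have "norm x \<le> \<bar>axis 1 1 \<bullet> x\<bar> + \<bar>axis 2 1 \<bullet> x\<bar>" for x :: "real^2"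
    using norm_le_l1_cart[of x] by (simp add: sum_2 inner_axis')
  then have "x \<le> psum (\<lambda>x. \<bar>axis 1 1 \<bullet> x\<bar> + \<bar>axis 2 1 \<bullet> x\<bar>) \<gamma> ts"
    unfolding ts by (rule psum_mono)
  also have "\<dots> \<le> measure (nu (axis 1 1)) UNIV + measure (nu (axis 2 1)) UNIV"
    unfolding psum_add using ts by (intro add_mono psum_le_nu) auto
  finally show "x \<le> measure (nu (axis 1 1)) UNIV + measure (nu (axis 2 1)) UNIV" .
qed

text \<open>A closed curve has variation at least twice its oscillation in the direction \<open>u\<close>, while the
  crossing count bounds the variation of the two parts of the curve by the corresponding parts of
  the same total. Hence all these estimates are equalities.\<close>

lemma var_inner:
  assumes t: "t \<in> {0..1}"
  shows "var (\<lambda>x. \<bar>u \<bullet> x\<bar>) \<gamma> 0 t = measure (nu u) {..t}"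
proof -
  let ?N = "\<lambda>x. \<bar>u \<bullet> x\<bar>"
  have "var ?N \<gamma> 0 t \<le> measure (nu u) {..t}"
    using t by (intro var_least psum_le_nu) auto
  moreover have "var ?N \<gamma> t 1 \<le> measure (nu u) {t<..}"
    using t by (intro var_least psum_le_nu) auto
  moreover have "measure (nu u) {..t} + measure (nu u) {t<..} = measure (nu u) UNIV"
  proof -
    have "{..t} \<union> {t<..} = UNIV" by auto
    then show ?thesis by (subst nu.finite_measure_Union[symmetric]) auto
  qed
  moreover have "measure (nu u) UNIV \<le> var ?N \<gamma> 0 1"
  proof -
    \<comment> \<open>A point of \<open>K\<close> that is extreme in direction \<open>u\<close> or
      \<open>- u\<close> is on the boundary, as it could otherwise be moved further; so the path
      attains both extreme levels.\<close>
    have ex: "\<exists>t\<in>{0..1}. u \<bullet> \<gamma> t = u \<bullet> y" if y: "y \<in> K" and supp: "\<And>z. z \<in> K \<Longrightarrow> v \<bullet> z \<le> v \<bullet> y" "v = u \<or> v = - u" for y v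
    proof (cases "u = 0")
      case True
      then show ?thesis by (intro bexI[of _ 0]) auto
    next
      case False
      have "y \<notin> interior K"
      proof
        assume "y \<in> interior K"
        then obtain e where e: "e > 0" "cball y e \<subseteq> K" by (auto simp: mem_interior_cball)
        have v: "v \<noteq> 0" using False supp by auto
        have "y + (e / norm v) *\<^sub>R v \<in> K" using e v by (intro subsetD[OF e(2)]) (simp add: dist_norm)
        from supp(1)[OF this] e v show False
          by (simp add: inner_add_right) (meson divide_nonneg_pos divide_pos_pos inner_gt_zero_iff leD mult_pos_pos zero_less_norm_iff)
      qed
      then have "y \<in> frontier K" using y by (simp add: frontier_eq)
      then obtain t where "t \<in> {0..<1}" "\<gamma> t = y" by (rule on_frontier_obtain)
      then show ?thesis by (intro bexI[of _ t]) auto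
    qed
    obtain y where y: "y \<in> K" "u \<bullet> y = lo K u" using lo_attained .
    obtain z where z: "z \<in> K" "u \<bullet> z = up K u" using up_attained .
    obtain p where p: "p \<in> {0..1}" "u \<bullet> \<gamma> p = lo K u"
      using ex[of y "- u"] y lo_le[of _ u] by auto
    obtain q where q: "q \<in> {0..1}" "u \<bullet> \<gamma> q = up K u"
      using ex[of z "u"] z le_up[of _ u] by auto
    have "psum ?N \<gamma> [0, min p q, max p q, 1] \<le> var ?N \<gamma> 0 1"
      using p q by (intro psum_le_var rectifiable seminorm_inner) auto
    \<comment> \<open>Because \<open>\<gamma> 0 = \<gamma> 1\<close>, the outer two segments
      together change \<open>u \<bullet> \<gamma>\<close> by at least a full oscillation, as the
      middle one does.\<close>
    moreover have "2 * (up K u - lo K u) \<le> psum ?N \<gamma> [0, min p q, max p q, 1]"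
      using p q start_end lo_le[OF in_body[of 0], of u] le_up[OF in_body[of 0], of u]
      by (cases "p \<le> q") (auto simp: inner_diff_right min_def max_def abs_if)
    ultimately show ?thesis by (simp add: measure_nu_UNIV)
  qed
  moreover have "var ?N \<gamma> 0 1 = var ?N \<gamma> 0 t + var ?N \<gamma> t 1"
    using t by (intro var_add_interval rectifiable seminorm_inner) auto
  ultimately show ?thesis by linarith
qed

end

section \<open>Length measures\<close>

text \<open>Distribution functions, not normalized, of measures carried by \<open>{0..1}\<close>;
  the value \<open>0\<close> at \<open>0\<close> excludes an atom there.\<close>

definition unit_cdf :: "(real \<Rightarrow> real) \<Rightarrow> bool" where
  "unit_cdf F \<longleftrightarrow> mono F \<and> (\<forall>a. continuous (at_right a) F) \<and> (\<forall>t\<le>0. F t = 0) \<and> (\<forall>t\<ge>1. F t = F 1)"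

lemma unit_cdf_limits:
  assumes "unit_cdf F"
  shows "(F \<longlongrightarrow> 0) at_bot" "(F \<longlongrightarrow> F 1) at_top" "0 \<le> F 1"
proof -
  have F: "mono F" "\<And>t. t \<le> 0 \<Longrightarrow> F t = 0" "\<And>t. 1 \<le> t \<Longrightarrow> F t = F 1"
    using assms unfolding unit_cdf_def by blast+
  show "(F \<longlongrightarrow> 0) at_bot"
    by (rule tendsto_eventually, rule eventually_mono[OF eventually_le_at_bot[of 0]]) (rule F)
  show "(F \<longlongrightarrow> F 1) at_top"
    by (rule tendsto_eventually, rule eventually_mono[OF eventually_ge_at_top[of 1]]) (rule F)
  show "0 \<le> F 1" using monoD[OF F(1), of 0 1] F(2)[of 0] by simp
qed

lemma
  assumes "unit_cdf F"
  shows unit_cdf_finite: "finite_borel_measure (interval_measure F)"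
    and cdf_unit_cdf: "cdf (interval_measure F) = F"
    and emeasure_unit_cdf: "emeasure (interval_measure F) UNIV = ennreal (F 1)"
proof -
  note * = unit_cdf_limits[OF assms]
  have m: "\<And>x y. x \<le> y \<Longrightarrow> F x \<le> F y" "\<And>a. continuous (at_right a) F"
    using assms unfolding unit_cdf_def mono_def by blast+
  show "finite_borel_measure (interval_measure F)"
    by (rule finite_borel_measure_interval_measure[OF m *])
  show "cdf (interval_measure F) = F" by (rule cdf_interval_measure[OF m *(1)])
  show "emeasure (interval_measure F) UNIV = ennreal (F 1)"
    by (rule interval_measure_UNIV[OF m *])
qed

lemma unit_cdf_add: "unit_cdf F \<Longrightarrow> unit_cdf G \<Longrightarrow> unit_cdf (\<lambda>t. F t + G t)"
proof -
  assume F: "unit_cdf F" and G: "unit_cdf G"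
  have "F t + G t = F 1 + G 1" if "1 \<le> t" for t
  proof -
    have "F t = F 1" "G t = G 1" using that F G unfolding unit_cdf_def by blast+
    then show ?thesis by (rule arg_cong2)
  qed
  moreover have "F t + G t = 0" if "t \<le> 0" for t
  proof -
    have "F t = 0" "G t = 0" using that F G unfolding unit_cdf_def by blast+
    then show ?thesis by simp
  qed
  moreover have "mono (\<lambda>t. F t + G t)"
    using F G unfolding unit_cdf_def mono_def by (meson add_mono)
  moreover have "continuous (at_right a) (\<lambda>t. F t + G t)" for a
    using F G unfolding unit_cdf_def by (intro continuous_add) blast+
  ultimately show ?thesis unfolding unit_cdf_def by blast
qed

lemma measure_add_finite_borel:
  assumes "finite_borel_measure M" "finite_borel_measure N"
  shows "finite_borel_measure (measure_add M N)"
    "A \<in> sets borel \<Longrightarrow> measure (measure_add M N) A = measure M A + measure N A"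
proof -
  interpret M: finite_borel_measure M by fact
  interpret N: finite_borel_measure N by fact
  have s: "sets M = sets borel" "sets N = sets borel" "space M = UNIV"
    using M.M_is_borel N.M_is_borel M.borel_UNIV by auto
  have e: "emeasure (measure_add M N) A = emeasure M A + emeasure N A" if "A \<in> sets borel" for A
    using that s by (intro emeasure_measure_add) auto
  show "finite_borel_measure (measure_add M N)"
    using s by (intro finite_borel_measure.intro finite_measureI finite_borel_measure_axioms.intro)
      (auto simp: e ennreal_add_eq_top)
  show "A \<in> sets borel \<Longrightarrow> measure (measure_add M N) A = measure M A + measure N A"
    unfolding measure_def e
    by (rule enn2real_plus) (simp_all add: M.emeasure_finite N.emeasure_finite less_top[symmetric])
qed

lemma measure_interval_measure_add:
  assumes F: "unit_cdf F" and G: "unit_cdf G" and A: "A \<in> sets borel"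
  shows "measure (interval_measure (\<lambda>t. F t + G t)) A
    = measure (interval_measure F) A + measure (interval_measure G) A"
proof -
  note FG = unit_cdf_finite[OF F] unit_cdf_finite[OF G]
  have "interval_measure (\<lambda>t. F t + G t) = measure_add (interval_measure F) (interval_measure G)"
  proof (rule cdf_unique')
    show "cdf (interval_measure (\<lambda>t. F t + G t)) = cdf (measure_add (interval_measure F) (interval_measure G))"
      unfolding cdf_unit_cdf[OF unit_cdf_add[OF F G]]
      by (simp add: cdf_def measure_add_finite_borel(2)[OF FG] fun_eq_iff
          cdf_unit_cdf[OF F, unfolded cdf_def fun_eq_iff, rule_format]
          cdf_unit_cdf[OF G, unfolded cdf_def fun_eq_iff, rule_format])
  qed (intro unit_cdf_finite unit_cdf_add F G measure_add_finite_borel FG)+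
  then show ?thesis using measure_add_finite_borel(2)[OF FG A] by simp
qed

text \<open>Transfers right continuity from the variation of a zonal majorant, which is known
  explicitly, to that of a general seminorm.\<close>

lemma continuous_at_right_dominated:
  fixes F G :: "real \<Rightarrow> real"
  assumes "\<And>s t. s \<le> t \<Longrightarrow> \<bar>F t - F s\<bar> \<le> G t - G s" "continuous (at_right a) G"
  shows "continuous (at_right a) F"
proof -
  have "((\<lambda>t. G t - G a) \<longlongrightarrow> 0) (at_right a)"
    using assms(2) by (simp add: continuous_within LIM_zero_iff)
  then have "((\<lambda>t. F t - F a) \<longlongrightarrow> 0) (at_right a)"
    by (rule Lim_null_comparison[rotated]) (auto simp: eventually_at_filter intro!: assms(1) always_eventually)
  then show ?thesis by (simp add: continuous_within LIM_zero_iff)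
qed

definition wid :: "(real^2) set \<Rightarrow> real^2 \<Rightarrow> real" where
  "wid K u = measure lborel ((\<bullet>) u ` K)"

text \<open>The length measure of the boundary for the seminorm
  \<open>\<bar>u \<bullet> _\<bar>\<close>, expressed without a parametrization; this is what allows
  the boundaries of translated and reflected bodies to be compared.\<close>

definition boundary_mass :: "(real^2) set \<Rightarrow> real^2 \<Rightarrow> (real^2) set \<Rightarrow> real" where
  "boundary_mass K u A = measure lborel {s\<in>width_int K u. top_pt K u s \<in> A}
    + measure lborel {s\<in>width_int K u. top_pt K (- u) (- s) \<in> A}"

lemma (in planar_body) wid_eq: "wid K u = up K u - lo K u"
  using lo_le_up by (simp add: wid_def proj_eq)

context boundary_path
begin

definition cum :: "(real^2 \<Rightarrow> real) \<Rightarrow> real \<Rightarrow> real" where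
  "cum N t = var N \<gamma> 0 (max 0 (min 1 t))"

lemma var_zero_zero: "is_seminorm N \<Longrightarrow> var N \<gamma> 0 0 = 0"
  using var_add_interval[OF rectifiable, of N 0 0 0] by simp

lemma cum_diff:
  assumes "is_seminorm N" "s \<le> t"
  shows "cum N t - cum N s = var N \<gamma> (max 0 (min 1 s)) (max 0 (min 1 t))"
proof -
  have "max 0 (min 1 s) \<le> max 0 (min 1 t)" using assms(2) by (intro max.mono min.mono) auto
  then show ?thesis
    using var_add_interval[OF rectifiable assms(1), of 0 "max 0 (min 1 s)" "max 0 (min 1 t)"]
    by (simp add: cum_def)
qed

text \<open>Increments, and not only values, are monotone in the seminorm, since each is a variation
  over a subinterval. So the difference of two cumulative lengths is again monotone.\<close>

lemma cum_mono_diff: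
  assumes "is_seminorm M" "is_seminorm N" "\<And>x. N x \<le> M x" "s \<le> t"
  shows "cum N t - cum N s \<le> cum M t - cum M s"
  unfolding cum_diff[OF assms(1,4)] cum_diff[OF assms(2,4)]
  using assms by (intro var_mono rectifiable) auto

lemma cum_diff_nonneg: "is_seminorm N \<Longrightarrow> s \<le> t \<Longrightarrow> 0 \<le> cum N t - cum N s"
  unfolding cum_diff by (intro var_nonneg rectifiable) auto

lemma cum_add: "is_seminorm N \<Longrightarrow> is_seminorm M \<Longrightarrow> cum (\<lambda>x. N x + M x) t = cum N t + cum M t"
  unfolding cum_def by (intro var_add_seminorm rectifiable) auto

text \<open>Outside \<open>{0..1}\<close> the two sides agree because \<open>tau\<close> takes
  values in \<open>{0..<1}\<close>: there is no mass below \<open>0\<close> or from \<open>1\<close>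
  on.\<close>

lemma cum_inner: "cum (\<lambda>x. \<bar>u \<bullet> x\<bar>) = cdf (nu u)"
proof
  fix t :: real
  consider "t < 0" | "0 \<le> t \<and> t \<le> 1" | "1 < t" by linarith
  then show "cum (\<lambda>x. \<bar>u \<bullet> x\<bar>) t = cdf (nu u) t"
  proof cases
    case 1
    have none: "tau v s \<notin> {..t}" if "s \<in> width_int K v" for v s
      using tau(1)[OF that] 1 by auto
    have "{s\<in>width_int K u. tau u s \<in> {..t}} = {}" using none by blast
    moreover have "{s\<in>width_int K u. tau (- u) (- s) \<in> {..t}} = {}"
      using none[of "- _" "- u"] by (auto simp: width_int_uminus)
    ultimately have "emeasure (nu u) {..t} = 0" by (subst emeasure_nu) (simp_all only: emeasure_empty, auto)
    then show ?thesis using 1 by (simp add: cum_def var_zero_zero seminorm_inner cdf_def measure_def)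
  next
    case 2
    then show ?thesis by (simp add: cum_def var_inner cdf_def)
  next
    case 3
    have none: "tau v s \<notin> {1..}" if "s \<in> width_int K v" for v s
      using tau(1)[OF that] by auto
    have "{s\<in>width_int K u. tau u s \<in> {1..}} = {}" using none by blast
    moreover have "{s\<in>width_int K u. tau (- u) (- s) \<in> {1..}} = {}"
      using none[of "- _" "- u"] by (auto simp: width_int_uminus)
    ultimately have "emeasure (nu u) {1..} = 0" by (subst emeasure_nu) (simp_all only: emeasure_empty, auto)
    then have z: "measure (nu u) {1..} = 0" by (simp add: measure_def)
    have "measure (nu u) {..t} \<le> measure (nu u) ({..1} \<union> {1..})" by (intro nu.finite_measure_mono) auto
    also have "\<dots> \<le> measure (nu u) {..1} + measure (nu u) {1..}" by (intro measure_Un_le) auto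
    finally have "measure (nu u) {..t} \<le> measure (nu u) {..1}" using z by simp
    moreover have "measure (nu u) {..1} \<le> measure (nu u) {..t}" using 3 by (intro nu.finite_measure_mono) auto
    ultimately show ?thesis using 3 by (simp add: cum_def var_inner cdf_def)
  qed
qed

lemma right_continuous_cum_zonal: "continuous (at_right a) (cum (zonal us))"
proof (induction us)
  case Nil
  have "\<bar>cum (zonal []) t - cum (zonal []) s\<bar> \<le> 0 - 0" if "s \<le> t" for s t
  proof -
    have "psum (\<lambda>x. 0) \<gamma> ts = 0" for ts using psum_cmult[of 0 "\<lambda>x. 0" \<gamma> ts] by simp
    then have "var (zonal []) \<gamma> a b \<le> 0" for a b by (intro var_least) (simp add: zonal_Nil)
    then show ?thesis
      using cum_diff_nonneg[OF seminorm_zonal that, of "[]"] cum_diff[OF seminorm_zonal that, of "[]"] by simp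
  qed
  then show ?case by (rule continuous_at_right_dominated[where G="\<lambda>_. 0"]) auto
next
  case (Cons u us)
  have "cum (zonal (u # us)) = (\<lambda>t. cdf (nu u) t + cum (zonal us) t)"
    unfolding zonal_Cons by (simp add: fun_eq_iff cum_add seminorm_inner seminorm_zonal cum_inner)
  then show ?case using Cons by (simp add: continuous_add nu.cdf_is_right_cont)
qed

lemma unit_cdf_cum:
  assumes N: "is_seminorm N"
  shows "unit_cdf (cum N)"
  unfolding unit_cdf_def
proof (intro conjI allI impI)
  show "mono (cum N)" using cum_diff_nonneg[OF N] by (auto simp: mono_def)
  obtain us where us: "\<And>x. N x \<le> zonal us x" using seminorm_le_zonal[OF N] by blast
  have "\<bar>cum N t - cum N s\<bar> \<le> cum (zonal us) t - cum (zonal us) s" if "s \<le> t" for s t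
    using cum_mono_diff[OF seminorm_zonal N us that] cum_diff_nonneg[OF N that] by simp
  then show "continuous (at_right a) (cum N)" for a
    using right_continuous_cum_zonal by (rule continuous_at_right_dominated)
qed (auto simp: cum_def var_zero_zero N)

definition mass :: "(real^2 \<Rightarrow> real) \<Rightarrow> (real^2) set \<Rightarrow> real" where
  "mass N A = measure (interval_measure (cum N)) {t\<in>{0..1}. \<gamma> t \<in> A}"

lemma preimage_borel:
  assumes "A \<in> sets borel" shows "{t\<in>{0..1}. \<gamma> t \<in> A} \<in> sets borel"
proof -
  have "\<gamma> \<in> borel_measurable (restrict_space borel {0..1})"
    by (intro borel_measurable_continuous_on_restrict continuous)
  from measurable_sets[OF this assms] show ?thesis
    by (simp add: sets_restrict_space_iff space_restrict_space vimage_def Int_def conj_commute)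
qed

lemma mass_add:
  assumes "is_seminorm N" "is_seminorm M" "A \<in> sets borel"
  shows "mass (\<lambda>x. N x + M x) A = mass N A + mass M A"
proof -
  have "cum (\<lambda>x. N x + M x) = (\<lambda>t. cum N t + cum M t)" using assms by (simp add: cum_add fun_eq_iff)
  then show ?thesis
    unfolding mass_def using assms
    by (simp only:) (intro measure_interval_measure_add unit_cdf_cum preimage_borel)
qed

text \<open>The difference of the cumulative lengths is itself a distribution function, so the
  larger measure is the smaller one plus a measure.\<close>

lemma mass_mono:
  assumes "is_seminorm N" "is_seminorm M" "A \<in> sets borel" "\<And>x. N x \<le> M x"
  shows "mass N A \<le> mass M A"
proof -
  let ?D = "\<lambda>t. cum M t - cum N t"
  have "unit_cdf ?D"
    unfolding unit_cdf_def
  proof (intro conjI allI impI)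
    show "mono ?D" using cum_mono_diff[OF assms(2,1,4)] by (force intro!: monoI)
    show "continuous (at_right a) ?D" for a
      using unit_cdf_cum[OF assms(1)] unit_cdf_cum[OF assms(2)]
      unfolding unit_cdf_def by (intro continuous_diff) blast+
  qed (auto simp: cum_def var_zero_zero assms)
  from measure_interval_measure_add[OF unit_cdf_cum[OF assms(1)] this preimage_borel[OF assms(3)]]
  show ?thesis by (simp add: mass_def)
qed

lemma mass_inner:
  assumes A: "A \<in> sets borel"
  shows "mass (\<lambda>x. \<bar>u \<bullet> x\<bar>) A = boundary_mass K u A"
proof -
  let ?T = "{t\<in>{0..1}. \<gamma> t \<in> A}"
  have "interval_measure (cum (\<lambda>x. \<bar>u \<bullet> x\<bar>)) = nu u"
  proof (rule cdf_unique')
    show "finite_borel_measure (interval_measure (cum (\<lambda>x. \<bar>u \<bullet> x\<bar>)))"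
      by (intro unit_cdf_finite unit_cdf_cum seminorm_inner)
    show "finite_borel_measure (nu u)" by (rule nu.finite_borel_measure_axioms)
    show "cdf (interval_measure (cum (\<lambda>x. \<bar>u \<bullet> x\<bar>))) = cdf (nu u)"
      unfolding cdf_unit_cdf[OF unit_cdf_cum[OF seminorm_inner]] by (rule cum_inner)
  qed
  then have "mass (\<lambda>x. \<bar>u \<bullet> x\<bar>) A = measure (nu u) ?T" by (simp add: mass_def)
  moreover have T: "?T \<in> sets borel" by (rule preimage_borel[OF A])
  have iff: "tau v s \<in> ?T \<longleftrightarrow> top_pt K v s \<in> A" if "s \<in> width_int K v" for v s
    using tau(1,2)[OF that] by auto
  then have e1: "{s\<in>width_int K u. tau u s \<in> ?T} = {s\<in>width_int K u. top_pt K u s \<in> A}" by blast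
  have e2: "{s\<in>width_int K u. tau (- u) (- s) \<in> ?T} = {s\<in>width_int K u. top_pt K (- u) (- s) \<in> A}"
    using iff[of "- _" "- u"] by (auto simp: width_int_uminus)
  have "measure (nu u) ?T = boundary_mass K u A"
    unfolding boundary_mass_def measure_def emeasure_nu[OF T] e1 e2
    by (rule enn2real_plus) (use emeasure_width_int_finite in simp_all)
  ultimately show ?thesis by simp
qed

lemma mass_zonal: "A \<in> sets borel \<Longrightarrow> mass (zonal us) A = (\<Sum>u\<leftarrow>us. boundary_mass K u A)"
proof (induction us)
  case Nil
  have "cum (zonal []) = cum (\<lambda>x. \<bar>0 \<bullet> x\<bar>)" by (simp add: zonal_Nil)
  then have "mass (zonal []) A = boundary_mass K 0 A"
    using mass_inner[OF Nil, of 0] by (simp add: mass_def)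
  then show ?case by (simp add: boundary_mass_def width_int_zero)
next
  case (Cons u us)
  then show ?case
    by (simp add: zonal_Cons mass_add seminorm_inner seminorm_zonal mass_inner)
qed

lemma boundary_mass_le: "boundary_mass K u A \<le> 2 * wid K u"
proof -
  have "measure lborel {s\<in>width_int K u. P s} \<le> up K u - lo K u" for P
  proof (cases "{s\<in>width_int K u. P s} \<in> sets lborel")
    case True
    then have "measure lborel {s\<in>width_int K u. P s} \<le> measure lborel {lo K u..up K u}"
      by (intro measure_mono_fmeasurable) (auto simp: width_int_def fmeasurable_def lo_le_up)
    then show ?thesis using lo_le_up[of u] by simp
  next
    case False
    then show ?thesis using lo_le_up[of u] by (simp add: measure_notin_sets)
  qed
  from add_mono[OF this this] show ?thesis by (simp add: boundary_mass_def wid_eq)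
qed

text \<open>The zonal error seminorm \<open>?E\<close> is added on either side,
  \<open>N \<le> zonal us + ?E\<close> and \<open>zonal us \<le> N + ?E\<close>; its mass is
  controlled by widths, whatever the set \<open>A\<close>.\<close>

lemma mass_approx:
  assumes N: "is_seminorm N" and A: "A \<in> sets borel" and e: "0 \<le> e"
    and us: "\<And>x. \<bar>N x - zonal us x\<bar> \<le> e * (\<bar>x$1\<bar> + \<bar>x$2\<bar>)"
  shows "\<bar>mass N A - (\<Sum>u\<leftarrow>us. boundary_mass K u A)\<bar> \<le> e * (2 * wid K (axis 1 1) + 2 * wid K (axis 2 1))"
proof -
  let ?E = "zonal [e *\<^sub>R axis 1 1, e *\<^sub>R axis 2 1]"
  have E: "?E x = e * (\<bar>x$1\<bar> + \<bar>x$2\<bar>)" for x by (rule zonal_axes[OF e])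
  have up_scale: "up K (e *\<^sub>R u) - lo K (e *\<^sub>R u) \<le> e * (up K u - lo K u)" for u
  proof -
    obtain y where y: "y \<in> K" "(e *\<^sub>R u) \<bullet> y = lo K (e *\<^sub>R u)" using lo_attained .
    obtain z where z: "z \<in> K" "(e *\<^sub>R u) \<bullet> z = up K (e *\<^sub>R u)" using up_attained .
    have "up K (e *\<^sub>R u) - lo K (e *\<^sub>R u) = e * (u \<bullet> z - u \<bullet> y)"
      using y z by (simp add: algebra_simps)
    also have "\<dots> \<le> e * (up K u - lo K u)"
      using lo_le[OF y(1), of u] le_up[OF z(1), of u] e by (intro mult_left_mono) auto
    finally show ?thesis .
  qed
  have "mass ?E A \<le> e * (2 * wid K (axis 1 1) + 2 * wid K (axis 2 1))"
    using boundary_mass_le[of "e *\<^sub>R axis 1 1" A] boundary_mass_le[of "e *\<^sub>R axis 2 1" A]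
      up_scale[of "axis 1 1"] up_scale[of "axis 2 1"]
    by (simp add: mass_zonal A wid_eq algebra_simps)
  moreover have "mass N A \<le> mass (\<lambda>x. zonal us x + ?E x) A"
    using us by (intro mass_mono N A seminorm_add seminorm_zonal) (simp only: E, smt (verit))
  moreover have "mass (zonal us) A \<le> mass (\<lambda>x. N x + ?E x) A"
    using us by (intro mass_mono N A seminorm_add seminorm_zonal) (simp only: E, smt (verit))
  ultimately show ?thesis
    using A by (simp add: mass_add seminorm_zonal N mass_zonal)
qed

lemma measure_path_measure:
  assumes N: "is_seminorm (gauge_norm B)"
  shows "finite_measure (path_measure B \<gamma>)"
    "A \<in> sets borel \<Longrightarrow> measure (path_measure B \<gamma>) A = mass (gauge_norm B) A"
    "measure (path_measure B \<gamma>) UNIV = path_len B \<gamma> 0 1"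
proof -
  let ?F = "cum (gauge_norm B)"
  have F: "unit_cdf ?F" by (rule unit_cdf_cum[OF N])
  interpret I: finite_borel_measure "interval_measure ?F" by (rule unit_cdf_finite[OF F])
  have pm: "path_measure B \<gamma> = distr (restrict_space (interval_measure ?F) {0..1}) borel \<gamma>"
    by (simp add: path_measure_def cum_def[abs_def] path_len_var)
  have meas: "\<gamma> \<in> restrict_space (interval_measure ?F) {0..1} \<rightarrow>\<^sub>M borel"
  proof -
    have "\<gamma> \<in> borel_measurable (restrict_space borel {0..1})"
      by (intro borel_measurable_continuous_on_restrict continuous)
    moreover have "sets (restrict_space (interval_measure ?F) {0..1}) = sets (restrict_space borel {0..1})"
      by (rule sets_restrict_space_cong) simp
    ultimately show ?thesis using measurable_cong_sets by blast
  qed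
  interpret R: finite_measure "restrict_space (interval_measure ?F) {0..1}"
    by (intro finite_measure_restrict_space I.finite_measure_axioms) simp
  show "finite_measure (path_measure B \<gamma>)" unfolding pm by (rule R.finite_measure_distr[OF meas])
  show e: "measure (path_measure B \<gamma>) A = mass (gauge_norm B) A" if "A \<in> sets borel" for A
  proof -
    have eq: "\<gamma> -` A \<inter> space (restrict_space (interval_measure ?F) {0..1}) = {t\<in>{0..1}. \<gamma> t \<in> A}"
      by (auto simp: space_restrict_space)
    show ?thesis
      unfolding pm mass_def measure_distr[OF meas that] eq
      by (rule measure_restrict_space) auto
  qed
  \<comment> \<open>There is no mass at \<open>0\<close> and none outside the unit interval, so the
    restriction in \<open>path_measure\<close> loses nothing.\<close>
  have "measure (interval_measure ?F) {0<..1} = ?F 1 - ?F 0"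
  proof (rule measure_interval_measure_Ioc)
    show "?F x \<le> ?F y" if "x \<le> y" for x y using cum_diff_nonneg[OF N that] by simp
    show "continuous (at_right a) ?F" for a using F unfolding unit_cdf_def by blast
  qed simp
  moreover have "measure (interval_measure ?F) UNIV = ?F 1"
    using unit_cdf_limits(3)[OF F] emeasure_unit_cdf[OF F] by (simp add: measure_def)
  moreover have "measure (interval_measure ?F) {0<..1} \<le> measure (interval_measure ?F) {0..1}"
    "measure (interval_measure ?F) {0..1} \<le> measure (interval_measure ?F) UNIV"
    by (intro I.finite_measure_mono; auto)+
  ultimately have "measure (interval_measure ?F) {0..1} = ?F 1"
    using F by (simp add: cum_def var_zero_zero N)
  then show "measure (path_measure B \<gamma>) UNIV = path_len B \<gamma> 0 1"
    unfolding e[OF sets.top[of borel, unfolded space_borel]] mass_def path_len_var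
    by (simp add: cum_def atLeastAtMost_def atLeast_def atMost_def Int_def)
qed

end

section \<open>Gauges\<close>

text \<open>By symmetry a ball about \<open>z\<close> has its mirror image in \<open>B\<close>; the
  midpoints of \<open>z + y\<close> and \<open>- (z - y)\<close> fill a ball about the
  origin.\<close>

lemma S2_ball:
  assumes "B \<in> S2"
  obtains e where "0 < e" "ball 0 e \<subseteq> B"
proof -
  have B: "convex B" "uminus ` B = B" "interior B \<noteq> {}" using assms by (auto simp: S2_def)
  obtain z where "z \<in> interior B" using B(3) by auto
  then obtain e where e: "e > 0" "ball z e \<subseteq> B" by (auto simp: mem_interior)
  have "ball 0 e \<subseteq> B"
  proof
    fix y assume y: "y \<in> ball (0::real^2) e"
    have "z + y \<in> B" "z - y \<in> B" using y e by (auto simp: dist_norm)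
    then have "z + y \<in> B" "- (z - y) \<in> B" using B(2) by (auto simp del: minus_diff_eq)
    from convexD[OF B(1) this, of "1/2" "1/2"] show "y \<in> B"
      by (simp add: algebra_simps flip: scaleR_add_left)
  qed
  with e that show ?thesis by blast
qed

definition gauge_set :: "(real^2) set \<Rightarrow> real^2 \<Rightarrow> real set" where
  "gauge_set B x = {a. a > 0 \<and> (1 / a) *\<^sub>R x \<in> B}"

lemma gauge_norm_eq: "gauge_norm B x = Inf (gauge_set B x)"
proof -
  have "x \<in> (\<lambda>y. a *\<^sub>R y) ` B \<longleftrightarrow> (1 / a) *\<^sub>R x \<in> B" if "a > 0" for a
  proof
    show "(1 / a) *\<^sub>R x \<in> B" if "x \<in> (\<lambda>y. a *\<^sub>R y) ` B" using that \<open>a > 0\<close> by auto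
    show "x \<in> (\<lambda>y. a *\<^sub>R y) ` B" if "(1 / a) *\<^sub>R x \<in> B"
      using that \<open>a > 0\<close> by (intro image_eqI[of _ _ "(1 / a) *\<^sub>R x"]) auto
  qed
  then show ?thesis unfolding gauge_norm_def gauge_set_def by metis
qed

lemma gauge_set_bdd: "bdd_below (gauge_set B x)"
  by (intro bdd_belowI[of _ 0]) (auto simp: gauge_set_def)

lemma gauge_norm_le: "a \<in> gauge_set B x \<Longrightarrow> gauge_norm B x \<le> a"
  unfolding gauge_norm_eq by (rule cInf_lower[OF _ gauge_set_bdd])

lemma gauge_set_nonempty:
  assumes "B \<in> S2" shows "gauge_set B x \<noteq> {}"
proof -
  obtain e where e: "0 < e" "ball 0 e \<subseteq> B" using S2_ball[OF assms] .
  define a where "a = (norm x + 1) / e"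
  have "0 < norm x + 1" by (simp add: add_nonneg_pos)
  then have a: "0 < a" using e by (simp add: a_def)
  have "norm x < a * e" using e by (simp add: a_def)
  then have "(1 / a) *\<^sub>R x \<in> ball 0 e" using a by (simp add: field_simps)
  then have "a \<in> gauge_set B x" using a e by (auto simp: gauge_set_def)
  then show ?thesis by auto
qed

lemma gauge_norm_greatest:
  "B \<in> S2 \<Longrightarrow> (\<And>a. a \<in> gauge_set B x \<Longrightarrow> c \<le> a) \<Longrightarrow> c \<le> gauge_norm B x"
  unfolding gauge_norm_eq by (rule cInf_greatest[OF gauge_set_nonempty])

lemma gauge_norm_scale_le:
  assumes "B \<in> S2" "0 < c"
  shows "gauge_norm B (c *\<^sub>R x) \<le> c * gauge_norm B x"
proof -
  have "gauge_norm B (c *\<^sub>R x) / c \<le> gauge_norm B x"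
  proof (rule gauge_norm_greatest[OF assms(1)])
    fix a assume "a \<in> gauge_set B x"
    then have "c * a \<in> gauge_set B (c *\<^sub>R x)" using assms by (simp add: gauge_set_def)
    from gauge_norm_le[OF this] show "gauge_norm B (c *\<^sub>R x) / c \<le> a"
      using assms by (simp add: field_simps)
  qed
  then show ?thesis using assms by (simp add: field_simps)
qed

lemma seminorm_gauge_norm:
  assumes B: "B \<in> S2"
  shows "is_seminorm (gauge_norm B)"
  unfolding is_seminorm_def
proof (intro conjI allI)
  have conv: "convex B" using B by (simp add: S2_def)
  fix x y
  have "gauge_norm B (x + y) - gauge_norm B x \<le> gauge_norm B y"
  proof (rule gauge_norm_greatest[OF B])
    fix b assume b: "b \<in> gauge_set B y"
    have "gauge_norm B (x + y) - b \<le> gauge_norm B x"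
    proof (rule gauge_norm_greatest[OF B])
      fix a assume a: "a \<in> gauge_set B x"
      then have pos: "0 < a" "0 < b" using b by (auto simp: gauge_set_def)
      have "(a / (a + b)) *\<^sub>R ((1 / a) *\<^sub>R x) + (b / (a + b)) *\<^sub>R ((1 / b) *\<^sub>R y) \<in> B"
        using a b pos by (intro convexD[OF conv]) (auto simp: gauge_set_def add_divide_distrib[symmetric])
      then have "a + b \<in> gauge_set B (x + y)"
        using pos by (simp add: gauge_set_def scaleR_add_right)
      from gauge_norm_le[OF this] show "gauge_norm B (x + y) - b \<le> a" by simp
    qed
    then show "gauge_norm B (x + y) - gauge_norm B x \<le> b" by simp
  qed
  then show "gauge_norm B (x + y) \<le> gauge_norm B x + gauge_norm B y" by simp
next
  have sym: "uminus ` B = B" using B by (auto simp: S2_def)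
  fix c :: real and x :: "real^2"
  have pos: "gauge_norm B (c *\<^sub>R x) = c * gauge_norm B x" if c: "0 < c" for c x
  proof (rule antisym[OF gauge_norm_scale_le[OF B c]])
    show "c * gauge_norm B x \<le> gauge_norm B (c *\<^sub>R x)"
      using gauge_norm_scale_le[OF B, of "1 / c" "c *\<^sub>R x"] c by (simp add: field_simps)
  qed
  \<comment> \<open>Doubling the zero vector changes nothing, so positive homogeneity forces the
    value \<open>0\<close>.\<close>
  have "gauge_norm B (2 *\<^sub>R 0) = 2 * gauge_norm B 0" by (rule pos) simp
  then have zero: "gauge_norm B 0 = 0" by simp
  have "- x \<in> B \<longleftrightarrow> x \<in> B" for x using sym by (metis image_iff minus_minus)
  then have "gauge_set B (- x) = gauge_set B x" for x by (simp add: gauge_set_def)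
  then have neg: "gauge_norm B (- x) = gauge_norm B x" for x by (simp add: gauge_norm_eq)
  consider "c = 0" | "0 < c" | "0 < - c" by linarith
  then show "gauge_norm B (c *\<^sub>R x) = \<bar>c\<bar> * gauge_norm B x"
  proof cases
    case 3
    then show ?thesis using pos[OF 3, of x] neg[of "c *\<^sub>R x"] by simp
  qed (simp_all add: zero pos)
qed

section \<open>Widths\<close>

lemma measure_bounded_interval:
  fixes S :: "real set"
  assumes "is_interval S" "bounded S" "S \<noteq> {}"
  shows "measure lborel S = Sup S - Inf S" "S \<in> sets borel"
proof -
  have b: "bdd_above S" "bdd_below S"
    using assms by (auto intro: bounded_imp_bdd_above bounded_imp_bdd_below)
  have sub: "S \<subseteq> {Inf S..Sup S}" using b by (auto intro: cInf_lower cSup_upper)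
  have sup: "{Inf S<..<Sup S} \<subseteq> S"
  proof
    fix x assume x: "x \<in> {Inf S<..<Sup S}"
    obtain a where "a \<in> S" "a < x" using x cInf_lessD[OF assms(3)] by (metis greaterThanLessThan_iff)
    moreover obtain b where "b \<in> S" "x < b" using x less_cSupE[OF _ assms(3)] by (metis greaterThanLessThan_iff)
    ultimately show "x \<in> S" using mem_is_interval_1_I[OF assms(1), of a b x] by simp
  qed
  show S: "S \<in> sets borel" using assms(1) by (rule real_interval_borel_measurable)
  have le: "Inf S \<le> Sup S" using assms b by (intro cInf_le_cSup)
  have "measure lborel {Inf S<..<Sup S} \<le> measure lborel S"
    using S sub by (intro measure_mono_fmeasurable sup fmeasurableI2[OF _ sub]) (auto simp: fmeasurable_def le)
  moreover have "measure lborel S \<le> measure lborel {Inf S..Sup S}"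
    using S sub by (intro measure_mono_fmeasurable) (auto simp: fmeasurable_def le)
  ultimately show "measure lborel S = Sup S - Inf S" using le by simp
qed

text \<open>The Brunn-Minkowski inequality on the line. Only infima and suprema matter, and passing
  to closures covers intervals that are not known to be closed, such as level sets of chord
  lengths.\<close>

lemma measure_interval_combination:
  fixes R S T :: "real set"
  assumes "is_interval R" "bounded R" "is_interval S" "bounded S" "S \<noteq> {}"
    "is_interval T" "bounded T" "T \<noteq> {}"
    and ab: "0 \<le> a" "0 \<le> b" and sub: "\<And>s t. s \<in> S \<Longrightarrow> t \<in> T \<Longrightarrow> a * s + b * t \<in> R"
  shows "a * measure lborel S + b * measure lborel T \<le> measure lborel R"
proof -
  have R: "R \<noteq> {}" using assms by auto
  have bR: "bdd_above R" "bdd_below R"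
    using assms by (auto intro: bounded_imp_bdd_above bounded_imp_bdd_below)
  have "closed {p. a * fst p + b * snd p \<le> Sup R}" "closed {p. Inf R \<le> a * fst p + b * snd p}"
    by (intro closed_Collect_le continuous_intros)+
  moreover have "S \<times> T \<subseteq> {p. a * fst p + b * snd p \<le> Sup R}" "S \<times> T \<subseteq> {p. Inf R \<le> a * fst p + b * snd p}"
    using sub bR by (auto intro: cSup_upper cInf_lower)
  ultimately have cl: "closure S \<times> closure T \<subseteq> {p. a * fst p + b * snd p \<le> Sup R}"
    "closure S \<times> closure T \<subseteq> {p. Inf R \<le> a * fst p + b * snd p}"
    unfolding closure_Times[symmetric] by (auto dest: closure_minimal)
  have "Sup S \<in> closure S" "Inf S \<in> closure S" "Sup T \<in> closure T" "Inf T \<in> closure T"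
    using assms by (auto intro!: closure_contains_Sup closure_contains_Inf bounded_imp_bdd_above bounded_imp_bdd_below)
  then have "a * Sup S + b * Sup T \<le> Sup R" "Inf R \<le> a * Inf S + b * Inf T"
    using cl by auto
  then show ?thesis using assms R by (simp add: measure_bounded_interval algebra_simps)
qed

lemma proj_interval:
  assumes "L \<in> convex_compacts"
  shows "is_interval ((\<bullet>) u ` L)" "bounded ((\<bullet>) u ` L)" "compact ((\<bullet>) u ` L)"
proof -
  have L: "compact L" "convex L" using assms by (auto simp: convex_compacts_def)
  show "is_interval ((\<bullet>) u ` L)"
    using L by (simp add: is_interval_convex_1 convex_linear_image linear_iff inner_add_right)
  show "compact ((\<bullet>) u ` L)" using L by (intro compact_continuous_image continuous_intros)
  then show "bounded ((\<bullet>) u ` L)" by (rule compact_imp_bounded)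
qed

lemma wid_combination:
  assumes "L \<in> convex_compacts" "L1 \<in> convex_compacts" "L2 \<in> convex_compacts" "L1 \<noteq> {}" "L2 \<noteq> {}"
    "0 \<le> a" "0 \<le> b" "\<And>x y. x \<in> L1 \<Longrightarrow> y \<in> L2 \<Longrightarrow> a *\<^sub>R x + b *\<^sub>R y \<in> L"
  shows "a * wid L1 u + b * wid L2 u \<le> wid L u"
  unfolding wid_def using assms
proof (intro measure_interval_combination proj_interval)
  fix s t assume "s \<in> (\<bullet>) u ` L1" "t \<in> (\<bullet>) u ` L2"
  then obtain x y where "x \<in> L1" "s = u \<bullet> x" "y \<in> L2" "t = u \<bullet> y" by auto
  then have "a *\<^sub>R x + b *\<^sub>R y \<in> L" "a * s + b * t = u \<bullet> (a *\<^sub>R x + b *\<^sub>R y)"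
    using assms by (auto simp: inner_add_right)
  then show "a * s + b * t \<in> (\<bullet>) u ` L" by blast
qed auto

section \<open>Perimeters\<close>

lemma psum_on_line:
  assumes N: "\<And>c x. N (c *\<^sub>R x) = \<bar>c\<bar> * N x"
    and "\<And>t. t \<in> set ts \<Longrightarrow> \<exists>c. \<gamma> t = p + c *\<^sub>R d" "u \<bullet> d = 1"
  shows "psum N \<gamma> ts = N d * psum (\<lambda>x. \<bar>u \<bullet> x\<bar>) \<gamma> ts"
  using assms(2)
proof (induction ts rule: induct_list012)
  case (3 x y ts)
  obtain a b where "\<gamma> x = p + a *\<^sub>R d" "\<gamma> y = p + b *\<^sub>R d" using 3(3) by (metis list.set_intros)
  then have d: "\<gamma> y - \<gamma> x = (b - a) *\<^sub>R d" by (simp add: algebra_simps)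
  have "N (\<gamma> y - \<gamma> x) = \<bar>b - a\<bar> * N d" "\<bar>u \<bullet> (\<gamma> y - \<gamma> x)\<bar> = \<bar>b - a\<bar>"
    by (simp_all only: d N inner_scaleR_right assms(3) mult_1_right)
  then show ?case using 3 by (simp add: distrib_left mult.commute)
qed auto

text \<open>Every level of the coordinate along the segment is attained by at most one inner
  parameter, as the path is simple; the crossing count then bounds the variation without a proof
  that the path is monotone.\<close>

lemma psum_segment_le:
  assumes N: "\<And>c x. N (c *\<^sub>R x) = \<bar>c\<bar> * N x" "0 \<le> N (q - p)" and pq: "p \<noteq> q"
    and \<gamma>: "simple_path \<gamma>" "path_image \<gamma> = closed_segment p q"
    and ts: "sorted ts" "set ts \<subseteq> {0..1}"
  shows "psum N \<gamma> ts \<le> N (q - p)"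
proof -
  define d where "d = q - p"
  \<comment> \<open>Scaled so that \<open>u \<bullet> d = 1\<close>: the segment has width
    \<open>1\<close> in direction \<open>u\<close>.\<close>
  define u where "u = (1 / (d \<bullet> d)) *\<^sub>R d"
  have ud: "u \<bullet> d = 1" using pq by (simp add: u_def d_def)
  have ex: "\<exists>c\<in>{0..1}. \<gamma> t = p + c *\<^sub>R d" if "t \<in> {0..1}" for t
  proof -
    have "\<gamma> t \<in> closed_segment p q" using that \<gamma> by (auto simp: path_image_def)
    then show ?thesis by (auto simp: in_segment d_def algebra_simps)
  qed
  have coord: "\<gamma> t = p + (u \<bullet> \<gamma> t - u \<bullet> p) *\<^sub>R d" if "t \<in> {0..1}" for t
    using ex[OF that] ud by (auto simp: inner_add_right)
  have "ennreal (psum (\<lambda>x. \<bar>u \<bullet> x\<bar>) \<gamma> ts)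
    \<le> (\<integral>\<^sup>+s. 1 * indicator {u \<bullet> p<..<u \<bullet> p + 1} s \<partial>lborel)"
  proof (rule psum_inner_le_crossings[where f="\<lambda>t. u \<bullet> \<gamma> t", OF refl _ ts])
    show "continuous_on {0..1} (\<lambda>t. u \<bullet> \<gamma> t)"
      using \<gamma>(1) by (intro continuous_intros) (simp add: simple_path_def path_def)
    show "u \<bullet> p \<le> u \<bullet> \<gamma> t \<and> u \<bullet> \<gamma> t \<le> u \<bullet> p + 1" if "t \<in> {0..1}" for t
      using ex[OF that] ud by (auto simp: inner_add_right)
    fix s
    let ?T = "{t\<in>{0<..<1}. u \<bullet> \<gamma> t = s}"
    have eq: "x = y" if "x \<in> ?T" "y \<in> ?T" for x y
    proof -
      have xy: "x \<in> {0..1}" "y \<in> {0..1}" "u \<bullet> \<gamma> x = u \<bullet> \<gamma> y" using that by auto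
      have "\<gamma> x = \<gamma> y" using coord[OF xy(1)] coord[OF xy(2)] xy(3) by metis
      then have "x = y \<or> x = 0 \<and> y = 1 \<or> x = 1 \<and> y = 0"
        using \<gamma>(1) xy unfolding simple_path_def loop_free_def by blast
      then show ?thesis using that by auto
    qed
    have "\<exists>x. ?T \<subseteq> {x}" using eq by blast
    then obtain x where x: "?T \<subseteq> {x}" by blast
    then have "finite ?T" "card ?T \<le> 1"
      using finite_subset[OF x] card_mono[OF _ x] by auto
    then show "finite ?T \<and> of_nat (card ?T) \<le> (1::ennreal)"
      by (metis of_nat_1 of_nat_mono)
  qed
  also have "\<dots> = 1" by simp
  finally have "psum (\<lambda>x. \<bar>u \<bullet> x\<bar>) \<gamma> ts \<le> 1" by simp
  moreover have "psum N \<gamma> ts = N d * psum (\<lambda>x. \<bar>u \<bullet> x\<bar>) \<gamma> ts"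
    using ex ts by (intro psum_on_line N ud) blast
  ultimately show ?thesis using N(2) unfolding d_def[symmetric] by (simp add: mult_left_le)
qed

lemma parametrizes_param_of: "parametrizes \<gamma> C \<Longrightarrow> parametrizes (param_of C) C"
  unfolding param_of_def by (rule someI[of "\<lambda>\<gamma>. parametrizes \<gamma> C"])

lemma parametrizes_segment: "\<exists>\<gamma>. parametrizes \<gamma> (closed_segment p q)"
proof (cases "p = q")
  case True
  have "psum norm (linepath p p) ts = 0" for ts
    by (induction ts rule: induct_list012) (auto simp: linepath_def algebra_simps)
  then have "parametrizes (linepath p p) {p}"
    by (auto simp: parametrizes_def rectifiable_def inscribed_lengths_psum bdd_above_def)
  then show ?thesis using True by auto
next
  case False
  have "parametrizes (linepath p q) (closed_segment p q)"
    unfolding parametrizes_def rectifiable_def bdd_above_def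
  proof (intro conjI exI ballI)
    fix x assume "x \<in> inscribed_lengths norm (linepath p q) 0 1"
    then obtain ts where "x = psum norm (linepath p q) ts" "sorted ts" "set ts \<subseteq> {0..1}"
      by (auto simp: inscribed_lengths_psum)
    then show "x \<le> norm (q - p)"
      using psum_segment_le[of norm q p "linepath p q" ts] simple_path_linepath[OF False] False by simp
  qed (use False in auto)
  then show ?thesis by blast
qed

text \<open>The case \<open>p = q\<close>, where the parametrization is constant, is included;
  points and segments are then treated alike.\<close>

lemma len_segment:
  assumes N: "is_seminorm (gauge_norm B)"
  shows "len B (closed_segment p q) = gauge_norm B (q - p)"
proof -
  let ?N = "gauge_norm B" and ?\<gamma> = "param_of (closed_segment p q)"
  have par: "parametrizes ?\<gamma> (closed_segment p q)"
    using parametrizes_segment parametrizes_param_of by metis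
  then have im: "path_image ?\<gamma> = closed_segment p q" and rect: "rectifiable ?\<gamma>"
    by (auto simp: parametrizes_def)
  have "len B (closed_segment p q) = var ?N ?\<gamma> 0 1"
    by (simp add: len_def path_len_var)
  also have "\<dots> = ?N (q - p)"
  proof (rule antisym)
    show "var ?N ?\<gamma> 0 1 \<le> ?N (q - p)"
    proof (rule var_least)
      fix ts :: "real list" assume ts: "sorted ts" "set ts \<subseteq> {0..1}"
      show "psum ?N ?\<gamma> ts \<le> ?N (q - p)"
      proof (cases "p = q")
        case True
        then have "?\<gamma> t = p" if "t \<in> {0..1}" for t
        proof -
          have "?\<gamma> t \<in> path_image ?\<gamma>" using that by (simp add: path_image_def)
          moreover have "closed_segment p q = {p}" using True by simp
          ultimately show ?thesis using im by blast
        qed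
        note const = this
        from ts(2) const have "psum ?N ?\<gamma> ts = 0"
          by (induction ts rule: induct_list012) (auto simp: seminorm_zero[OF N])
        then show ?thesis by (simp add: seminorm_nonneg[OF N])
      next
        case False
        have "simple_path ?\<gamma>"
        proof -
          have "closed_segment p q \<noteq> {r}" for r
            using False by (metis ends_in_segment singletonD)
          then show ?thesis using par by (auto simp: parametrizes_def)
        qed
        then show ?thesis
          by (intro psum_segment_le False im ts seminorm_scale[OF N] seminorm_nonneg[OF N])
      qed
    qed
    have "p \<in> path_image ?\<gamma>" "q \<in> path_image ?\<gamma>" unfolding im by auto
    then obtain s t where st: "s \<in> {0..1}" "?\<gamma> s = p" "t \<in> {0..1}" "?\<gamma> t = q"
      unfolding path_image_def by (metis imageE)
    have "psum ?N ?\<gamma> [min s t, max s t] \<le> var ?N ?\<gamma> 0 1"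
      using st by (intro psum_le_var rect N) auto
    then show "?N (q - p) \<le> var ?N ?\<gamma> 0 1"
      using st seminorm_diff_swap[OF N, of p q] by (simp add: min_def max_def split: if_splits)
  qed
  finally show ?thesis .
qed

lemma wid_segment: "wid (closed_segment p q) u = \<bar>u \<bullet> (q - p)\<bar>"
proof -
  have "(\<bullet>) u ` closed_segment p q = closed_segment (u \<bullet> p) (u \<bullet> q)"
    by (rule closed_segment_linear_image[symmetric]) (simp add: linear_iff inner_add_right)
  then show ?thesis by (auto simp: wid_def closed_segment_eq_real_ivl inner_diff_right)
qed

text \<open>Without interior points the affine dimension is at most one, so the set is collinear.
  This matches the case distinctions in \<open>per\<close> and \<open>len\<close>.\<close>

lemma convex_compact_cases:
  assumes "L \<in> convex_compacts"
  obtains "L = {}" | "planar_body L" | p q where "interior L = {}" "L = closed_segment p q"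
proof -
  have L: "compact L" "convex L" using assms by (auto simp: convex_compacts_def)
  consider "L = {}" | "interior L \<noteq> {}" | "L \<noteq> {}" "interior L = {}" by auto
  then show ?thesis
  proof cases
    case 2
    then have "planar_body L" using assms by (simp add: planar_body_def planar_convex_body_def)
    then show ?thesis by (rule that)
  next
    case 3
    have "aff_dim L \<noteq> DIM(real^2)"
    proof
      assume "aff_dim L = DIM(real^2)"
      then have "rel_interior L = interior L" by (simp only: aff_dim_eq_full rel_interior_interior)
      then show False using 3 L by (simp add: rel_interior_eq_empty)
    qed
    then have "aff_dim L \<le> 1" using aff_dim_le_DIM[of L] by simp
    then have "collinear L" by (simp add: collinear_aff_dim)
    then obtain p q where "L = closed_segment p q"
      using compact_convex_collinear_segment 3 L by metis
    with 3 show ?thesis by (intro that(3)) auto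
  qed (use that in auto)
qed

lemma (in planar_body) boundary_path_param_of: "boundary_path K (param_of (frontier K))"
proof -
  obtain \<gamma> where \<gamma>: "simple_path \<gamma>" "path_image \<gamma> = frontier K" using frontier_simple_path .
  then interpret b: boundary_path K \<gamma> by unfold_locales
  have "parametrizes \<gamma> (frontier K)"
    using \<gamma> b.rectifiable by (simp add: parametrizes_def simple_path_def)
  then have "parametrizes (param_of (frontier K)) (frontier K)" by (rule parametrizes_param_of)
  then show ?thesis
    using frontier_not_singleton by unfold_locales (auto simp: parametrizes_def)
qed

context planar_body
begin

lemma curve_measure_frontier:
  assumes N: "is_seminorm (gauge_norm B)"
  shows "finite_measure (curve_measure B (frontier K))"
    "measure (curve_measure B (frontier K)) UNIV = per B K"
    "A \<in> sets borel \<Longrightarrow> 0 \<le> e \<Longrightarrow> (\<And>x. \<bar>gauge_norm B x - zonal us x\<bar> \<le> e * (\<bar>x$1\<bar> + \<bar>x$2\<bar>)) \<Longrightarrow>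
      \<bar>measure (curve_measure B (frontier K)) A - (\<Sum>u\<leftarrow>us. boundary_mass K u A)\<bar>
        \<le> e * (2 * wid K (axis 1 1) + 2 * wid K (axis 2 1))"
proof -
  interpret b: boundary_path K "param_of (frontier K)" by (rule boundary_path_param_of)
  show "finite_measure (curve_measure B (frontier K))"
    unfolding curve_measure_def by (rule b.measure_path_measure(1)[OF N])
  show "measure (curve_measure B (frontier K)) UNIV = per B K"
  proof -
    have "frontier K \<noteq> {}" using frontier_eq_empty nonempty bounded not_bounded_UNIV by metis
    then show ?thesis
      using interior unfolding curve_measure_def b.measure_path_measure(3)[OF N] per_def len_def by auto
  qed
  show "A \<in> sets borel \<Longrightarrow> 0 \<le> e \<Longrightarrow> (\<And>x. \<bar>gauge_norm B x - zonal us x\<bar> \<le> e * (\<bar>x$1\<bar> + \<bar>x$2\<bar>)) \<Longrightarrow>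
      \<bar>measure (curve_measure B (frontier K)) A - (\<Sum>u\<leftarrow>us. boundary_mass K u A)\<bar>
        \<le> e * (2 * wid K (axis 1 1) + 2 * wid K (axis 2 1))"
    unfolding curve_measure_def
    by (simp only: b.measure_path_measure(2)[OF N]) (rule b.mass_approx[OF N])
qed

lemma boundary_mass_UNIV: "boundary_mass K u UNIV = 2 * wid K u"
proof -
  have e: "{s\<in>width_int K u. f s \<in> UNIV} = {lo K u<..<up K u}" for f :: "real \<Rightarrow> real^2"
    by (auto simp: width_int_def)
  show ?thesis unfolding boundary_mass_def e wid_eq using lo_le_up[of u] by simp
qed

end

text \<open>The factor \<open>2\<close> in \<open>per\<close> for sets without interior makes one
  formula fit all cases: for \<open>\<bar>u \<bullet> _\<bar>\<close> a segment, like a body, has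
  perimeter twice its width. The value \<open>e = 0\<close> is allowed and settles vanishing
  gauges.\<close>

lemma per_approx:
  assumes N: "is_seminorm (gauge_norm B)" and L: "L \<in> convex_compacts" and e: "0 \<le> e"
    and us: "\<And>x. \<bar>gauge_norm B x - zonal us x\<bar> \<le> e * (\<bar>x$1\<bar> + \<bar>x$2\<bar>)"
  shows "\<bar>per B L - (\<Sum>u\<leftarrow>us. 2 * wid L u)\<bar> \<le> e * (2 * wid L (axis 1 1) + 2 * wid L (axis 2 1))"
  using L
proof (cases rule: convex_compact_cases)
  case 1
  have "(\<Sum>u\<leftarrow>us. 2 * wid L u) = 0" using 1 by (induction us) (auto simp: wid_def)
  with 1 show ?thesis by (simp add: per_def len_def wid_def)
next
  case 2
  then interpret planar_body L .
  show ?thesis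
    using curve_measure_frontier(3)[OF N sets.top[of borel, unfolded space_borel] e us]
    by (simp add: curve_measure_frontier(2)[OF N] boundary_mass_UNIV)
next
  case (3 p q)
  have "(\<Sum>u\<leftarrow>us. 2 * wid L u) = 2 * zonal us (q - p)"
    unfolding 3(2) wid_segment by (simp add: zonal_def sum_list_const_mult)
  moreover have "per B L = 2 * gauge_norm B (q - p)"
    using 3 len_segment[OF N] by (simp add: per_def)
  moreover have "2 * \<bar>gauge_norm B (q - p) - zonal us (q - p)\<bar> \<le> 2 * (e * (\<bar>q$1 - p$1\<bar> + \<bar>q$2 - p$2\<bar>))"
    using us[of "q - p"] by simp
  moreover have "\<bar>2 * a - 2 * b\<bar> = 2 * \<bar>a - b\<bar>" for a b :: real by (simp add: abs_if)
  ultimately show ?thesis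
    by (simp add: 3(2) wid_segment inner_axis' distrib_left)
qed

lemma le_if_le_eps:
  fixes x y C :: real
  assumes "\<And>e. 0 < e \<Longrightarrow> x \<le> y + e * C"
  shows "x \<le> y"
proof (rule field_le_epsilon)
  fix d :: real assume d: "0 < d"
  have "x \<le> y + d / (\<bar>C\<bar> + 1) * C" using d by (intro assms) (simp add: add_nonneg_pos)
  also have "\<dots> \<le> y + d / (\<bar>C\<bar> + 1) * (\<bar>C\<bar> + 1)" using d by (intro add_left_mono mult_left_mono) auto
  also have "\<dots> = y + d" by (simp add: add_nonneg_pos)
  finally show "x \<le> y + d" .
qed

text \<open>Widths are superadditive in every direction, hence so are zonal perimeters; the errors
  are \<open>e\<close> times a constant. The weights \<open>a = 1\<close> and \<open>b = 0\<close>
  give monotonicity of \<open>per\<close>.\<close>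

lemma per_combination:
  assumes N: "is_seminorm (gauge_norm B)"
    and L: "L \<in> convex_compacts" "L1 \<in> convex_compacts" "L2 \<in> convex_compacts" "L1 \<noteq> {}" "L2 \<noteq> {}"
    and ab: "0 \<le> a" "0 \<le> b" and sub: "\<And>x y. x \<in> L1 \<Longrightarrow> y \<in> L2 \<Longrightarrow> a *\<^sub>R x + b *\<^sub>R y \<in> L"
  shows "a * per B L1 + b * per B L2 \<le> per B L"
proof (rule le_if_le_eps)
  fix e :: real assume e: "0 < e"
  obtain us where us: "\<And>x. \<bar>gauge_norm B x - zonal us x\<bar> \<le> e * (\<bar>x$1\<bar> + \<bar>x$2\<bar>)"
    using zonal_approximation[OF N e] by blast
  let ?W = "\<lambda>L. \<Sum>u\<leftarrow>us. 2 * wid L u" and ?C = "\<lambda>L. 2 * wid L (axis 1 1) + 2 * wid L (axis 2 1)"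
  have approx: "\<bar>per B M - ?W M\<bar> \<le> e * ?C M" if "M \<in> convex_compacts" for M
    using e us by (intro per_approx N that) auto
  have "a * ?W L1 + b * ?W L2 \<le> ?W L"
  proof (induction us)
    case (Cons u us)
    then show ?case using wid_combination[OF L ab sub, of u] by (simp add: algebra_simps)
  qed simp
  moreover have "a * per B L1 \<le> a * (?W L1 + e * ?C L1)" "b * per B L2 \<le> b * (?W L2 + e * ?C L2)"
    using approx[OF L(2)] approx[OF L(3)] ab by (auto intro!: mult_left_mono)
  moreover have "?W L \<le> per B L + e * ?C L" using approx[OF L(1)] by linarith
  ultimately show "a * per B L1 + b * per B L2 \<le> per B L + e * (a * ?C L1 + b * ?C L2 + ?C L)"
    by (simp add: algebra_simps)
qed

section \<open>Boundary measure of an intersection of translates\<close>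

lemma emeasure_lborel_shift:
  assumes "S \<in> sets (borel :: real measure)"
  shows "emeasure lborel {s. s - c \<in> S} = emeasure lborel S" "{s. s - c \<in> S} \<in> sets borel"
proof -
  have "(\<lambda>s. s - c) -` S \<inter> space borel \<in> sets borel" by (rule measurable_sets[OF _ assms]) simp
  then show b: "{s. s - c \<in> S} \<in> sets borel" by (simp add: vimage_def)
  have "emeasure lborel S = (\<integral>\<^sup>+s. indicator S s \<partial>lborel)" using assms by simp
  also have "\<dots> = (\<integral>\<^sup>+s. indicator S (- c + 1 * s) \<partial>lborel)"
    using assms by (subst nn_integral_real_affine[where c=1 and t="- c"]) auto
  also have "\<dots> = (\<integral>\<^sup>+s. indicator {s. s - c \<in> S} s \<partial>lborel)"
    by (intro nn_integral_cong) (auto simp: indicator_def)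
  also have "\<dots> = emeasure lborel {s. s - c \<in> S}" using b by (intro nn_integral_indicator) simp
  finally show "emeasure lborel {s. s - c \<in> S} = emeasure lborel S" by simp
qed

lemma borel_translate:
  assumes "A \<in> sets borel" shows "(\<lambda>y. y - x) ` A \<in> sets (borel :: (real^2) measure)"
proof -
  have "(\<lambda>y. y - x) ` A = (\<lambda>z. z + x) -` A \<inter> space borel" by (force simp: image_iff)
  moreover have "(\<lambda>z. z + x) -` A \<inter> space borel \<in> sets borel" by (rule measurable_sets[OF _ assms]) simp
  ultimately show ?thesis by simp
qed

lemma borel_uminus_image:
  assumes "A \<in> sets borel" shows "uminus ` A \<in> sets (borel :: (real^2) measure)"
proof -
  have "uminus ` A = uminus -` A \<inter> space borel" by (force simp: image_iff)
  moreover have "uminus -` A \<inter> space borel \<in> sets (borel :: (real^2) measure)" by (rule measurable_sets[OF _ assms]) simp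
  ultimately show ?thesis by simp
qed

definition top_measure :: "(real^2) set \<Rightarrow> real^2 \<Rightarrow> (real^2) measure" where
  "top_measure K u = distr (restrict_space lborel (width_int K u)) borel (top_pt K u)"

lemma sets_top_measure [simp, measurable_cong]: "sets (top_measure K u) = sets borel"
  and space_top_measure [simp]: "space (top_measure K u) = UNIV"
  by (simp_all add: top_measure_def)

context planar_body
begin

lemma emeasure_top_measure:
  "A \<in> sets borel \<Longrightarrow> emeasure (top_measure K u) A = emeasure lborel {s\<in>width_int K u. top_pt K u s \<in> A}"
  "A \<in> sets borel \<Longrightarrow> {s\<in>width_int K u. top_pt K u s \<in> A} \<in> sets borel"
  unfolding top_measure_def by (auto intro!: emeasure_distr_restrict_lborel top_pt_measurable)

lemma emeasure_top_measure_uminus: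
  "A \<in> sets borel \<Longrightarrow> emeasure (top_measure K (- u)) A = emeasure lborel {s\<in>width_int K u. top_pt K (- u) (- s) \<in> A}"
  "A \<in> sets borel \<Longrightarrow> {s\<in>width_int K u. top_pt K (- u) (- s) \<in> A} \<in> sets borel"
  unfolding top_measure_def by (auto intro!: emeasure_distr_width_int_uminus top_pt_measurable)

lemma finite_top_measure: "finite_measure (top_measure K u)"
proof (rule finite_measureI)
  have "emeasure (top_measure K u) UNIV = emeasure lborel {s\<in>width_int K u. top_pt K u s \<in> UNIV}"
    by (rule emeasure_top_measure) simp
  then show "emeasure (top_measure K u) (space (top_measure K u)) \<noteq> \<infinity>"
    using emeasure_width_int_finite[of u "\<lambda>s. top_pt K u s \<in> UNIV"] by simp
qed

lemma boundary_mass_eq: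
  assumes "A \<in> sets borel"
  shows "boundary_mass K u A = measure (top_measure K u) A + measure (top_measure K (- u)) A"
  unfolding boundary_mass_def measure_def
  by (simp only: emeasure_top_measure(1)[OF assms, of u] emeasure_top_measure_uminus(1)[OF assms, of u])

lemma chord_iff:
  assumes u: "u \<noteq> 0" and s: "lo K u \<le> u \<bullet> y" "u \<bullet> y \<le> up K u"
  shows "y \<in> K \<longleftrightarrow> - hi K (- u) (- (u \<bullet> y)) \<le> perp u \<bullet> y \<and> perp u \<bullet> y \<le> hi K u (u \<bullet> y)"
proof
  show "y \<in> K \<Longrightarrow> - hi K (- u) (- (u \<bullet> y)) \<le> perp u \<bullet> y \<and> perp u \<bullet> y \<le> hi K u (u \<bullet> y)"
    using le_hi[of y u] le_hi[of y "- u"] by simp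
next
  assume y: "- hi K (- u) (- (u \<bullet> y)) \<le> perp u \<bullet> y \<and> perp u \<bullet> y \<le> hi K u (u \<bullet> y)"
  let ?s = "u \<bullet> y" and ?C = "K \<inter> {z. u \<bullet> z = u \<bullet> y}"
  have int: "is_interval ((\<bullet>) (perp u) ` ?C)"
    by (simp add: is_interval_convex_1 convex_linear_image convex_Int convex convex_hyperplane linear_iff inner_add_right)
  have "top_pt K u ?s \<in> ?C" using s u by (simp add: top_pt_in inner_top_pt)
  moreover have "top_pt K (- u) (- ?s) \<in> ?C"
    using top_pt_in[of "- u" "- ?s"] inner_top_pt[of "- u" K "- ?s"] s u by (simp add: lo_uminus up_uminus)
  moreover have "perp u \<bullet> top_pt K (- u) (- ?s) = - hi K (- u) (- ?s)"
    using perp_inner_top_pt[of "- u" K "- ?s"] u by (simp add: minus_equation_iff)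
  ultimately have "hi K u ?s \<in> (\<bullet>) (perp u) ` ?C" "- hi K (- u) (- ?s) \<in> (\<bullet>) (perp u) ` ?C"
    by (metis imageI perp_inner_top_pt[OF u])+
  then have "perp u \<bullet> y \<in> (\<bullet>) (perp u) ` ?C"
    using mem_is_interval_1_I[OF int] y by blast
  then obtain z where "z \<in> K" "u \<bullet> z = u \<bullet> y" "perp u \<bullet> z = perp u \<bullet> y" by auto
  then show "y \<in> K" using eq_if_coords_eq[OF u, of z y] by simp
qed

end

text \<open>Nested intervals contribute both ends of the inner one, overlapping intervals one end
  each, disjoint ones none. Distinct endpoints prevent a common end from being counted for
  both.\<close>

lemma interval_end_count:
  fixes h h' l l' :: real
  assumes "l < h" "l' < h'" "h \<noteq> h'" "h \<noteq> l'" "l \<noteq> l'" "l \<noteq> h'"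
  shows "of_bool (l' \<le> h \<and> h \<le> h') + of_bool (l' \<le> l \<and> l \<le> h') + of_bool (l \<le> h' \<and> h' \<le> h)
    + of_bool (l \<le> l' \<and> l' \<le> h) = (if max l l' \<le> min h h' then 2 else (0::nat))"
  using assms by (auto simp: max_def min_def)

lemma convex_compacts_Int: "K \<in> convex_compacts \<Longrightarrow> L \<in> convex_compacts \<Longrightarrow> K \<inter> L \<in> convex_compacts"
  by (auto simp: convex_compacts_def intro: compact_Int convex_Int)

text \<open>Almost every line in direction \<open>perp u\<close> meets the bodies in two segments without a common
  endpoint, and then the number of endpoints of either segment that lie in the other one is two
  or zero, according to whether the segments meet or not.\<close>

lemma boundary_mass_Int:
  assumes "planar_body K" "planar_body K'" and null: "boundary_mass K u (frontier K') = 0"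
  shows "boundary_mass K u K' + boundary_mass K' u K = 2 * wid (K \<inter> K') u"
proof (cases "u = 0")
  case True
  interpret K: planar_body K by fact
  interpret K': planar_body K' by fact
  have "lo K 0 = 0" "up K 0 = 0" "lo K' 0 = 0" "up K' 0 = 0"
    using K.nonempty K'.nonempty by (auto simp: lo_def up_def image_constant_conv)
  moreover have "wid (K \<inter> K') 0 = 0" by (simp add: wid_def image_constant_conv)
  ultimately show ?thesis using True by (simp add: boundary_mass_def width_int_def)
next
  case u: False
  interpret K: planar_body K by fact
  interpret K': planar_body K' by fact
  have mu: "- u \<noteq> 0" using u by simp
  let ?w = "width_int K u" and ?w' = "width_int K' u"
  let ?t = "top_pt K u" and ?b = "\<lambda>s. top_pt K (- u) (- s)"
  let ?t' = "top_pt K' u" and ?b' = "\<lambda>s. top_pt K' (- u) (- s)"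
  define T1 where "T1 = {s\<in>?w. ?t s \<in> K'}"
  define T2 where "T2 = {s\<in>?w. ?b s \<in> K'}"
  define T3 where "T3 = {s\<in>?w'. ?t' s \<in> K}"
  define T4 where "T4 = {s\<in>?w'. ?b' s \<in> K}"
  define P where "P = (\<bullet>) u ` (K \<inter> K')"
  note defs = T1_def T2_def T3_def T4_def
  have bK: "K \<in> sets borel" "K' \<in> sets borel" "frontier K' \<in> sets borel"
    using K.closed K'.closed by auto
  have meas: "T1 \<in> sets borel" "T2 \<in> sets borel" "T3 \<in> sets borel" "T4 \<in> sets borel"
    unfolding defs using bK
    by (auto intro!: K.emeasure_top_measure K.emeasure_top_measure_uminus
        K'.emeasure_top_measure K'.emeasure_top_measure_uminus)
  have fin: "emeasure lborel T1 < \<infinity>" "emeasure lborel T2 < \<infinity>" "emeasure lborel T3 < \<infinity>" "emeasure lborel T4 < \<infinity>"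
    unfolding defs by (rule K.emeasure_width_int_finite K'.emeasure_width_int_finite)+
  have Pc: "compact P"
    unfolding P_def by (intro compact_continuous_image compact_Int K.compact K'.compact continuous_intros)
  have P: "P \<in> sets borel" using Pc by (intro borel_closed compact_imp_closed)
  \<comment> \<open>Levels on which an end of the chord of \<open>K\<close> lies on the boundary of
    \<open>K'\<close>; by \<open>null\<close> they are negligible. On other levels the two chords
    have no common end.\<close>
  define N1 where "N1 = {s\<in>?w. ?t s \<in> frontier K'}"
  define N2 where "N2 = {s\<in>?w. ?b s \<in> frontier K'}"
  have "measure lborel N1 = 0" "measure lborel N2 = 0"
    using null measure_nonneg[of lborel N1] measure_nonneg[of lborel N2]
    unfolding boundary_mass_def N1_def[symmetric] N2_def[symmetric] by linarith+
  moreover have "N1 \<in> sets borel" "N2 \<in> sets borel"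
    unfolding N1_def N2_def using bK by (auto intro!: K.emeasure_top_measure K.emeasure_top_measure_uminus)
  moreover have "emeasure lborel N1 < \<infinity>" "emeasure lborel N2 < \<infinity>"
    unfolding N1_def N2_def by (rule K.emeasure_width_int_finite)+
  ultimately have "N1 \<in> null_sets lborel" "N2 \<in> null_sets lborel"
    by (auto simp: null_sets_def measure_def enn2real_eq_0_iff)
  have AE: "AE s in lborel. s \<notin> N1 \<and> s \<notin> N2 \<and> s \<notin> {lo K u, up K u, lo K' u, up K' u}"
  proof -
    have "AE s in lborel. s \<notin> {lo K u, up K u, lo K' u, up K' u}"
      by (rule AE_not_in, rule finite_imp_null_set_lborel) simp
    with AE_not_in[OF \<open>N1 \<in> null_sets lborel\<close>] AE_not_in[OF \<open>N2 \<in> null_sets lborel\<close>]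
    show ?thesis by eventually_elim simp
  qed
  have cnt: "of_bool (s \<in> T1) + of_bool (s \<in> T2) + of_bool (s \<in> T3) + of_bool (s \<in> T4)
      = (if s \<in> P then 2 else (0::nat))"
    if s: "s \<notin> N1" "s \<notin> N2" "s \<notin> {lo K u, up K u, lo K' u, up K' u}" for s
  proof (cases "s \<in> ?w \<and> s \<in> ?w'")
    case True
    let ?h = "hi K u s" and ?l = "- hi K (- u) (- s)" and ?h' = "hi K' u s" and ?l' = "- hi K' (- u) (- s)"
    have w: "lo K u < s" "s < up K u" "lo K' u < s" "s < up K' u" using True by (auto simp: width_int_def)
    have co: "u \<bullet> ?t s = s" "u \<bullet> ?b s = s" "u \<bullet> ?t' s = s" "u \<bullet> ?b' s = s"
      "perp u \<bullet> ?t s = ?h" "perp u \<bullet> ?b s = ?l" "perp u \<bullet> ?t' s = ?h'" "perp u \<bullet> ?b' s = ?l'"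
      using inner_top_pt[OF u] perp_inner_top_pt[OF u] inner_top_pt[OF mu, of _ "- s"]
        perp_inner_top_pt[OF mu, of _ "- s"]
      by (auto simp: minus_equation_iff)
    have mem': "y \<in> K' \<longleftrightarrow> ?l' \<le> perp u \<bullet> y \<and> perp u \<bullet> y \<le> ?h'" if "u \<bullet> y = s" for y
      using K'.chord_iff[OF u, of y] w that by auto
    have mem: "y \<in> K \<longleftrightarrow> ?l \<le> perp u \<bullet> y \<and> perp u \<bullet> y \<le> ?h" if "u \<bullet> y = s" for y
      using K.chord_iff[OF u, of y] w that by auto
    have lh: "?l < ?h" "?l' < ?h'" using K.hi_uminus_less[OF u] K'.hi_uminus_less[OF u] w by auto
    have fr: "?t' s \<in> frontier K'" "?b' s \<in> frontier K'" using K'.frontier_chord[OF u w(3,4)] by blast+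
    have nt: "?t s \<notin> frontier K'" "?b s \<notin> frontier K'"
      using s True by (auto simp: N1_def N2_def)
    have ne: "?h \<noteq> ?h'" "?h \<noteq> ?l'" "?l \<noteq> ?l'" "?l \<noteq> ?h'"
      using eq_if_coords_eq[OF u, of "?t s" "?t' s"] eq_if_coords_eq[OF u, of "?t s" "?b' s"]
        eq_if_coords_eq[OF u, of "?b s" "?b' s"] eq_if_coords_eq[OF u, of "?b s" "?t' s"]
        co fr nt by metis+
    have "s \<in> P \<longleftrightarrow> max ?l ?l' \<le> min ?h ?h'"
    proof
      assume "s \<in> P"
      then obtain y where "y \<in> K" "y \<in> K'" "u \<bullet> y = s" by (auto simp: P_def)
      then show "max ?l ?l' \<le> min ?h ?h'" using mem[of y] mem'[of y] by auto
    next
      assume le: "max ?l ?l' \<le> min ?h ?h'"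
      define y where "y = (if ?l' \<le> ?l then ?b s else ?b' s)"
      have "u \<bullet> y = s" "perp u \<bullet> y = max ?l ?l'" by (auto simp: y_def co)
      then have "y \<in> K" "y \<in> K'" using mem[of y] mem'[of y] le by auto
      then show "s \<in> P" using \<open>u \<bullet> y = s\<close> by (auto simp: P_def)
    qed
    moreover have "s \<in> T1 \<longleftrightarrow> ?l' \<le> ?h \<and> ?h \<le> ?h'" "s \<in> T2 \<longleftrightarrow> ?l' \<le> ?l \<and> ?l \<le> ?h'"
      "s \<in> T3 \<longleftrightarrow> ?l \<le> ?h' \<and> ?h' \<le> ?h" "s \<in> T4 \<longleftrightarrow> ?l \<le> ?l' \<and> ?l' \<le> ?h"
      unfolding defs using True mem'[of "?t s"] mem'[of "?b s"] mem[of "?t' s"] mem[of "?b' s"] co by auto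
    ultimately show ?thesis using interval_end_count[OF lh ne] by presburger
  next
    case False
    \<comment> \<open>As \<open>s\<close> is none of the four extreme levels, it lies outside the
      closed projection of one of the bodies, and all five sets omit it.\<close>
    have "s \<notin> P"
    proof
      assume "s \<in> P"
      then obtain y where "y \<in> K" "y \<in> K'" "u \<bullet> y = s" by (auto simp: P_def)
      then show False
        using False K.lo_le[of y u] K.le_up[of y u] K'.lo_le[of y u] K'.le_up[of y u] s(3)
        by (auto simp: width_int_def)
    qed
    moreover have "s \<notin> T1" "s \<notin> T2"
    proof -
      have "y \<notin> K'" if "u \<bullet> y = s" "s \<in> ?w" for y
        using False K'.lo_le[of y u] K'.le_up[of y u] s(3) that by (auto simp: width_int_def)
      moreover have "u \<bullet> ?t s = s" "u \<bullet> ?b s = s"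
        using inner_top_pt[OF u] inner_top_pt[OF mu, of K "- s"] by auto
      ultimately show "s \<notin> T1" "s \<notin> T2" by (auto simp: defs)
    qed
    moreover have "s \<notin> T3" "s \<notin> T4"
    proof -
      have "y \<notin> K" if "u \<bullet> y = s" "s \<in> ?w'" for y
        using False K.lo_le[of y u] K.le_up[of y u] s(3) that by (auto simp: width_int_def)
      moreover have "u \<bullet> ?t' s = s" "u \<bullet> ?b' s = s"
        using inner_top_pt[OF u] inner_top_pt[OF mu, of K' "- s"] by auto
      ultimately show "s \<notin> T3" "s \<notin> T4" by (auto simp: defs)
    qed
    ultimately show ?thesis by simp
  qed
  have ind: "(indicator T1 s + indicator T2 s + indicator T3 s + indicator T4 s :: ennreal) = 2 * indicator P s"
    if "of_bool (s \<in> T1) + of_bool (s \<in> T2) + of_bool (s \<in> T3) + of_bool (s \<in> T4)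
      = (if s \<in> P then 2 else (0::nat))" for s
    using arg_cong[OF that, of "of_nat :: nat \<Rightarrow> ennreal"]
    by (auto simp: indicator_def split: if_splits)
  have "emeasure lborel T1 + emeasure lborel T2 + emeasure lborel T3 + emeasure lborel T4
    = (\<integral>\<^sup>+s. indicator T1 s + indicator T2 s + indicator T3 s + indicator T4 s \<partial>lborel)"
    using meas by (simp add: nn_integral_add)
  also have "\<dots> = (\<integral>\<^sup>+s. 2 * indicator P s \<partial>lborel)"
    using AE by (intro nn_integral_cong_AE) (auto intro!: ind cnt)
  also have "\<dots> = 2 * emeasure lborel P" using P by (simp add: nn_integral_cmult)
  finally have "enn2real (emeasure lborel T1 + emeasure lborel T2 + emeasure lborel T3 + emeasure lborel T4)
    = enn2real (2 * emeasure lborel P)" by simp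
  then show ?thesis
    using fin unfolding boundary_mass_def wid_def defs[symmetric] P_def[symmetric] measure_def
    by (simp add: enn2real_plus enn2real_mult)
qed

section \<open>Translates of a body, and the intersection formula for almost every
  translation\<close>

lemma planar_body_translate:
  assumes "planar_body K" shows "planar_body ((\<lambda>y. y + x) ` K)"
proof -
  interpret planar_body K by fact
  have "(\<lambda>y. y + x) ` K = (+) x ` K" by (simp add: add.commute)
  moreover have "interior ((+) x ` K) \<noteq> {}" using interior by (simp add: interior_translation)
  ultimately show ?thesis
    using compact convex
    by (auto simp: planar_body_def planar_convex_body_def convex_compacts_def
        intro: compact_translation convex_translation)
qed

context planar_body
begin

lemma lo_translate: "lo ((\<lambda>y. y + x) ` K) u = lo K u + u \<bullet> x"
  and up_translate: "up ((\<lambda>y. y + x) ` K) u = up K u + u \<bullet> x"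
proof -
  interpret T: planar_body "(\<lambda>y. y + x) ` K" by (rule planar_body_translate) unfold_locales
  have "{lo ((\<lambda>y. y + x) ` K) u..up ((\<lambda>y. y + x) ` K) u} = (\<lambda>s. s + u \<bullet> x) ` {lo K u..up K u}"
    unfolding T.proj_eq[symmetric] proj_eq[symmetric] by (force simp: image_iff inner_add_right)
  also have "\<dots> = {lo K u + u \<bullet> x..up K u + u \<bullet> x}"
    by (force simp: image_iff intro: bexI[of _ "_ - u \<bullet> x"])
  finally show "lo ((\<lambda>y. y + x) ` K) u = lo K u + u \<bullet> x" "up ((\<lambda>y. y + x) ` K) u = up K u + u \<bullet> x"
    using lo_le_up[of u] T.lo_le_up[of u] by (auto simp: Icc_eq_Icc)
qed

lemma top_pt_translate:
  assumes "s \<in> width_int ((\<lambda>y. y + x) ` K) u" "u \<noteq> 0"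
  shows "top_pt ((\<lambda>y. y + x) ` K) u s = top_pt K u (s - u \<bullet> x) + x"
proof -
  interpret T: planar_body "(\<lambda>y. y + x) ` K" by (rule planar_body_translate) unfold_locales
  let ?t = "top_pt ((\<lambda>y. y + x) ` K) u s" and ?r = "top_pt K u (s - u \<bullet> x)"
  have s: "lo K u \<le> s - u \<bullet> x" "s - u \<bullet> x \<le> up K u"
    using assms by (auto simp: width_int_def lo_translate up_translate)
  have "?t \<in> (\<lambda>y. y + x) ` K" using assms by (intro T.top_pt_in) (auto simp: width_int_def)
  then obtain z where z: "z \<in> K" "?t = z + x" by auto
  then have uz: "u \<bullet> z = s - u \<bullet> x" using inner_top_pt[OF assms(2), of "(\<lambda>y. y + x) ` K" s] by (simp add: inner_add_right)
  have 1: "perp u \<bullet> z \<le> perp u \<bullet> ?r" using le_hi[OF z(1), of u] perp_inner_top_pt[OF assms(2), of K "s - u \<bullet> x"] uz by simp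
  have "?r + x \<in> (\<lambda>y. y + x) ` K" using top_pt_in[OF assms(2) s] by auto
  from T.le_hi[OF this, of u] have 2: "perp u \<bullet> (?r + x) \<le> perp u \<bullet> ?t"
    using inner_top_pt[OF assms(2)] perp_inner_top_pt[OF assms(2)] by (simp add: inner_add_right)
  show ?thesis
    using 1 2 z uz by (intro eq_if_coords_eq[OF assms(2)]) (auto simp: inner_top_pt assms inner_add_right)
qed

lemma top_measure_translate:
  assumes A: "A \<in> sets borel"
  shows "measure (top_measure ((\<lambda>y. y + x) ` K) u) A = measure (top_measure K u) ((\<lambda>y. y - x) ` A)"
proof -
  interpret T: planar_body "(\<lambda>y. y + x) ` K" by (rule planar_body_translate) unfold_locales
  have mem: "z \<in> (\<lambda>y. y - x) ` A \<longleftrightarrow> z + x \<in> A" for z by (force simp: image_iff)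
  have A': "(\<lambda>y. y - x) ` A \<in> sets borel" by (rule borel_translate[OF A])
  let ?S = "{s\<in>width_int K u. top_pt K u s \<in> (\<lambda>y. y - x) ` A}"
  have "{s\<in>width_int ((\<lambda>y. y + x) ` K) u. top_pt ((\<lambda>y. y + x) ` K) u s \<in> A} = {s. s - u \<bullet> x \<in> ?S}"
  proof -
    have w: "s \<in> width_int ((\<lambda>y. y + x) ` K) u \<longleftrightarrow> s - u \<bullet> x \<in> width_int K u" for s
      by (auto simp: width_int_def lo_translate up_translate)
    have u: "u \<noteq> 0" if "s \<in> width_int K u" for s
    proof
      assume "u = 0"
      moreover have "(\<bullet>) 0 ` K = {0}" using nonempty by auto
      ultimately show False using that by (simp add: width_int_def lo_def up_def)
    qed
    show ?thesis using top_pt_translate[OF _ u, of _ x] w mem by auto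
  qed
  then show ?thesis
    unfolding measure_def T.emeasure_top_measure(1)[OF A] emeasure_top_measure(1)[OF A']
    using emeasure_lborel_shift(1)[OF emeasure_top_measure(2)[OF A'], of "u \<bullet> x" u] by simp
qed

lemma boundary_mass_translate:
  assumes "A \<in> sets borel"
  shows "boundary_mass ((\<lambda>y. y + x) ` K) u A = boundary_mass K u ((\<lambda>y. y - x) ` A)"
proof -
  interpret T: planar_body "(\<lambda>y. y + x) ` K" by (rule planar_body_translate) unfold_locales
  show ?thesis
    by (simp add: T.boundary_mass_eq boundary_mass_eq assms borel_translate top_measure_translate)
qed

end

text \<open>Fubini: for fixed \<open>y\<close>, the set of \<open>x\<close> with
  \<open>y - x \<in> F\<close> is a reflected translate of \<open>F\<close>, hence null.\<close>

lemma AE_translate_null: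
  fixes F :: "(real^2) set"
  assumes M: "finite_measure M" "sets M = sets borel" and F: "F \<in> sets borel" "emeasure lborel F = 0"
  shows "AE x in lborel. measure M {y. y - x \<in> F} = 0"
proof -
  interpret M: finite_measure M by fact
  interpret P: pair_sigma_finite lborel M by unfold_locales
  have sp: "space M = UNIV" using sets_eq_imp_space_eq[OF M(2)] by simp
  note [measurable_cong] = M(2)
  note [measurable] = F(1)
  have m: "(\<lambda>(x, y). indicator F (y - x) :: ennreal) \<in> borel_measurable (lborel \<Otimes>\<^sub>M M)"
    by measurable
  have "(\<integral>\<^sup>+x. \<integral>\<^sup>+y. indicator F (y - x) \<partial>M \<partial>lborel) = (\<integral>\<^sup>+y. \<integral>\<^sup>+x. indicator F (y - x) \<partial>lborel \<partial>M)"
    using P.Fubini'[OF m] by simp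
  also have "\<dots> = (\<integral>\<^sup>+y. 0 \<partial>M)"
  proof (intro nn_integral_cong)
    fix y
    have "(\<integral>\<^sup>+x. indicator F (y - x) \<partial>lborel) = (\<integral>\<^sup>+x. indicator F (y + (-1) *\<^sub>R x) \<partial>lborel)" by simp
    also have "\<dots> = (\<integral>\<^sup>+x. indicator F x \<partial>distr lborel borel (\<lambda>x. y + (-1) *\<^sub>R x))"
      by (subst nn_integral_distr) auto
    also have "distr lborel borel (\<lambda>x. y + (-1) *\<^sub>R x) = lborel"
      using lborel_affine[of "-1" y] by (simp add: density_1)
    finally show "(\<integral>\<^sup>+x. indicator F (y - x) \<partial>lborel) = 0" using F by simp
  qed
  finally have "(\<integral>\<^sup>+x. \<integral>\<^sup>+y. indicator F (y - x) \<partial>M \<partial>lborel) = 0" by simp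
  moreover have "(\<lambda>x. \<integral>\<^sup>+y. indicator F (y - x) \<partial>M) \<in> borel_measurable lborel" by measurable
  ultimately have "AE x in lborel. (\<integral>\<^sup>+y. indicator F (y - x) \<partial>M) = 0"
    using nn_integral_0_iff_AE by blast
  then show ?thesis
  proof (rule AE_mp, intro AE_I2 impI)
    fix x assume z: "(\<integral>\<^sup>+y. indicator F (y - x) \<partial>M) = 0"
    have "{y. y - x \<in> F} = (\<lambda>y. y - x) -` F \<inter> space M" by (auto simp: sp)
    then have "{y. y - x \<in> F} \<in> sets M" by simp
    then have "emeasure M {y. y - x \<in> F} = (\<integral>\<^sup>+y. indicator {y. y - x \<in> F} y \<partial>M)" by simp
    also have "\<dots> = 0" using z by (simp add: indicator_def)
    finally show "measure M {y. y - x \<in> F} = 0" by (simp add: measure_def)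
  qed
qed

context planar_body
begin

lemma AE_boundary_mass_frontier_translate:
  "AE x in lborel. boundary_mass K u (frontier ((\<lambda>y. y + x) ` K)) = 0"
proof -
  have "negligible (frontier K)" by (rule negligible_convex_frontier[OF convex])
  then have F: "frontier K \<in> sets borel" "emeasure lborel (frontier K) = 0"
    by (simp_all add: negligible_iff_emeasure0 borel_closed)
  have eq: "frontier ((\<lambda>y. y + x) ` K) = {y. y - x \<in> frontier K}" for x
  proof -
    have "frontier ((\<lambda>y. y + x) ` K) = (+) x ` frontier K"
      using frontier_translation[of x K] by (simp add: add.commute)
    also have "\<dots> = {y. y - x \<in> frontier K}"
      by (auto intro: image_eqI[of _ _ "_ - x"])
    finally show ?thesis .
  qed
  have "AE x in lborel. measure (top_measure K u) {y. y - x \<in> frontier K} = 0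
    \<and> measure (top_measure K (- u)) {y. y - x \<in> frontier K} = 0"
    using AE_translate_null[OF finite_top_measure _ F] by simp
  then show ?thesis
    by (rule AE_mp) (auto simp: eq[symmetric] boundary_mass_eq borel_closed)
qed

text \<open>Approximations with errors \<open>1 / Suc n\<close> use countably many directions, whose
  exceptional null sets may be united; off their union \<open>boundary_mass_Int\<close> applies to
  all these directions at once.\<close>

lemma per_Int_translate_AE:
  assumes N: "is_seminorm (gauge_norm B)"
  shows "AE x in lborel. per B (K \<inter> (\<lambda>y. y + x) ` K)
    = measure (curve_measure B (frontier K)) ((\<lambda>y. y + x) ` K)
      + measure (curve_measure B (frontier K)) ((\<lambda>y. y - x) ` K)"
proof -
  have "\<exists>us. \<forall>x. \<bar>gauge_norm B x - zonal us x\<bar> \<le> 1 / real (Suc n) * (\<bar>x$1\<bar> + \<bar>x$2\<bar>)" for n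
    using zonal_approximation[OF N, of "1 / real (Suc n)"] by (metis of_nat_0_less_iff zero_less_Suc zero_less_divide_1_iff)
  then obtain us where us: "\<And>n x. \<bar>gauge_norm B x - zonal (us n) x\<bar> \<le> 1 / real (Suc n) * (\<bar>x$1\<bar> + \<bar>x$2\<bar>)"
    by metis
  have "AE x in lborel. \<forall>n. \<forall>u\<in>set (us n). boundary_mass K u (frontier ((\<lambda>y. y + x) ` K)) = 0"
    by (intro AE_all_countable[THEN iffD2] allI AE_finite_allI AE_boundary_mass_frontier_translate) simp
  then show ?thesis
  proof (rule AE_mp, intro AE_I2 impI)
    fix x assume null: "\<forall>n. \<forall>u\<in>set (us n). boundary_mass K u (frontier ((\<lambda>y. y + x) ` K)) = 0"
    let ?Kx = "(\<lambda>y. y + x) ` K" and ?Ky = "(\<lambda>y. y - x) ` K"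
    interpret T: planar_body ?Kx by (rule planar_body_translate) unfold_locales
    define C where "C = 2 * wid K (axis 1 1) + 2 * wid K (axis 2 1)"
    let ?m = "measure (curve_measure B (frontier K))"
    have cc: "K \<in> convex_compacts" "?Kx \<in> convex_compacts"
      using compact convex T.compact T.convex by (auto simp: convex_compacts_def)
    have bor: "K \<in> sets borel" "?Kx \<in> sets borel" "?Ky \<in> sets borel"
      using closed T.closed borel_translate by auto
    have wid_le: "wid (K \<inter> ?Kx) u \<le> wid K u" for u
      unfolding wid_def using proj_interval(3)[OF convex_compacts_Int[OF cc], of u] proj_interval(3)[OF cc(1), of u]
      by (intro measure_mono_fmeasurable)
        (auto simp: fmeasurable_def compact_imp_closed intro: emeasure_bounded_finite[simplified] compact_imp_bounded)
    have main: "\<bar>per B (K \<inter> ?Kx) - (?m ?Kx + ?m ?Ky)\<bar> \<le> 1 / real (Suc n) * (3 * C)" for n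
    proof -
      have eq: "(\<Sum>u\<leftarrow>us n. 2 * wid (K \<inter> ?Kx) u)
        = (\<Sum>u\<leftarrow>us n. boundary_mass K u ?Kx) + (\<Sum>u\<leftarrow>us n. boundary_mass K u ?Ky)"
      proof -
        \<comment> \<open>The mass that the boundary of \<open>K + x\<close> gives to
          \<open>K\<close> is the mass that the boundary of \<open>K\<close> gives to
          \<open>K - x\<close>.\<close>
        have "2 * wid (K \<inter> ?Kx) u = boundary_mass K u ?Kx + boundary_mass K u ?Ky" if "u \<in> set (us n)" for u
          using boundary_mass_Int[of K ?Kx u] null that boundary_mass_translate[OF bor(1), of x u]
            planar_body_axioms T.planar_body_axioms by auto
        then show ?thesis
          by (simp add: sum_list_addf[symmetric] cong: map_cong)
      qed
      have e0: "0 \<le> 1 / real (Suc n)" by simp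
      have "\<bar>per B (K \<inter> ?Kx) - (\<Sum>u\<leftarrow>us n. 2 * wid (K \<inter> ?Kx) u)\<bar>
        \<le> 1 / real (Suc n) * (2 * wid (K \<inter> ?Kx) (axis 1 1) + 2 * wid (K \<inter> ?Kx) (axis 2 1))"
        by (rule per_approx[OF N convex_compacts_Int[OF cc] e0 us])
      also have "\<dots> \<le> 1 / real (Suc n) * C"
        unfolding C_def by (intro mult_left_mono add_mono wid_le) auto
      finally have 1: "\<bar>per B (K \<inter> ?Kx) - (\<Sum>u\<leftarrow>us n. 2 * wid (K \<inter> ?Kx) u)\<bar> \<le> 1 / real (Suc n) * C" .
      have 2: "\<bar>?m ?Kx - (\<Sum>u\<leftarrow>us n. boundary_mass K u ?Kx)\<bar> \<le> 1 / real (Suc n) * C"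
        unfolding C_def by (rule curve_measure_frontier(3)[OF N bor(2) e0 us])
      have 3: "\<bar>?m ?Ky - (\<Sum>u\<leftarrow>us n. boundary_mass K u ?Ky)\<bar> \<le> 1 / real (Suc n) * C"
        unfolding C_def by (rule curve_measure_frontier(3)[OF N bor(3) e0 us])
      show ?thesis using 1 2 3 unfolding eq by linarith
    qed
    have "(\<lambda>n. 1 / real (Suc n) * (3 * C)) \<longlonglongrightarrow> 0 * (3 * C)"
      by (intro tendsto_mult_right LIMSEQ_Suc lim_1_over_n)
    then have "\<bar>per B (K \<inter> ?Kx) - (?m ?Kx + ?m ?Ky)\<bar> \<le> 0 * (3 * C)"
      by (rule LIMSEQ_le_const) (use main in blast)
    then show "per B (K \<inter> ?Kx) = ?m ?Kx + ?m ?Ky" by simp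
  qed
qed

end

section \<open>Reflected bodies\<close>

lemma planar_body_uminus:
  assumes "planar_body K" shows "planar_body (uminus ` K)"
proof -
  interpret planar_body K by fact
  have "interior (uminus ` K) = uminus ` interior K" by (rule interior_negations)
  then show ?thesis
    using compact convex interior
    by (auto simp: planar_body_def planar_convex_body_def convex_compacts_def
        intro: compact_negations convex_negations)
qed

context planar_body
begin

lemma frontier_uminus: "frontier (uminus ` K) = uminus ` frontier K"
proof -
  interpret U: planar_body "uminus ` K" by (rule planar_body_uminus) unfold_locales
  show ?thesis
    unfolding U.frontier_eq frontier_eq interior_negations by (rule image_set_diff[symmetric]) simp
qed

lemma boundary_mass_uminus:
  assumes A: "A \<in> sets borel"
  shows "boundary_mass (uminus ` K) u A = boundary_mass K u (uminus ` A)"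
proof -
  interpret U: planar_body "uminus ` K" by (rule planar_body_uminus) unfold_locales
  have mem: "z \<in> uminus ` A \<longleftrightarrow> - z \<in> A" for z by (force simp: image_iff)
  have A': "uminus ` A \<in> sets borel" by (rule borel_uminus_image[OF A])
  have "measure (top_measure (uminus ` K) u) A = measure (top_measure K (- u)) (uminus ` A)" for u
  proof -
    have "(\<bullet>) u ` uminus ` K = (\<bullet>) (- u) ` K" by (simp add: image_image)
    then have w: "width_int (uminus ` K) u = width_int K (- u)" by (simp add: width_int_def lo_def up_def)
    have "{perp u \<bullet> y |y. y \<in> uminus ` K \<and> u \<bullet> y = s} = {perp (- u) \<bullet> y |y. y \<in> K \<and> (- u) \<bullet> y = s}" for s
      by (force intro: exI[of _ "- _"])
    then have "hi (uminus ` K) u s = hi K (- u) s" for s by (simp only: hi_def)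
    then have "top_pt (uminus ` K) u s = - top_pt K (- u) s" for s by (simp add: top_pt_def algebra_simps)
    then show ?thesis
      unfolding measure_def U.emeasure_top_measure(1)[OF A] emeasure_top_measure(1)[OF A'] w by (simp add: mem)
  qed
  from this[of u] this[of "- u"] show ?thesis by (simp add: U.boundary_mass_eq boundary_mass_eq A A')
qed

text \<open>The path chosen for the reflected boundary need not be the reflection of the one chosen
  for the boundary, so both measures are compared with the same sums of
  \<open>boundary_mass\<close>.\<close>

lemma curve_measure_uminus:
  assumes N: "is_seminorm (gauge_norm B)" and A: "A \<in> sets borel"
  shows "measure (curve_measure B (uminus ` frontier K)) A = measure (curve_measure B (frontier K)) (uminus ` A)"
proof -
  interpret U: planar_body "uminus ` K" by (rule planar_body_uminus) unfold_locales
  have A': "uminus ` A \<in> sets borel" by (rule borel_uminus_image[OF A])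
  have wid: "wid (uminus ` K) u = wid K u" for u
    using boundary_mass_uminus[of UNIV u] by (simp add: boundary_mass_UNIV U.boundary_mass_UNIV)
  let ?x = "measure (curve_measure B (uminus ` frontier K)) A"
  let ?y = "measure (curve_measure B (frontier K)) (uminus ` A)"
  define C where "C = 2 * wid K (axis 1 1) + 2 * wid K (axis 2 1)"
  have "\<bar>?x - ?y\<bar> \<le> e * (2 * C)" if e: "0 < e" for e
  proof -
    obtain us where us: "\<And>x. \<bar>gauge_norm B x - zonal us x\<bar> \<le> e * (\<bar>x$1\<bar> + \<bar>x$2\<bar>)"
      using zonal_approximation[OF N e] by blast
    have "\<bar>?x - (\<Sum>u\<leftarrow>us. boundary_mass K u (uminus ` A))\<bar> \<le> e * C"
      using U.curve_measure_frontier(3)[OF N A less_imp_le[OF e] us]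
      by (simp add: frontier_uminus boundary_mass_uminus[OF A] wid C_def)
    moreover have "\<bar>?y - (\<Sum>u\<leftarrow>us. boundary_mass K u (uminus ` A))\<bar> \<le> e * C"
      using curve_measure_frontier(3)[OF N A' less_imp_le[OF e] us] by (simp add: C_def)
    ultimately show ?thesis by (simp add: algebra_simps)
  qed
  then have "\<bar>?x - ?y\<bar> \<le> 0" using le_if_le_eps[of "\<bar>?x - ?y\<bar>" 0 "2 * C"] by simp
  then show ?thesis by simp
qed

end

section \<open>The Brunn-Minkowski inequality for planar convex sets\<close>

definition vec2 :: "real \<times> real \<Rightarrow> real^2" where
  "vec2 p = fst p *\<^sub>R axis 1 1 + snd p *\<^sub>R axis 2 1"

lemma vec2_nth [simp]: "vec2 (s, r) $ 1 = s" "vec2 (s, r) $ 2 = r"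
  by (simp_all add: vec2_def axis_def)

lemma vec2_eq: "vec2 (x$1, x$2) = x"
  by (simp add: vec_eq_iff forall_2)

lemma vec2_combination: "a *\<^sub>R vec2 (s, r) + b *\<^sub>R vec2 (t, q) = vec2 (a * s + b * t, a * r + b * q)"
  by (simp add: vec_eq_iff forall_2)

lemma vec2_measurable [measurable]: "vec2 \<in> borel_measurable borel"
  unfolding vec2_def[abs_def] by (intro borel_measurable_continuous_onI continuous_intros)

text \<open>Identifies the plane with a product of lines, so that Fubini applies to slices parallel
  to the second axis.\<close>

lemma lborel_vec2: "lborel = distr (lborel \<Otimes>\<^sub>M lborel) borel vec2"
proof (rule lborel_eqI)
  fix l u :: "real^2" assume lu: "\<And>b. b \<in> Basis \<Longrightarrow> l \<bullet> b \<le> u \<bullet> b"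
  have le: "l$1 \<le> u$1" "l$2 \<le> u$2"
    using lu[of "axis 1 1"] lu[of "axis 2 1"] by (auto simp: inner_axis)
  have m: "vec2 \<in> (lborel \<Otimes>\<^sub>M lborel) \<rightarrow>\<^sub>M borel"
    unfolding lborel_prod by measurable
  have "vec2 -` box l u \<inter> space (lborel \<Otimes>\<^sub>M lborel) = {l$1<..<u$1} \<times> {l$2<..<u$2}"
    by (auto simp: mem_box_cart forall_2 space_pair_measure)
  then have "emeasure (distr (lborel \<Otimes>\<^sub>M lborel) borel vec2) (box l u)
    = emeasure lborel {l$1<..<u$1} * emeasure lborel {l$2<..<u$2}"
    by (subst emeasure_distr[OF m]) (simp_all add: lborel.emeasure_pair_measure_Times)
  also have "\<dots> = ennreal ((u$1 - l$1) * (u$2 - l$2))"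
    using le by (simp add: ennreal_mult)
  also have "(u$1 - l$1) * (u$2 - l$2) = (\<Prod>b\<in>Basis. (u - l) \<bullet> b)"
  proof -
    have B: "(Basis :: (real^2) set) = {axis 1 1, axis 2 1}"
      by (auto simp: Basis_vec_def UNIV_2)
    have "axis 1 (1::real) \<noteq> (axis 2 1 :: real^2)"
      by (simp add: axis_eq_axis)
    then show ?thesis unfolding B by (simp add: inner_axis)
  qed
  finally show "emeasure (distr (lborel \<Otimes>\<^sub>M lborel) borel vec2) (box l u) = (\<Prod>b\<in>Basis. (u - l) \<bullet> b)" .
qed simp

definition slice :: "(real^2) set \<Rightarrow> real \<Rightarrow> real set" where
  "slice L s = {r. vec2 (s, r) \<in> L}"

definition slice_len :: "(real^2) set \<Rightarrow> real \<Rightarrow> real" where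
  "slice_len L s = measure lborel (slice L s)"

definition slice_dom :: "(real^2) set \<Rightarrow> real set" where
  "slice_dom L = {s. slice L s \<noteq> {}}"

text \<open>Membership in \<open>slice_dom\<close> keeps the set bounded for
  \<open>c \<le> 0\<close>, where the inequality alone would admit every \<open>s\<close>.\<close>

definition level :: "(real^2) set \<Rightarrow> real \<Rightarrow> real set" where
  "level L c = {s \<in> slice_dom L. c \<le> slice_len L s}"

context
  fixes L :: "(real^2) set"
  assumes L: "L \<in> convex_compacts"
begin

lemma slice_interval: "is_interval (slice L s)" "bounded (slice L s)"
proof -
  have c: "compact L" "convex L" using L by (auto simp: convex_compacts_def)
  have "convex (slice L s)"
  proof (rule convexI)
    fix r q u v :: real assume *: "r \<in> slice L s" "q \<in> slice L s" "0 \<le> u" "0 \<le> v" "u + v = 1"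
    have "u *\<^sub>R vec2 (s, r) + v *\<^sub>R vec2 (s, q) \<in> L"
      using * c(2) by (intro convexD) (auto simp: slice_def)
    moreover have "u * s + v * s = s" using *(5) by (simp flip: distrib_right)
    ultimately show "u *\<^sub>R r + v *\<^sub>R q \<in> slice L s" by (simp add: slice_def vec2_combination)
  qed
  then show "is_interval (slice L s)" by (simp add: is_interval_convex_1)
  have "slice L s \<subseteq> (\<lambda>x. x$2) ` L" by (force simp: slice_def image_iff intro: bexI[of _ "vec2 (s, _)"])
  moreover have "compact ((\<lambda>x. x$2) ` L)" using c(1) by (intro compact_continuous_image continuous_intros)
  ultimately show "bounded (slice L s)" using compact_imp_bounded bounded_subset by blast
qed

lemma slice_dom_eq: "slice_dom L = (\<lambda>x. x$1) ` L"
proof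
  show "slice_dom L \<subseteq> (\<lambda>x. x$1) ` L"
    by (force simp: slice_dom_def slice_def image_iff intro: bexI[of _ "vec2 (_, _)"])
  show "(\<lambda>x. x$1) ` L \<subseteq> slice_dom L"
    using vec2_eq by (auto simp: slice_dom_def slice_def) (metis)
qed

lemma slice_dom_compact: "compact (slice_dom L)"
  unfolding slice_dom_eq using L
  by (intro compact_continuous_image continuous_intros) (simp add: convex_compacts_def)

lemma slice_borel: "slice L s \<in> sets borel"
  using slice_interval by (intro real_interval_borel_measurable)

lemma emeasure_slice: "emeasure lborel (slice L s) = ennreal (slice_len L s)"
  unfolding slice_len_def
  by (intro emeasure_eq_ennreal_measure) (use emeasure_bounded_finite[OF slice_interval(2)] in \<open>simp add: less_top\<close>)

lemma slice_len_nonneg: "0 \<le> slice_len L s"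
  by (simp add: slice_len_def)

lemma L_borel: "L \<in> sets borel"
  using L by (intro borel_closed compact_imp_closed) (simp add: convex_compacts_def)

lemma slice_len_measurable [measurable]: "slice_len L \<in> borel_measurable borel"
proof -
  have "vec2 -` L \<inter> space (lborel \<Otimes>\<^sub>M lborel) \<in> sets (lborel \<Otimes>\<^sub>M lborel)"
    by (rule measurable_sets[OF _ L_borel]) (unfold lborel_prod, measurable)
  then have "(\<lambda>s. emeasure lborel (Pair s -` (vec2 -` L \<inter> space (lborel \<Otimes>\<^sub>M lborel)))) \<in> borel_measurable lborel"
    by (rule lborel.measurable_emeasure_Pair)
  moreover have "Pair s -` (vec2 -` L \<inter> space (lborel \<Otimes>\<^sub>M lborel)) = slice L s" for s
    by (auto simp: slice_def space_pair_measure)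
  ultimately show ?thesis unfolding slice_len_def measure_def by simp
qed

lemma emeasure_slices: "emeasure lborel L = (\<integral>\<^sup>+s. ennreal (slice_len L s) \<partial>lborel)"
proof -
  have m: "vec2 \<in> (lborel \<Otimes>\<^sub>M lborel) \<rightarrow>\<^sub>M borel" unfolding lborel_prod by measurable
  have Q: "vec2 -` L \<inter> space (lborel \<Otimes>\<^sub>M lborel) \<in> sets (lborel \<Otimes>\<^sub>M lborel)"
    by (rule measurable_sets[OF m L_borel])
  have sl: "Pair s -` (vec2 -` L \<inter> space (lborel \<Otimes>\<^sub>M lborel)) = slice L s" for s
    by (auto simp: slice_def space_pair_measure)
  have "emeasure lborel L = emeasure (lborel \<Otimes>\<^sub>M lborel) (vec2 -` L \<inter> space (lborel \<Otimes>\<^sub>M lborel))"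
    by (subst lborel_vec2) (rule emeasure_distr[OF m L_borel])
  also have "\<dots> = (\<integral>\<^sup>+s. emeasure lborel (slice L s) \<partial>lborel)"
    by (subst lborel.emeasure_pair_measure_alt[OF Q]) (simp only: sl)
  finally show ?thesis by (simp add: emeasure_slice)
qed

lemma vol_eq: "vol L = enn2real (emeasure lborel L)" "emeasure lborel L < \<infinity>"
proof -
  show "vol L = enn2real (emeasure lborel L)"
    using L_borel by (simp add: vol_def measure_completion) (simp add: measure_def)
  show "emeasure lborel L < \<infinity>"
    using L by (intro emeasure_bounded_finite compact_imp_bounded) (simp add: convex_compacts_def)
qed

lemma level_borel: "level L c \<in> sets borel"
proof -
  have [measurable]: "slice_dom L \<in> sets borel" by (intro borel_closed compact_imp_closed slice_dom_compact)
  show ?thesis unfolding level_def by measurable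
qed

lemma level_bounded: "bounded (level L c)"
  by (rule bounded_subset[OF compact_imp_bounded[OF slice_dom_compact]]) (auto simp: level_def)

lemma slice_len_outside: "s \<notin> slice_dom L \<Longrightarrow> slice_len L s = 0"
  by (simp add: slice_dom_def slice_len_def)

text \<open>Layers are indexed by the fraction \<open>\<tau>\<close> of the height \<open>b\<close>
  rather than by the height itself: layers of different sets with equal \<open>\<tau>\<close> can
  then be combined, and \<open>b = 0\<close> causes no division.\<close>

definition level_integral :: "real \<Rightarrow> ennreal" where
  "level_integral b = (\<integral>\<^sup>+\<tau>. indicator {0..1} \<tau> * emeasure lborel (level L (\<tau> * b)) \<partial>lborel)"

text \<open>The layer cake formula for the chord length cut off at \<open>b\<close>, with heights
  \<open>\<tau> * b\<close>; the factor \<open>b\<close> is the Jacobian.\<close>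

lemma level_integral_eq:
  assumes b: "0 \<le> b"
  shows "ennreal b * level_integral b = (\<integral>\<^sup>+s. ennreal (min b (slice_len L s)) \<partial>lborel)"
    "level_integral b < \<infinity>"
proof -
  have [measurable]: "slice_dom L \<in> sets borel" by (intro borel_closed compact_imp_closed slice_dom_compact)
  define f :: "real \<times> real \<Rightarrow> ennreal" where
    "f = (\<lambda>(\<tau>, s). indicator {0..1} \<tau> * indicator {p. snd p \<in> slice_dom L \<and> fst p * b \<le> slice_len L (snd p)} (\<tau>, s))"
  have f: "f \<in> borel_measurable (lborel \<Otimes>\<^sub>M lborel)"
    unfolding f_def by measurable
  have lev: "indicator {p. snd p \<in> slice_dom L \<and> fst p * b \<le> slice_len L (snd p)} (\<tau>, s) = (indicator (level L (\<tau> * b)) s :: ennreal)" for \<tau> s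
    by (auto simp: indicator_def level_def)
  have e: "indicator {0..1} \<tau> * emeasure lborel (level L (\<tau> * b)) = (\<integral>\<^sup>+s. f (\<tau>, s) \<partial>lborel)" for \<tau>
    using level_borel by (simp add: f_def lev nn_integral_cmult)
  have "level_integral b = (\<integral>\<^sup>+s. \<integral>\<^sup>+\<tau>. f (\<tau>, s) \<partial>lborel \<partial>lborel)"
    unfolding level_integral_def e using lborel_pair.Fubini'[of "\<lambda>\<tau> s. f (\<tau>, s)"] f by simp
  then have "ennreal b * level_integral b = (\<integral>\<^sup>+s. ennreal b * (\<integral>\<^sup>+\<tau>. f (\<tau>, s) \<partial>lborel) \<partial>lborel)"
    using f by (subst nn_integral_cmult) (auto intro: lborel.borel_measurable_nn_integral simp: measurable_split_conv)
  also have "\<dots> = (\<integral>\<^sup>+s. ennreal (min b (slice_len L s)) \<partial>lborel)"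
  proof (intro nn_integral_cong)
    fix s
    show "ennreal b * (\<integral>\<^sup>+\<tau>. f (\<tau>, s) \<partial>lborel) = ennreal (min b (slice_len L s))"
    proof (cases "s \<in> slice_dom L \<and> 0 < b")
      case False
      then show ?thesis using b slice_len_outside[of s] slice_len_nonneg[of s] by (auto simp: f_def min_def)
    next
      case True
      let ?c = "min 1 (slice_len L s / b)"
      have "f (\<tau>, s) = indicator {0..?c} \<tau>" for \<tau>
        using True by (auto simp: f_def indicator_def field_simps)
      then have "(\<integral>\<^sup>+\<tau>. f (\<tau>, s) \<partial>lborel) = ennreal ?c"
        using slice_len_nonneg[of s] True by simp
      then have "ennreal b * (\<integral>\<^sup>+\<tau>. f (\<tau>, s) \<partial>lborel) = ennreal (b * ?c)"
        using b slice_len_nonneg[of s] True by (simp add: ennreal_mult)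
      also have "b * ?c = min b (slice_len L s)" using True by (simp add: min_def field_simps)
      finally show ?thesis .
    qed
  qed
  finally show "ennreal b * level_integral b = (\<integral>\<^sup>+s. ennreal (min b (slice_len L s)) \<partial>lborel)" .
  have "level_integral b \<le> (\<integral>\<^sup>+\<tau>. indicator {0..1::real} \<tau> * emeasure lborel (slice_dom L) \<partial>lborel)"
    unfolding level_integral_def
  proof (rule nn_integral_mono)
    fix \<tau> :: real
    have "emeasure lborel (level L (\<tau> * b)) \<le> emeasure lborel (slice_dom L)"
      by (rule emeasure_mono) (auto simp: level_def)
    then show "indicator {0..1} \<tau> * emeasure lborel (level L (\<tau> * b)) \<le> indicator {0..1} \<tau> * emeasure lborel (slice_dom L)"
      by (rule mult_left_mono) simp
  qed
  also have "\<dots> = emeasure lborel (slice_dom L)" by (simp add: nn_integral_multc)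
  also have "\<dots> < \<infinity>" by (intro emeasure_bounded_finite compact_imp_bounded slice_dom_compact)
  finally show "level_integral b < \<infinity>" .
qed

end

lemma slice_len_combination:
  assumes L: "L \<in> convex_compacts" "L1 \<in> convex_compacts" "L2 \<in> convex_compacts"
    and ab: "0 \<le> a" "0 \<le> b" and sub: "\<And>x y. x \<in> L1 \<Longrightarrow> y \<in> L2 \<Longrightarrow> a *\<^sub>R x + b *\<^sub>R y \<in> L"
    and st: "s \<in> slice_dom L1" "t \<in> slice_dom L2"
  shows "a * slice_len L1 s + b * slice_len L2 t \<le> slice_len L (a * s + b * t)"
    "a * s + b * t \<in> slice_dom L"
proof -
  have mem: "a * r + b * q \<in> slice L (a * s + b * t)" if "r \<in> slice L1 s" "q \<in> slice L2 t" for r q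
    using sub[of "vec2 (s, r)" "vec2 (t, q)"] that by (simp add: slice_def vec2_combination)
  then show "a * slice_len L1 s + b * slice_len L2 t \<le> slice_len L (a * s + b * t)"
    unfolding slice_len_def using st L ab
    by (intro measure_interval_combination slice_interval) (auto simp: slice_dom_def)
  show "a * s + b * t \<in> slice_dom L" using st mem by (auto simp: slice_dom_def)
qed

text \<open>Concavity of the chord length on a convex set: \<open>slice_len_combination\<close> with
  all three sets equal to \<open>L\<close>.\<close>

lemma level_interval:
  assumes L: "L \<in> convex_compacts"
  shows "is_interval (level L c)"
  unfolding is_interval_convex_1 convex_def
proof (intro ballI allI impI)
  fix s t u v :: real assume *: "s \<in> level L c" "t \<in> level L c" "0 \<le> u" "0 \<le> v" "u + v = 1"
  have cv: "u *\<^sub>R x + v *\<^sub>R y \<in> L" if "x \<in> L" "y \<in> L" for x y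
    using L * that by (auto simp: convex_compacts_def intro: convexD)
  have "c = u * c + v * c" using * by (simp flip: distrib_right)
  also have "\<dots> \<le> u * slice_len L s + v * slice_len L t"
    using * by (intro add_mono mult_left_mono) (auto simp: level_def)
  also have "\<dots> \<le> slice_len L (u * s + v * t)"
    using * by (intro slice_len_combination L cv) (auto simp: level_def)
  finally show "u *\<^sub>R s + v *\<^sub>R t \<in> level L c"
    using slice_len_combination(2)[OF L L L *(3,4) cv, of s t] * by (simp add: level_def)
qed

text \<open>Here \<open>p\<close> and \<open>q\<close> stand for suprema of chord lengths,
  \<open>p * x\<close> and \<open>q * y\<close> for areas. After squaring, the mixed term is bounded
  by the inequality of geometric and arithmetic means, paired as \<open>p * y\<close> and
  \<open>q * x\<close>, and the result factors into the two linear bounds.\<close>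

lemma brunn_minkowski_scalar:
  fixes a b p q x y z v :: real
  assumes "0 \<le> a" "0 \<le> b" "0 \<le> p" "0 \<le> q" "0 \<le> x" "0 \<le> y"
    "a * x + b * y \<le> z" "(a * p + b * q) * z \<le> v"
  shows "a * sqrt (p * x) + b * sqrt (q * y) \<le> sqrt v"
proof (rule real_le_rsqrt)
  have 1: "2 * (sqrt (p * x) * sqrt (q * y)) \<le> p * y + q * x"
  proof -
    have "sqrt (p * x) * sqrt (q * y) = sqrt (p * y) * sqrt (q * x)"
      by (simp add: real_sqrt_mult[symmetric] mult_ac)
    moreover have "0 \<le> (sqrt (p * y) - sqrt (q * x))\<^sup>2" by simp
    ultimately show ?thesis using assms by (simp add: power2_diff)
  qed
  have "(a * sqrt (p * x) + b * sqrt (q * y))\<^sup>2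
    = a * a * (p * x) + b * b * (q * y) + a * b * (2 * (sqrt (p * x) * sqrt (q * y)))"
    using assms by (simp add: power2_eq_square algebra_simps)
  also have "\<dots> \<le> a * a * (p * x) + b * b * (q * y) + a * b * (p * y + q * x)"
    using 1 assms by (intro add_left_mono mult_left_mono) auto
  also have "\<dots> = (a * p + b * q) * (a * x + b * y)" by (simp add: algebra_simps)
  also have "\<dots> \<le> (a * p + b * q) * z" using assms by (intro mult_left_mono) auto
  also have "\<dots> \<le> v" by (rule assms)
  finally show "(a * sqrt (p * x) + b * sqrt (q * y))\<^sup>2 \<le> v" .
qed

text \<open>Bonnesen's argument: if the chord lengths of \<open>L1\<close>, \<open>L2\<close> are measured in units of their maxima
  \<open>p\<close>, \<open>q\<close>, then the level sets of the chord lengths of \<open>L\<close>, measured in units of \<open>a p + b q\<close>, contain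
  the corresponding combinations of the level sets of \<open>L1\<close> and \<open>L2\<close>.\<close>

theorem brunn_minkowski:
  assumes L: "L \<in> convex_compacts" "L1 \<in> convex_compacts" "L2 \<in> convex_compacts" "L1 \<noteq> {}" "L2 \<noteq> {}"
    and ab: "0 \<le> a" "0 \<le> b" and sub: "\<And>x y. x \<in> L1 \<Longrightarrow> y \<in> L2 \<Longrightarrow> a *\<^sub>R x + b *\<^sub>R y \<in> L"
  shows "a * sqrt (vol L1) + b * sqrt (vol L2) \<le> sqrt (vol L)"
proof -
  \<comment> \<open>Attainment of the supremum \<open>p\<close> is avoided: the levels at a fraction
    \<open>\<tau> < 1\<close> of it are nonempty, and that is enough for almost all
    \<open>\<tau>\<close> in the unit interval.\<close>
  have sup: "\<exists>p\<ge>0. (\<forall>s. slice_len M s \<le> p) \<and> (\<forall>\<tau>. 0 < \<tau> \<and> \<tau> < 1 \<longrightarrow> level M (\<tau> * p) \<noteq> {})"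
    if M: "M \<in> convex_compacts" "M \<noteq> {}" for M
  proof -
    have D: "slice_dom M \<noteq> {}" using M by (simp add: slice_dom_eq)
    have "compact ((\<lambda>x. x$2) ` M)"
      using M by (intro compact_continuous_image continuous_intros) (simp add: convex_compacts_def)
    then have bd: "bounded ((\<lambda>x. x$2) ` M)" by (rule compact_imp_bounded)
    then obtain c d where cd: "(\<lambda>x. x$2) ` M \<subseteq> {c..d}"
      by (metis bounded_subset_cbox_symmetric cbox_interval)
    have "slice_len M s \<le> max 0 (d - c)" for s
    proof -
      have "slice M s \<subseteq> {c..d}" using cd by (force simp: slice_def)
      then have "slice_len M s \<le> measure lborel {c..d}"
        unfolding slice_len_def using slice_borel[OF M(1)]
        by (intro measure_mono_fmeasurable) (auto simp: fmeasurable_def emeasure_lborel_Icc_eq)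
      then show ?thesis by (auto simp: max_def split: if_splits)
    qed
    then have bdd: "bdd_above (slice_len M ` slice_dom M)" by (auto intro!: bdd_aboveI2)
    define p where "p = Sup (slice_len M ` slice_dom M)"
    have le: "slice_len M s \<le> p" if "s \<in> slice_dom M" for s
      unfolding p_def using bdd that by (intro cSup_upper) auto
    obtain s0 where s0: "s0 \<in> slice_dom M" using D by auto
    have p0: "0 \<le> p" using le[OF s0] slice_len_nonneg[OF M(1), of s0] by simp
    moreover have "slice_len M s \<le> p" for s
      using le slice_len_outside[OF M(1), of s] p0 by (cases "s \<in> slice_dom M") auto
    moreover have "level M (\<tau> * p) \<noteq> {}" if "0 < \<tau>" "\<tau> < 1" for \<tau>
    proof (cases "p = 0")
      case True
      then show ?thesis using s0 slice_len_nonneg[OF M(1), of s0] by (auto simp: level_def)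
    next
      case False
      then have "\<tau> * p < p" using p0 that by simp
      then obtain s where "s \<in> slice_dom M" "\<tau> * p < slice_len M s"
        using less_cSupE[of "\<tau> * p" "slice_len M ` slice_dom M"] D unfolding p_def by blast
      then show ?thesis by (auto simp: level_def less_imp_le)
    qed
    ultimately show ?thesis by blast
  qed
  obtain p where p: "0 \<le> p" "\<And>s. slice_len L1 s \<le> p" "\<And>\<tau>. 0 < \<tau> \<Longrightarrow> \<tau> < 1 \<Longrightarrow> level L1 (\<tau> * p) \<noteq> {}"
    using sup[OF L(2,4)] by blast
  obtain q where q: "0 \<le> q" "\<And>s. slice_len L2 s \<le> q" "\<And>\<tau>. 0 < \<tau> \<Longrightarrow> \<tau> < 1 \<Longrightarrow> level L2 (\<tau> * q) \<noteq> {}"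
    using sup[OF L(3,5)] by blast
  define r where "r = a * p + b * q"
  have r: "0 \<le> r" using p q ab by (simp add: r_def)
  define x where "x = enn2real (level_integral L1 p)"
  define y where "y = enn2real (level_integral L2 q)"
  define z where "z = enn2real (level_integral L r)"
  have J: "level_integral L1 p = ennreal x" "level_integral L2 q = ennreal y" "level_integral L r = ennreal z"
    unfolding x_def y_def z_def
    using level_integral_eq(2)[OF L(2) p(1)] level_integral_eq(2)[OF L(3) q(1)] level_integral_eq(2)[OF L(1) r]
    by (simp_all add: less_top)
  have nn: "0 \<le> x" "0 \<le> y" "0 \<le> z" by (simp_all add: x_def y_def z_def)
  have "ennreal p * ennreal x = emeasure lborel L1"
    using level_integral_eq(1)[OF L(2) p(1)] p(2) by (simp add: J emeasure_slices[OF L(2)] min_absorb2)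
  then have "emeasure lborel L1 = ennreal (p * x)" using p nn by (simp add: ennreal_mult)
  then have v1: "vol L1 = p * x" using p nn by (simp add: vol_eq[OF L(2)])
  have "ennreal q * ennreal y = emeasure lborel L2"
    using level_integral_eq(1)[OF L(3) q(1)] q(2) by (simp add: J emeasure_slices[OF L(3)] min_absorb2)
  then have "emeasure lborel L2 = ennreal (q * y)" using q nn by (simp add: ennreal_mult)
  then have v2: "vol L2 = q * y" using q nn by (simp add: vol_eq[OF L(3)])
  \<comment> \<open>The number \<open>r\<close> is not claimed to be the supremum for
    \<open>L\<close>: cutting its chords off at \<open>r\<close> only loses area, and a lower bound
    is wanted.\<close>
  have "ennreal r * ennreal z \<le> emeasure lborel L"
    using level_integral_eq(1)[OF L(1) r]
    by (simp add: J emeasure_slices[OF L(1)]) (intro nn_integral_mono ennreal_leI, simp)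
  also have "\<dots> = ennreal (vol L)" using vol_eq[OF L(1)] by (simp add: less_top)
  finally have v3: "r * z \<le> vol L"
    using r nn by (simp add: ennreal_mult[symmetric] vol_def)
  have "ennreal a * level_integral L1 p + ennreal b * level_integral L2 q \<le> level_integral L r"
  proof -
    have meas: "(\<lambda>\<tau>. indicator {0..1} \<tau> * emeasure lborel (level M (\<tau> * c))) \<in> borel_measurable lborel"
      if M: "M \<in> convex_compacts" for M c
    proof -
      have [measurable]: "slice_dom M \<in> sets borel" by (intro borel_closed compact_imp_closed slice_dom_compact M)
      note [measurable] = slice_len_measurable[OF M]
      have "{p \<in> space (lborel \<Otimes>\<^sub>M lborel). snd p \<in> slice_dom M \<and> fst p * c \<le> slice_len M (snd p)}
        \<in> sets (lborel \<Otimes>\<^sub>M lborel)" by measurable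
      from lborel.measurable_emeasure_Pair[OF this]
      have "(\<lambda>\<tau>. emeasure lborel (level M (\<tau> * c))) \<in> borel_measurable lborel"
        by (simp add: level_def vimage_def space_pair_measure)
      then show ?thesis by measurable
    qed
    have "ennreal a * level_integral L1 p + ennreal b * level_integral L2 q
      = (\<integral>\<^sup>+\<tau>. ennreal a * (indicator {0..1} \<tau> * emeasure lborel (level L1 (\<tau> * p)))
           + ennreal b * (indicator {0..1} \<tau> * emeasure lborel (level L2 (\<tau> * q))) \<partial>lborel)"
      unfolding level_integral_def[OF L(2)] level_integral_def[OF L(3)] using meas[OF L(2)] meas[OF L(3)]
      by (simp add: nn_integral_add nn_integral_cmult)
    also have "\<dots> \<le> (\<integral>\<^sup>+\<tau>. indicator {0..1} \<tau> * emeasure lborel (level L (\<tau> * r)) \<partial>lborel)"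
    proof (rule nn_integral_mono_AE)
      \<comment> \<open>Level sets of \<open>L1\<close> and \<open>L2\<close> are known to be
        nonempty only for \<open>0 < \<tau> < 1\<close>; an empty one would break the
        one-dimensional inequality.\<close>
      have "AE \<tau> in lborel. \<tau> \<notin> {0, 1::real}"
        by (rule AE_not_in, rule finite_imp_null_set_lborel) simp
      then show "AE \<tau> in lborel. ennreal a * (indicator {0..1} \<tau> * emeasure lborel (level L1 (\<tau> * p)))
           + ennreal b * (indicator {0..1} \<tau> * emeasure lborel (level L2 (\<tau> * q)))
         \<le> indicator {0..1} \<tau> * emeasure lborel (level L (\<tau> * r))"
      proof (rule AE_mp, intro AE_I2 impI)
        fix \<tau> :: real assume \<tau>: "\<tau> \<notin> {0, 1}"
        show "ennreal a * (indicator {0..1} \<tau> * emeasure lborel (level L1 (\<tau> * p)))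
           + ennreal b * (indicator {0..1} \<tau> * emeasure lborel (level L2 (\<tau> * q)))
         \<le> indicator {0..1} \<tau> * emeasure lborel (level L (\<tau> * r))"
        proof (cases "0 < \<tau> \<and> \<tau> < 1")
          case True
          have em: "emeasure lborel (level M c) = ennreal (measure lborel (level M c))" if "M \<in> convex_compacts" for M c
            using emeasure_bounded_finite[OF level_bounded[OF that]]
            by (intro emeasure_eq_ennreal_measure) (simp add: less_top)
          have "a * measure lborel (level L1 (\<tau> * p)) + b * measure lborel (level L2 (\<tau> * q))
            \<le> measure lborel (level L (\<tau> * r))"
          proof (intro measure_interval_combination level_interval level_bounded L ab p(3) q(3))
            fix s t assume st: "s \<in> level L1 (\<tau> * p)" "t \<in> level L2 (\<tau> * q)"
            then have d: "s \<in> slice_dom L1" "t \<in> slice_dom L2" by (auto simp: level_def)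
            have "\<tau> * r = a * (\<tau> * p) + b * (\<tau> * q)" by (simp add: r_def algebra_simps)
            also have "\<dots> \<le> a * slice_len L1 s + b * slice_len L2 t"
              using st ab by (intro add_mono mult_left_mono) (auto simp: level_def)
            also have "\<dots> \<le> slice_len L (a * s + b * t)"
              by (rule slice_len_combination[OF L(1-3) ab sub d])
            finally show "a * s + b * t \<in> level L (\<tau> * r)"
              using slice_len_combination(2)[OF L(1-3) ab sub d] by (simp add: level_def)
          qed (use True in auto)
          then show ?thesis
            using True ab by (simp add: em L ennreal_mult[symmetric] ennreal_plus[symmetric] del: ennreal_plus)
        next
          case False
          then have "indicator {0..1} \<tau> = (0::ennreal)" using \<tau> by (auto simp: indicator_def)
          then show ?thesis by simp
        qed
      qed
    qed
    finally show ?thesis by (simp add: level_integral_def[OF L(1)])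
  qed
  then have v4: "a * x + b * y \<le> z"
    using ab nn by (simp add: J ennreal_mult[symmetric] ennreal_plus[symmetric] del: ennreal_plus)
  show ?thesis
    unfolding v1 v2 using ab p(1) q(1) nn(1,2) v4 v3[unfolded r_def] by (rule brunn_minkowski_scalar)
qed

section \<open>Convolutions with characteristic functions\<close>

lemma sets_char_measure [simp, measurable_cong]: "sets (char_measure S) = sets borel"
  and space_char_measure [simp]: "space (char_measure S) = UNIV"
  by (simp_all add: char_measure_def)

lemma emeasure_char_measure:
  assumes "S \<in> sets borel" "A \<in> sets borel"
  shows "emeasure (char_measure S) A = emeasure lborel (S \<inter> A)"
  unfolding char_measure_def using assms
  by (subst emeasure_density) (auto simp: indicator_inter_arith[symmetric])

lemma finite_char_measure:
  assumes "S \<in> sets borel" "bounded S"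
  shows "finite_measure (char_measure S)"
proof (rule finite_measureI)
  have "emeasure lborel S < \<infinity>" using assms by (intro emeasure_bounded_finite)
  then show "emeasure (char_measure S) (space (char_measure S)) \<noteq> \<infinity>"
    using assms by (simp add: emeasure_char_measure)
qed

lemma nn_integral_lborel_minus:
  fixes f :: "real^2 \<Rightarrow> ennreal"
  assumes [measurable]: "f \<in> borel_measurable borel"
  shows "(\<integral>\<^sup>+x. f (x - y) \<partial>lborel) = (\<integral>\<^sup>+x. f x \<partial>lborel)"
proof -
  have "(\<integral>\<^sup>+x. f x \<partial>lborel) = (\<integral>\<^sup>+x. f x \<partial>distr lborel borel (\<lambda>x. - y + 1 *\<^sub>R x))"
    using lborel_affine[of 1 "- y"] by (simp add: density_1)
  also have "\<dots> = (\<integral>\<^sup>+x. f (x - y) \<partial>lborel)" by (subst nn_integral_distr) auto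
  finally show ?thesis by simp
qed

text \<open>Fubini and translation invariance: the density at \<open>x\<close> is the mass of the
  points \<open>y\<close> from which \<open>x\<close> is reached by adding an element of
  \<open>S\<close>.\<close>

lemma convolution_char_measure:
  assumes M: "finite_measure M" "sets M = sets borel" and S: "S \<in> sets borel" "bounded S"
  shows "M \<star> char_measure S = density lborel (\<lambda>x. emeasure M {y. x - y \<in> S})"
    "(\<lambda>x. emeasure M {y. x - y \<in> S}) \<in> borel_measurable borel"
proof -
  interpret M: finite_measure M by fact
  interpret P: pair_sigma_finite lborel M by unfold_locales
  have sp: "space M = UNIV" using sets_eq_imp_space_eq[OF M(2)] by simp
  note [measurable_cong] = M(2)
  note [measurable] = S(1)
  have em: "emeasure M {y. x - y \<in> S} = (\<integral>\<^sup>+y. indicator S (x - y) \<partial>M)" for x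
  proof -
    have "(\<lambda>y. x - y) -` S \<inter> space M \<in> sets M" by measurable
    then have "{y. x - y \<in> S} \<in> sets M" by (simp add: sp vimage_def)
    then have "emeasure M {y. x - y \<in> S} = (\<integral>\<^sup>+y. indicator {y. x - y \<in> S} y \<partial>M)" by simp
    then show ?thesis by (simp add: indicator_def)
  qed
  show meas: "(\<lambda>x. emeasure M {y. x - y \<in> S}) \<in> borel_measurable borel"
    unfolding em by measurable
  show "M \<star> char_measure S = density lborel (\<lambda>x. emeasure M {y. x - y \<in> S})"
  proof (rule measure_eqI)
    fix A assume "A \<in> sets (M \<star> char_measure S)"
    then have A[measurable]: "A \<in> sets borel" by simp
    have "emeasure (M \<star> char_measure S) A = (\<integral>\<^sup>+y. \<integral>\<^sup>+x. indicator A (y + x) \<partial>char_measure S \<partial>M)"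
      by (rule convolution_emeasure') (simp_all add: M finite_char_measure S)
    also have "\<dots> = (\<integral>\<^sup>+y. \<integral>\<^sup>+x. indicator S (x - y) * indicator A x \<partial>lborel \<partial>M)"
    proof (intro nn_integral_cong)
      fix y
      have "(\<integral>\<^sup>+x. indicator A (y + x) \<partial>char_measure S) = (\<integral>\<^sup>+x. indicator S x * indicator A (y + x) \<partial>lborel)"
        unfolding char_measure_def by (rule nn_integral_density) measurable
      also have "\<dots> = (\<integral>\<^sup>+x. indicator S (x - y) * indicator A (y + (x - y)) \<partial>lborel)"
        by (rule nn_integral_lborel_minus[symmetric]) measurable
      finally show "(\<integral>\<^sup>+x. indicator A (y + x) \<partial>char_measure S)
        = (\<integral>\<^sup>+x. indicator S (x - y) * indicator A x \<partial>lborel)" by simp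
    qed
    also have "\<dots> = (\<integral>\<^sup>+x. \<integral>\<^sup>+y. indicator S (x - y) * indicator A x \<partial>M \<partial>lborel)"
      by (rule P.Fubini'[where f="\<lambda>x y. indicator S (x - y) * indicator A x"]) measurable
    also have "\<dots> = (\<integral>\<^sup>+x. emeasure M {y. x - y \<in> S} * indicator A x \<partial>lborel)"
      unfolding em by (intro nn_integral_cong nn_integral_multc) measurable
    also have "\<dots> = emeasure (density lborel (\<lambda>x. emeasure M {y. x - y \<in> S})) A"
      using meas by (subst emeasure_density) auto
    finally show "emeasure (M \<star> char_measure S) A
      = emeasure (density lborel (\<lambda>x. emeasure M {y. x - y \<in> S})) A" .
  qed simp
qed

lemma emeasure_convolution_UNIV:
  assumes "finite_measure M" "finite_measure N" "sets M = sets borel" "sets N = sets borel"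
  shows "emeasure (M \<star> N) UNIV = emeasure M UNIV * emeasure N UNIV"
proof -
  have sp: "space M = UNIV" "space N = UNIV"
    using sets_eq_imp_space_eq[OF assms(3)] sets_eq_imp_space_eq[OF assms(4)] by auto
  show ?thesis
    using assms sp by (subst convolution_emeasure) (auto simp: mult.commute)
qed

text \<open>Commuting the sum to the right turns the convolution into an integral over
  \<open>M\<close>, where additivity is evident. Finiteness of \<open>c\<close> keeps the summed
  measure finite, as the convolution formula requires.\<close>

lemma emeasure_convolution_add:
  assumes fin: "finite_measure M" "finite_measure P" "finite_measure Q" and c: "c < \<infinity>"
    and s [measurable_cong]: "sets M = sets borel" "sets P = sets borel" "sets Q = sets borel"
    and A: "A \<in> sets borel"
  shows "emeasure (measure_add P (scale_measure c Q) \<star> M) A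
    = emeasure (M \<star> P) A + c * emeasure (M \<star> Q) A"
proof -
  interpret P: finite_measure P by fact
  interpret Q: finite_measure Q by fact
  let ?R = "measure_add P (scale_measure c Q)"
  have sp: "space M = UNIV" "space P = UNIV" "space Q = UNIV"
    using s[THEN sets_eq_imp_space_eq] by auto
  have R: "emeasure ?R E = emeasure P E + c * emeasure Q E" if "E \<in> sets borel" for E
    using that s by (subst emeasure_measure_add) auto
  have finR: "finite_measure ?R"
    using c by (intro finite_measureI) (auto simp: R sp ennreal_mult_eq_top_iff)
  note [measurable] = A
  have E: "{a. a + x \<in> A} \<in> sets borel" for x
  proof -
    have "(\<lambda>a. a + x) -` A \<inter> space borel \<in> sets borel" by measurable
    then show ?thesis by (simp add: vimage_def)
  qed
  have m: "(\<lambda>x. emeasure F {a. a + x \<in> A}) \<in> borel_measurable M"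
    if "finite_measure F" and [measurable_cong]: "sets F = sets borel" "space F = UNIV" for F
  proof -
    interpret F: finite_measure F by fact
    have "emeasure F {a. a + x \<in> A} = (\<integral>\<^sup>+a. indicator A (a + x) \<partial>F)" for x
    proof -
      have "emeasure F {a. a + x \<in> A} = (\<integral>\<^sup>+a. indicator {a. a + x \<in> A} a \<partial>F)" using E[of x] that(2) by simp
      then show ?thesis by (simp add: indicator_def)
    qed
    then show ?thesis by simp
  qed
  have "emeasure (?R \<star> M) A = emeasure (M \<star> ?R) A"
    using fin finR s by (subst convolution_commutative) auto
  also have "\<dots> = (\<integral>\<^sup>+x. emeasure ?R {a. a + x \<in> A} \<partial>M)"
    using fin finR s sp A by (intro convolution_emeasure) auto
  also have "\<dots> = (\<integral>\<^sup>+x. emeasure P {a. a + x \<in> A} + c * emeasure Q {a. a + x \<in> A} \<partial>M)"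
    by (simp add: R E)
  also have "\<dots> = (\<integral>\<^sup>+x. emeasure P {a. a + x \<in> A} \<partial>M) + c * (\<integral>\<^sup>+x. emeasure Q {a. a + x \<in> A} \<partial>M)"
    using m[OF fin(2)] m[OF fin(3)] s sp by (simp add: nn_integral_add nn_integral_cmult)
  also have "(\<integral>\<^sup>+x. emeasure P {a. a + x \<in> A} \<partial>M) = emeasure (M \<star> P) A"
    using fin s sp A by (intro convolution_emeasure[symmetric]) auto
  also have "(\<integral>\<^sup>+x. emeasure Q {a. a + x \<in> A} \<partial>M) = emeasure (M \<star> Q) A"
    using fin s sp A by (intro convolution_emeasure[symmetric]) auto
  finally show ?thesis .
qed

section \<open>Covariograms\<close>

lemma sets_curve_measure [simp, measurable_cong]: "sets (curve_measure B C) = sets borel"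
  and space_curve_measure [simp]: "space (curve_measure B C) = UNIV"
  by (simp_all add: curve_measure_def path_measure_def)

lemma translate_mem: "y \<in> (\<lambda>y. y + x) ` K \<longleftrightarrow> y - x \<in> (K :: (real^2) set)"
  by (force simp: image_iff)

context planar_body
begin

lemma body_borel: "K \<in> sets borel"
  by (intro borel_closed closed)

lemma body_compacts: "K \<in> convex_compacts"
  using compact convex by (simp add: convex_compacts_def)

lemma Int_translate_compacts: "K \<inter> (\<lambda>y. y + x) ` K \<in> convex_compacts"
proof -
  interpret T: planar_body "(\<lambda>y. y + x) ` K" by (rule planar_body_translate) unfold_locales
  show ?thesis by (intro convex_compacts_Int body_compacts T.body_compacts)
qed

lemma difference_body_iff: "x \<in> difference_body K \<longleftrightarrow> K \<inter> (\<lambda>y. y + x) ` K \<noteq> {}"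
proof -
  have "x \<in> difference_body K \<longleftrightarrow> (\<exists>y\<in>K. y - x \<in> K)"
  proof
    assume "x \<in> difference_body K"
    then obtain y z where "x = y - z" "y \<in> K" "z \<in> K" by (auto simp: difference_body_def)
    then show "\<exists>y\<in>K. y - x \<in> K" by (intro bexI[of _ y]) auto
  next
    assume "\<exists>y\<in>K. y - x \<in> K"
    then obtain y where "y \<in> K" "y - x \<in> K" by auto
    moreover have "x = y - (y - x)" by simp
    ultimately show "x \<in> difference_body K" unfolding difference_body_def by blast
  qed
  also have "\<dots> \<longleftrightarrow> (\<exists>y. y \<in> K \<inter> (\<lambda>y. y + x) ` K)" by (simp only: Int_iff translate_mem Bex_def)
  finally show ?thesis by blast
qed

text \<open>Since \<open>p - x\<close> and \<open>q - y\<close> lie in \<open>K\<close>, so does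
  \<open>a *\<^sub>R (p - x) + b *\<^sub>R (q - y)\<close>, which is the combination shifted
  back.\<close>

lemma Int_translate_combination:
  assumes "p \<in> K \<inter> (\<lambda>y. y + x) ` K" "q \<in> K \<inter> (\<lambda>z. z + y) ` K" "0 \<le> a" "0 \<le> b" "a + b = 1"
  shows "a *\<^sub>R p + b *\<^sub>R q \<in> K \<inter> (\<lambda>z. z + (a *\<^sub>R x + b *\<^sub>R y)) ` K"
proof -
  have "a *\<^sub>R p + b *\<^sub>R q - (a *\<^sub>R x + b *\<^sub>R y) = a *\<^sub>R (p - x) + b *\<^sub>R (q - y)"
    by (simp add: algebra_simps)
  then show ?thesis using assms by (auto simp: translate_mem intro!: convexD[OF convex])
qed

lemma difference_body_eq: "difference_body K = (\<lambda>(x, y). x - y) ` (K \<times> K)"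
  by (auto simp: difference_body_def)

lemma difference_body_compact: "compact (difference_body K)"
  unfolding difference_body_eq
  by (intro compact_continuous_image compact_Times compact) (auto simp: split_def intro!: continuous_intros)

lemma difference_body_convex: "convex (difference_body K)"
proof -
  have "difference_body K = (\<Union>x\<in>K. \<Union>y\<in>K. {x - y})" by (auto simp: difference_body_def)
  then show ?thesis using convex_differences[OF convex convex] by simp
qed

text \<open>The map from \<open>x\<close> to the intersection of \<open>K\<close> and
  \<open>K + x\<close> is concave for inclusion, so a functional that is superadditive under
  Minkowski combinations yields a concave function. An abstract \<open>F\<close> serves both
  \<open>per B\<close> and the root of the area.\<close>

lemma concave_covariogram:
  assumes F: "\<And>L L1 L2 a b. L \<in> convex_compacts \<Longrightarrow> L1 \<in> convex_compacts \<Longrightarrow> L2 \<in> convex_compacts \<Longrightarrow>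
    L1 \<noteq> {} \<Longrightarrow> L2 \<noteq> {} \<Longrightarrow> 0 \<le> a \<Longrightarrow> 0 \<le> b \<Longrightarrow> (\<And>x y. x \<in> L1 \<Longrightarrow> y \<in> L2 \<Longrightarrow> a *\<^sub>R x + b *\<^sub>R y \<in> L) \<Longrightarrow>
    a * F L1 + b * F L2 \<le> (F L :: real)"
  shows "concave_on (difference_body K) (covariogram F K)"
  unfolding concave_on_iff covariogram_def
proof (intro conjI ballI allI impI difference_body_convex)
  fix x y and a b :: real
  assume "x \<in> difference_body K" "y \<in> difference_body K" "0 \<le> a" "0 \<le> b" "a + b = 1"
  then show "a * F (K \<inter> (\<lambda>y. y + x) ` K) + b * F (K \<inter> (\<lambda>z. z + y) ` K)
    \<le> F (K \<inter> (\<lambda>z. z + (a *\<^sub>R x + b *\<^sub>R y)) ` K)"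
    by (intro F Int_translate_compacts Int_translate_combination) (auto simp: difference_body_iff)
qed

lemma vol_pos: "0 < vol K"
proof -
  obtain y where "y \<in> interior K" using interior by auto
  then obtain e where e: "e > 0" "cball y e \<subseteq> K" by (auto simp: mem_interior_cball)
  have "0 < measure lebesgue (cball y e)" using e content_cball_pos[of e y] by (simp add: measure_completion)
  also have "\<dots> \<le> vol K"
    unfolding vol_def using e compact
    by (intro measure_mono_fmeasurable) (auto intro: lmeasurable_compact)
  finally show ?thesis .
qed

text \<open>Comparison with a point of \<open>K\<close>, using the weights \<open>1\<close> and
  \<open>0\<close>.\<close>

lemma per_nonneg:
  assumes "is_seminorm (gauge_norm B)"
  shows "0 \<le> per B K"
proof -
  obtain y where y: "y \<in> K" using nonempty by auto
  have "{y} \<in> convex_compacts" by (simp add: convex_compacts_def)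
  have "1 * per B {y} + 0 * per B {y} \<le> per B K"
    using y by (intro per_combination assms body_compacts \<open>{y} \<in> convex_compacts\<close>) auto
  moreover have "per B {y} = 2 * gauge_norm B (y - y)"
    using len_segment[OF assms, of y y] by (simp add: per_def)
  ultimately show ?thesis using seminorm_nonneg[OF assms, of 0] by simp
qed

text \<open>A short segment inside \<open>K\<close> in the direction \<open>d\<close> already has
  positive perimeter. Such a \<open>d\<close> has to be assumed, as the gauge vanishes when
  \<open>B\<close> is the whole plane.\<close>

lemma per_pos:
  assumes N: "is_seminorm (gauge_norm B)" and d: "gauge_norm B d \<noteq> 0"
  shows "0 < per B K"
proof -
  obtain y where "y \<in> interior K" using interior by auto
  then obtain e where e: "e > 0" "cball y e \<subseteq> K" by (auto simp: mem_interior_cball)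
  have d0: "d \<noteq> 0" using d seminorm_zero[OF N] by auto
  define c where "c = e / norm d"
  have c: "0 < c" using e d0 by (simp add: c_def)
  define z where "z = y + c *\<^sub>R d"
  have "z \<in> K" "y \<in> K" using e d0 by (auto simp: z_def c_def dist_norm intro!: subsetD[OF e(2)])
  then have sub: "closed_segment y z \<subseteq> K" by (simp add: closed_segment_subset convex)
  have "closed_segment y z \<in> convex_compacts" by (simp add: convex_compacts_def)
  then have "1 * per B (closed_segment y z) + 0 * per B (closed_segment y z) \<le> per B K"
    using sub by (intro per_combination N body_compacts) auto
  moreover have "per B (closed_segment y z) = 2 * gauge_norm B (z - y)"
    using len_segment[OF N, of y z] interior_closed_segment_ge2[of y z] by (simp add: per_def)
  moreover have "gauge_norm B (z - y) = c * gauge_norm B d"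
    using c by (simp add: z_def seminorm_scale[OF N])
  moreover have "0 < gauge_norm B d" using d seminorm_nonneg[OF N, of d] by simp
  ultimately show ?thesis using c by (smt (verit) mult_pos_pos)
qed

end

text \<open>The empty zonal sum approximates the gauge with error \<open>0\<close>.\<close>

lemma per_zero:
  assumes N: "is_seminorm (gauge_norm B)" and "L \<in> convex_compacts" and "\<And>x. gauge_norm B x = 0"
  shows "per B L = 0"
  using per_approx[OF N assms(2), of 0 "[]"] assms(3) by (simp add: zonal_def)

theorem theorem3p1:
  fixes \<phi> :: "(real^2) set \<Rightarrow> real" and B K :: "(real^2) set" and \<alpha> :: real
  assumes "\<phi> \<in> Phi2" and "\<exists>L\<in>convex_compacts. \<phi> L \<noteq> 0"
    and "B \<in> S2" and "\<alpha> \<ge> 0"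
    and "\<forall>L\<in>convex_compacts. \<phi> L = per B L + \<alpha> * vol L"
    and "planar_convex_body K"
  shows
    "(ae_equals_measure (covariogram \<phi> K)
        (measure_add
          (measure_add
            (char_measure K \<star> curve_measure B (uminus ` frontier K))
            (curve_measure B (frontier K) \<star> char_measure (uminus ` K)))
          (scale_measure (ennreal \<alpha>) (char_measure K \<star> char_measure (uminus ` K))))
      \<and>
      measure_add
          (measure_add
            (char_measure K \<star> curve_measure B (uminus ` frontier K))
            (curve_measure B (frontier K) \<star> char_measure (uminus ` K)))
          (scale_measure (ennreal \<alpha>) (char_measure K \<star> char_measure (uminus ` K)))
      = measure_add
          (measure_add (curve_measure B (uminus ` frontier K))
             (scale_measure (ennreal (\<alpha> / 2)) (char_measure (uminus ` K))) \<star> char_measure K)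
          (measure_add (curve_measure B (frontier K))
             (scale_measure (ennreal (\<alpha> / 2)) (char_measure K)) \<star> char_measure (uminus ` K)))
    \<and> has_bochner_integral lebesgue (covariogram \<phi> K) (vol K * (2 * per B K + \<alpha> * vol K))
    \<and> closure {x. covariogram \<phi> K x \<noteq> 0} = difference_body K
    \<and> concave_on (difference_body K) (covariogram (per B) K)
    \<and> concave_on (difference_body K) (\<lambda>x. sqrt (covariogram vol K x))"
proof -
  interpret K: planar_body K using assms(6) by (simp add: planar_body_def)
  interpret U: planar_body "uminus ` K" by (rule planar_body_uminus) unfold_locales
  have N: "is_seminorm (gauge_norm B)" by (rule seminorm_gauge_norm[OF assms(3)])
  have \<phi>: "\<phi> L = per B L + \<alpha> * vol L" if "L \<in> convex_compacts" for L using assms(5) that by blast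
  have \<phi>0: "\<phi> {} = 0" using assms(1) by (simp add: Phi2_def valuation_def)
  let ?D = "curve_measure B (frontier K)" and ?D' = "curve_measure B (uminus ` frontier K)"
  let ?C = "char_measure K" and ?C' = "char_measure (uminus ` K)"
  have fin: "finite_measure ?D" "finite_measure ?D'" "finite_measure ?C" "finite_measure ?C'"
    using K.curve_measure_frontier(1)[OF N] U.curve_measure_frontier(1)[OF N]
    by (simp_all add: K.frontier_uminus finite_char_measure K.body_borel K.bounded U.body_borel U.bounded)
  interpret D: finite_measure ?D by fact
  interpret D': finite_measure ?D' by fact
  interpret C: finite_measure ?C by fact
  let ?\<mu> = "measure_add (measure_add (?C \<star> ?D') (?D \<star> ?C')) (scale_measure (ennreal \<alpha>) (?C \<star> ?C'))"
  have e\<mu>: "emeasure ?\<mu> A = emeasure (?C \<star> ?D') A + emeasure (?D \<star> ?C') A + ennreal \<alpha> * emeasure (?C \<star> ?C') A"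
    if "A \<in> sets borel" for A
    using that by (simp add: emeasure_measure_add)
  have comm: "(?C \<star> ?D') = (?D' \<star> ?C)" "(?C' \<star> ?D) = (?D \<star> ?C')" "(?C' \<star> ?C) = (?C \<star> ?C')"
    using fin by (auto intro!: convolution_commutative)
  have bd: "K \<in> sets borel" "uminus ` K \<in> sets borel" "bounded K" "bounded (uminus ` K)"
    by (rule K.body_borel U.body_borel K.bounded U.bounded)+
  define f1 where "f1 x = emeasure ?D' {y. x - y \<in> K}" for x
  define f2 where "f2 x = emeasure ?D {y. x - y \<in> uminus ` K}" for x
  define f3 where "f3 x = emeasure ?C {y. x - y \<in> uminus ` K}" for x
  have conv: "?C \<star> ?D' = density lborel f1" "?D \<star> ?C' = density lborel f2" "?C \<star> ?C' = density lborel f3"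
    unfolding comm(1) f1_def f2_def f3_def by (intro convolution_char_measure fin bd; simp)+
  have meas [measurable]: "f1 \<in> borel_measurable borel" "f2 \<in> borel_measurable borel" "f3 \<in> borel_measurable borel"
    unfolding f1_def f2_def f3_def by (intro convolution_char_measure fin bd; simp)+
  have sets_K: "(\<lambda>y. y + x) ` K = {y. x - y \<in> uminus ` K}" for x
  proof -
    have "x - y \<in> uminus ` K \<longleftrightarrow> y - x \<in> K" for y
    proof
      assume "x - y \<in> uminus ` K"
      then obtain z where "z \<in> K" "x - y = - z" by auto
      then show "y - x \<in> K" by (metis minus_diff_eq minus_minus)
    qed (auto intro: image_eqI[of _ _ "y - x"])
    then show ?thesis by (auto simp: translate_mem)
  qed
  have bx: "{y. x - y \<in> uminus ` K} \<in> sets borel" "{y. x - y \<in> K} \<in> sets borel" for x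
  proof -
    have "(\<lambda>y. x - y) -` S \<inter> space borel \<in> sets borel" if "S \<in> sets borel" for S :: "(real^2) set"
      by (rule measurable_sets[OF _ that]) simp
    then show "{y. x - y \<in> uminus ` K} \<in> sets borel" "{y. x - y \<in> K} \<in> sets borel"
      using bd by (simp_all add: vimage_def)
  qed
  have f1: "f1 x = ennreal (measure ?D ((\<lambda>y. y - x) ` K))" for x
  proof -
    \<comment> \<open>Reflecting the boundary measure turns \<open>x - K\<close> into
      \<open>K - x\<close>.\<close>
    have "uminus ` {y. x - y \<in> K} = (\<lambda>y. y - x) ` K"
      by (force simp: image_iff intro: bexI[of _ "x + _"] exI[of _ "x - _"])
    then show ?thesis
      unfolding f1_def D'.emeasure_eq_measure using K.curve_measure_uminus[OF N bx(2)] by simp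
  qed
  have f2: "f2 x = ennreal (measure ?D ((\<lambda>y. y + x) ` K))" for x
    unfolding f2_def D.emeasure_eq_measure sets_K ..
  have f3: "f3 x = ennreal (vol (K \<inter> (\<lambda>y. y + x) ` K))" for x
  proof -
    have "f3 x = emeasure lborel (K \<inter> (\<lambda>y. y + x) ` K)"
      unfolding f3_def sets_K using bd(1) bx(1) by (rule emeasure_char_measure)
    then show ?thesis
      using vol_eq[OF K.Int_translate_compacts, of x] by (simp add: less_top)
  qed
  have vol0: "0 \<le> vol L" for L by (simp add: vol_def)
  \<comment> \<open>The sum of the densities of the three convolutions: a Borel function defined for
    every \<open>x\<close>, with which the covariogram is known to agree only almost
    everywhere.\<close>
  define h where "h x = measure ?D ((\<lambda>y. y - x) ` K) + measure ?D ((\<lambda>y. y + x) ` K)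
    + \<alpha> * vol (K \<inter> (\<lambda>y. y + x) ` K)" for x
  have h0: "0 \<le> h x" for x using assms(4) vol0 by (simp add: h_def)
  have hf: "ennreal (h x) = f1 x + f2 x + ennreal \<alpha> * f3 x" for x
    unfolding h_def f1 f2 f3 using assms(4) vol0 by (simp add: ennreal_mult)
  have h_eq: "h = (\<lambda>x. enn2real (f1 x + f2 x + ennreal \<alpha> * f3 x))"
    using h0 by (simp add: hf[symmetric] fun_eq_iff)
  have h_meas [measurable]: "h \<in> borel_measurable borel" unfolding h_eq by measurable
  have \<mu>_density: "?\<mu> = density lborel (\<lambda>x. ennreal (h x))"
  proof (rule measure_eqI)
    fix A assume "A \<in> sets ?\<mu>"
    then have A [measurable]: "A \<in> sets borel" by simp
    show "emeasure ?\<mu> A = emeasure (density lborel (\<lambda>x. ennreal (h x))) A"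
      unfolding e\<mu>[OF A] unfolding conv
      by (simp add: emeasure_density hf distrib_right nn_integral_add nn_integral_cmult mult.assoc)
  qed simp
  have AE_eq: "AE x in lebesgue. covariogram \<phi> K x = h x"
  proof (rule AE_completion, rule AE_mp[OF K.per_Int_translate_AE[OF N]], intro AE_I2 impI)
    fix x assume "per B (K \<inter> (\<lambda>y. y + x) ` K)
      = measure ?D ((\<lambda>y. y + x) ` K) + measure ?D ((\<lambda>y. y - x) ` K)"
    then show "covariogram \<phi> K x = h x"
      by (simp add: covariogram_def \<phi> K.Int_translate_compacts h_def)
  qed
  have I1: "ae_equals_measure (covariogram \<phi> K) ?\<mu>"
    unfolding ae_equals_measure_def using h_meas h0 \<mu>_density AE_eq by blast
  have I2: "?\<mu> = measure_add
          (measure_add ?D' (scale_measure (ennreal (\<alpha> / 2)) ?C') \<star> ?C)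
          (measure_add ?D (scale_measure (ennreal (\<alpha> / 2)) ?C) \<star> ?C')" (is "_ = ?\<nu>")
  proof (rule measure_eqI)
    fix A assume "A \<in> sets ?\<mu>"
    then have A: "A \<in> sets borel" by simp
    \<comment> \<open>The two halves of the area term coincide because \<open>?C\<close> and
      \<open>?C'\<close> commute under convolution.\<close>
    have "emeasure ?\<nu> A = emeasure (?C \<star> ?D') A + ennreal (\<alpha> / 2) * emeasure (?C \<star> ?C') A
      + (emeasure (?C' \<star> ?D) A + ennreal (\<alpha> / 2) * emeasure (?C' \<star> ?C) A)"
      using A fin by (simp add: emeasure_measure_add emeasure_convolution_add)
    also have "\<dots> = emeasure (?C \<star> ?D') A + emeasure (?D \<star> ?C') A
      + (ennreal (\<alpha> / 2) + ennreal (\<alpha> / 2)) * emeasure (?C \<star> ?C') A"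
      by (simp add: comm distrib_left distrib_right ac_simps)
    also have "ennreal (\<alpha> / 2) + ennreal (\<alpha> / 2) = ennreal \<alpha>"
      using assms(4) by (simp add: ennreal_plus[symmetric] del: ennreal_plus)
    finally show "emeasure ?\<mu> A = emeasure ?\<nu> A" by (simp add: e\<mu>[OF A])
  qed simp
  have II: "has_bochner_integral lebesgue (covariogram \<phi> K) (vol K * (2 * per B K + \<alpha> * vol K))"
  proof -
    have per0: "0 \<le> per B K" by (rule K.per_nonneg[OF N])
    have "measure ?D' UNIV = per B K"
      using K.curve_measure_uminus[OF N, of UNIV] K.curve_measure_frontier(2)[OF N]
      by simp
    then have eD: "emeasure ?D UNIV = ennreal (per B K)" "emeasure ?D' UNIV = ennreal (per B K)"
      using K.curve_measure_frontier(2)[OF N] by (simp_all add: D.emeasure_eq_measure D'.emeasure_eq_measure)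
    have "emeasure lborel K = ennreal (vol K)"
      using vol_eq[OF K.body_compacts] by (simp add: less_top)
    moreover have "vol (uminus ` K) = vol K"
    proof -
      have eq: "distr lborel borel uminus = (lborel :: (real^2) measure)"
        using lborel_affine[of "-1" "0 :: real^2"] by (simp add: density_1)
      have "emeasure lborel (uminus ` K) = emeasure (distr lborel borel uminus) (uminus ` K)" by (simp only: eq)
      also have "\<dots> = emeasure lborel (uminus -` uminus ` K)" using bd by (subst emeasure_distr) auto
      also have "uminus -` uminus ` K = K" by (simp add: inj_vimage_image_eq)
      finally show ?thesis by (simp add: vol_eq[OF K.body_compacts] vol_eq[OF U.body_compacts])
    qed
    moreover have "emeasure lborel (uminus ` K) = ennreal (vol (uminus ` K))"
      using vol_eq[OF U.body_compacts] by (simp add: less_top)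
    ultimately have eC: "emeasure ?C UNIV = ennreal (vol K)" "emeasure ?C' UNIV = ennreal (vol K)"
      using bd by (simp_all add: emeasure_char_measure)
    \<comment> \<open>The total mass of a convolution is the product of the total masses:
      \<open>per B K * vol K\<close> twice, and \<open>\<alpha>\<close> times the square of
      \<open>vol K\<close>.\<close>
    have "(\<integral>\<^sup>+x. ennreal (h x) \<partial>lebesgue) = emeasure ?\<mu> UNIV"
      unfolding \<mu>_density by (simp add: nn_integral_completion emeasure_density)
    also have "\<dots> = ennreal (vol K * (2 * per B K + \<alpha> * vol K))"
      unfolding e\<mu>[OF sets.top[of borel, unfolded space_borel]]
      using fin per0 vol0 assms(4)
      by (simp add: emeasure_convolution_UNIV eC eD ennreal_mult[symmetric] ennreal_plus[symmetric] algebra_simps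
          del: ennreal_plus)
    finally have "(\<integral>\<^sup>+x. ennreal (h x) \<partial>lebesgue) = ennreal (vol K * (2 * per B K + \<alpha> * vol K))" .
    then have "has_bochner_integral lebesgue h (vol K * (2 * per B K + \<alpha> * vol K))"
      using h0 per0 vol0[of K] assms(4) by (intro has_bochner_integral_nn_integral) (auto intro: measurable_completion)
    moreover have hl: "h \<in> borel_measurable lebesgue" using h_meas by (simp add: measurable_completion)
    \<comment> \<open>Measurability of the covariogram is not known beforehand; completeness of
      \<open>lebesgue\<close> supplies it from equality almost everywhere.\<close>
    moreover have "covariogram \<phi> K \<in> borel_measurable lebesgue"
      by (rule borel_measurable_AE[OF hl]) (use AE_eq in \<open>auto simp: eq_commute\<close>)
    ultimately show ?thesis
      using has_bochner_integral_cong_AE[of "covariogram \<phi> K" lebesgue h] AE_eq by blast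
  qed
  have III: "closure {x. covariogram \<phi> K x \<noteq> 0} = difference_body K"
  proof
    have "covariogram \<phi> K x = 0" if "x \<notin> difference_body K" for x
      using that \<phi>0 by (simp add: covariogram_def K.difference_body_iff)
    then show "closure {x. covariogram \<phi> K x \<noteq> 0} \<subseteq> difference_body K"
      by (intro closure_minimal compact_imp_closed K.difference_body_compact) auto
    \<comment> \<open>For interior \<open>p\<close> and \<open>q\<close> the two translates share
      the interior point \<open>p\<close>, so their intersection is a body. Differences of interior
      points are dense in the difference body, which suffices for the closure.\<close>
    have pos: "covariogram \<phi> K (p - q) \<noteq> 0" if pq: "p \<in> interior K" "q \<in> interior K" for p q
    proof -
      let ?L = "K \<inter> (\<lambda>y. y + (p - q)) ` K"
      interpret T: planar_body "(\<lambda>y. y + (p - q)) ` K" by (rule planar_body_translate) unfold_locales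
      have "(\<lambda>y. y + (p - q)) ` K = (+) (p - q) ` K" by (simp add: add.commute)
      then have "p \<in> interior ((\<lambda>y. y + (p - q)) ` K)"
        using pq(2) by (auto simp: interior_translation intro: image_eqI[of _ _ q])
      then have "interior ?L \<noteq> {}" using pq(1) by (auto simp: interior_Int)
      then have "planar_convex_body ?L"
        using K.Int_translate_compacts by (simp add: planar_convex_body_def)
      then interpret L: planar_body ?L by (simp add: planar_body_def)
      have "0 < per B ?L + \<alpha> * vol ?L"
      proof (cases "\<alpha> = 0")
        case False
        then have "0 < \<alpha> * vol ?L" using assms(4) L.vol_pos by simp
        then show ?thesis using L.per_nonneg[OF N] by linarith
      next
        case True
        \<comment> \<open>With \<open>\<alpha> = 0\<close> positivity has to come from the
          perimeter; a vanishing gauge would make \<open>\<phi>\<close> vanish on all convex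
          compacts, against the hypothesis.\<close>
        have "\<exists>d. gauge_norm B d \<noteq> 0"
        proof (rule ccontr)
          assume "\<nexists>d. gauge_norm B d \<noteq> 0"
          then have "\<phi> L = 0" if "L \<in> convex_compacts" for L
            using \<phi>[OF that] per_zero[OF N that] True by simp
          then show False using assms(2) by blast
        qed
        then show ?thesis using L.per_pos[OF N] True by auto
      qed
      then show ?thesis by (simp add: covariogram_def \<phi> K.Int_translate_compacts)
    qed
    let ?f = "\<lambda>(x, y). x - (y :: real^2)"
    have "difference_body K = ?f ` closure (interior K \<times> interior K)"
      by (simp add: K.difference_body_eq closure_Times K.closure_interior)
    also have "\<dots> \<subseteq> closure (?f ` (interior K \<times> interior K))"
      by (rule image_closure_subset) (auto simp: split_def intro!: continuous_intros closure_subset)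
    also have "\<dots> \<subseteq> closure {x. covariogram \<phi> K x \<noteq> 0}"
      using pos by (intro closure_mono) auto
    finally show "difference_body K \<subseteq> closure {x. covariogram \<phi> K x \<noteq> 0}" .
  qed
  have IV1: "concave_on (difference_body K) (covariogram (per B) K)"
    by (rule K.concave_covariogram) (rule per_combination[OF N])
  have "concave_on (difference_body K) (covariogram (\<lambda>L. sqrt (vol L)) K)"
    by (rule K.concave_covariogram) (rule brunn_minkowski)
  then have IV2: "concave_on (difference_body K) (\<lambda>x. sqrt (covariogram vol K x))"
    by (simp add: covariogram_def[abs_def])
  show ?thesis using I1 I2 II III IV1 IV2 by blast
qed

end
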